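(* For every $N_0\in\mathbb N$ there exists $\kappa_0>0$ such that for $\kappa\in(0,\kappa_0)$ the operator $\mathcal H_{\mathsf{toy}}(\kappa)$ has at least $N_0$ eigenvalues below $1$. Denoting by $\lambda_{\mathsf{toy},n}(\kappa)$ the increasing sequence of these eigenvalues, for $1\le n\le N_0$ and $\kappa$ small enough one has the convergent expansions $$\lambda_{\mathsf{toy},n}(\kappa)=\kappa^{2/3}\sum_{j=0}^{\infty}\alpha_{j,n}\kappa^{j/3}\quad\text{with}\quad \alpha_{0,n}=z_{\mathsf A}(n).$$
   Context: For $\kappa>0$, $\mathcal H_{\mathsf{toy}}(\kappa)=-\kappa^2\partial_z^2+W(z)$ is the self-adjoint operator on $L^2(\mathbb R)$ associated with the quadratic form $\int_{\mathbb R}(\kappa^2|u'|^2+W|u|^2)\,dz$, where $W(z)=-z$ for $z\le0$ and $W(z)=1$ for $z\ge0$. Its essential spectrum is $[1,\infty)$. $\mathsf A(x)=\mathrm{Ai}(-x)$ is the reversed Airy function and $z_{\mathsf A}(n)$ its $n$-th positive zero. *)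

theory Defs
  imports "HOL-Analysis.Analysis"
begin

text \<open>Maclaurin-series definition of the Airy function (DLMF 9.4.1):
  Ai(x) = Ai(0) f(x) + Ai'(0) g(x), with Ai(0) = 1/(3^(2/3) Gamma(2/3)),
  Ai'(0) = -1/(3^(1/3) Gamma(1/3)).\<close>

definition airy_f :: "real \<Rightarrow> real" where
  "airy_f x = (\<Sum>k. 3 ^ k * pochhammer (1/3) k * x ^ (3*k) / fact (3*k))"

definition airy_g :: "real \<Rightarrow> real" where
  "airy_g x = (\<Sum>k. 3 ^ k * pochhammer (2/3) k * x ^ (3*k+1) / fact (3*k+1))"

definition airy_Ai :: "real \<Rightarrow> real" where
  "airy_Ai x = airy_f x / (3 powr (2/3) * Gamma (2/3))
             - airy_g x / (3 powr (1/3) * Gamma (1/3))"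

definition airyA :: "real \<Rightarrow> real" where
  "airyA x = airy_Ai (- x)"

definition nth_smallest :: "real set \<Rightarrow> nat \<Rightarrow> real" where
  "nth_smallest S n = (THE x. x \<in> S \<and> finite {y \<in> S. y < x} \<and> card {y \<in> S. y < x} = n - 1)"

definition zA :: "nat \<Rightarrow> real" where
  "zA n = nth_smallest {x. 0 < x \<and> airyA x = 0} n"

definition toy_W :: "real \<Rightarrow> real" where
  "toy_W z = (if z \<le> 0 then - z else 1)"

text \<open>Form domain: u in H^1(R) (u locally absolutely continuous with weak derivative du,
  u, du in L^2) with integral of |W| u^2 finite.\<close>
definition toy_form_dom :: "(real \<Rightarrow> real) \<Rightarrow> (real \<Rightarrow> real) \<Rightarrow> bool" where
  "toy_form_dom u du \<longleftrightarrow>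
     u \<in> borel_measurable lborel \<and> du \<in> borel_measurable lborel \<and>
     integrable lborel (\<lambda>x. (u x)\<^sup>2) \<and> integrable lborel (\<lambda>x. (du x)\<^sup>2) \<and>
     integrable lborel (\<lambda>x. \<bar>toy_W x\<bar> * (u x)\<^sup>2) \<and>
     (\<forall>a b. a \<le> b \<longrightarrow> set_integrable lborel {a..b} du \<and>
                        u b - u a = (\<integral>x\<in>{a..b}. du x \<partial>lborel))"

definition toy_form :: "real \<Rightarrow> (real \<Rightarrow> real) \<Rightarrow> (real \<Rightarrow> real) \<Rightarrow> (real \<Rightarrow> real) \<Rightarrow> (real \<Rightarrow> real) \<Rightarrow> real" where
  "toy_form \<kappa> u du v dv =
     \<kappa>\<^sup>2 * (\<integral>x. du x * dv x \<partial>lborel) + (\<integral>x. toy_W x * u x * v x \<partial>lborel)"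

text \<open>lambda is an eigenvalue of the self-adjoint operator associated with the form:
  there is a nonzero u in the form domain with q(u,v) = lambda <u,v> for all v in the form domain.\<close>
definition toy_eigenvalue :: "real \<Rightarrow> real \<Rightarrow> bool" where
  "toy_eigenvalue \<kappa> lam \<longleftrightarrow>
     (\<exists>u du. toy_form_dom u du \<and> (\<integral>x. (u x)\<^sup>2 \<partial>lborel) > 0 \<and>
        (\<forall>v dv. toy_form_dom v dv \<longrightarrow>
            toy_form \<kappa> u du v dv = lam * (\<integral>x. u x * v x \<partial>lborel)))"

definition toy_ev_below1 :: "real \<Rightarrow> real set" where
  "toy_ev_below1 \<kappa> = {lam. lam < 1 \<and> toy_eigenvalue \<kappa> lam}"

definition toy_ev :: "real \<Rightarrow> nat \<Rightarrow> real" where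
  "toy_ev \<kappa> n = nth_smallest (toy_ev_below1 \<kappa>) n"

end

theory Submission
  imports Defs "HOL-Complex_Analysis.Complex_Analysis"
begin

text \<open>
  Put \<open>\<kappa> = h\<^sup>3\<close> and \<open>\<lambda> = h\<^sup>2 m\<close>. To the left of the origin the square-integrable solutions of the
  eigenvalue equation are multiples of \<open>A((z + \<lambda>) / h\<^sup>2)\<close>, to the right they are multiples of
  \<open>exp (- sqrt (1 - \<lambda>) z / \<kappa>)\<close>; on each side this follows because the Wronskian of an eigenfunction
  with the decaying solution is constant and integrable, hence zero. So \<open>\<lambda>\<close> is an eigenvalue below 1
  iff \<open>h A'(m) + sqrt (1 - h\<^sup>2 m) A(m) = 0\<close>. With \<open>r = A / A'\<close> this equation can be solved for \<open>h\<close>, namely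
  \<open>h = - r(m) / sqrt (1 + m r(m)\<^sup>2)\<close>, whose right-hand side is analytic with derivative \<open>-1\<close> at each
  (simple) zero of \<open>A\<close>. Its local inverse is the convergent expansion in \<open>h = \<kappa>\<^sup>1\<^sup>/\<^sup>3\<close>, and for small \<open>h\<close>
  a compactness argument leaves no other roots in a bounded range of \<open>m\<close>.

  That the Maclaurin series with the prescribed Gamma values is square integrable at \<open>+\<infinity>\<close> comes from
  an integral representation bounding it on \<open>x \<ge> 0\<close>: since \<open>(y y')' = y'\<^sup>2 + x y\<^sup>2\<close>, a bounded solution
  has \<open>y y' \<le> 0\<close> there, and so \<open>y'\<^sup>2 + x y\<^sup>2\<close> is integrable.
\<close>

section \<open>Power series solutions of the Airy equation\<close>

text \<open>The exponents come from the scaling z = h^2 y: for \<kappa> = h^3 the kinetic term and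
  the linear potential both acquire the factor h^2, so h = \<kappa>^(1/3) is the natural parameter.
  At h = 0 the matching condition degenerates to the Dirichlet condition A(m) = 0: the step on the
  right acts as a wall in the limit, which is why the leading coefficients are the zeros of A.

  Three obstacles shape the proof. Eigenvalues are given by the quadratic form alone, so an
  eigenfunction must be shown to be C^1, with a second derivative off 0, before any Wronskian can be
  formed. Convergence of the expansion, as opposed to an asymptotic statement, calls for complex
  analyticity; hence the Airy solutions are set up for real and complex arguments at once, and
  conjugation symmetry brings the complex inverse back to the real line. Finally, numbering the
  eigenvalues requires that no root is missed, so local uniqueness on each branch has to be combined
  with the exclusion of roots far from all zeros.\<close>

fun airy_coeff :: "real \<Rightarrow> real \<Rightarrow> nat \<Rightarrow> real" where
  "airy_coeff p q 0 = p"
| "airy_coeff p q (Suc 0) = q"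
| "airy_coeff p q (Suc (Suc 0)) = 0"
| "airy_coeff p q (Suc (Suc (Suc n))) = airy_coeff p q n / (real (n + 2) * real (n + 3))"

text \<open>Solution of y'' = z y with y(0) = \<open>p\<close> and y'(0) = \<open>q\<close>; the
  coefficient of z^2 vanishes because y''(0) = 0. The argument type is left open so that real and
  complex Airy functions share one series.\<close>

definition airy_sol :: "real \<Rightarrow> real \<Rightarrow> 'a \<Rightarrow> 'a::{real_normed_field,banach}" where
  "airy_sol p q z = (\<Sum>n. of_real (airy_coeff p q n) * z ^ n)"

definition airy_sol_deriv :: "real \<Rightarrow> real \<Rightarrow> 'a \<Rightarrow> 'a::{real_normed_field,banach}" where
  "airy_sol_deriv p q z = (\<Sum>n. diffs (\<lambda>n. of_real (airy_coeff p q n)) n * z ^ n)"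

text \<open>Of the two denominators in the recursion only one is kept: it dominates
  \<open>Suc (n div 3)\<close>, so three steps of the index pay for one step of the
  factorial.\<close>

lemma abs_airy_coeff_le: "\<bar>airy_coeff p q n\<bar> \<le> (\<bar>p\<bar> + \<bar>q\<bar>) / fact (n div 3)"
proof (induction p q n rule: airy_coeff.induct)
  case (4 p q n)
  have 1: "Suc (Suc (Suc n)) div 3 = Suc (n div 3)" by simp
  have "\<bar>airy_coeff p q (Suc (Suc (Suc n)))\<bar> = \<bar>airy_coeff p q n\<bar> / (real (n + 2) * real (n + 3))"
    by (simp add: abs_mult)
  also have "\<dots> \<le> ((\<bar>p\<bar> + \<bar>q\<bar>) / fact (n div 3)) / (1 * real (Suc (n div 3)))"
    by (intro frac_le 4 mult_mono) auto
  also have "\<dots> = (\<bar>p\<bar> + \<bar>q\<bar>) / fact (Suc (n div 3))"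
    by (simp add: field_simps)
  finally show ?case unfolding 1 .
qed auto

lemma summable_airy_coeff:
  fixes z :: "'a::{real_normed_field,banach}"
  shows "summable (\<lambda>n. of_real (airy_coeff p q n) * z ^ n)"
proof (rule summable_comparison_test')
  define r where "r = max 1 (norm z)"
  have r: "r \<ge> 1" "norm z \<le> r" by (auto simp: r_def)
  define C where "C = \<bar>p\<bar> + \<bar>q\<bar>"
  have C: "C \<ge> 0" by (simp add: C_def)
  \<comment> \<open>The majorant depends on n only through \<open>n div 3\<close>: as r \<ge> 1, the
    leftover power r^(n mod 3) is at most r^2.\<close>
  define f where "f n = C * r ^ 2 * ((r ^ 3) ^ (n div 3) / fact (n div 3))" for n :: nat
  show "norm (of_real (airy_coeff p q n) * z ^ n) \<le> f n" if "n \<ge> 0" for n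
  proof -
    have "norm z ^ n \<le> r ^ n" using r by (intro power_mono) auto
    also have "r ^ n = r ^ (n mod 3) * (r ^ 3) ^ (n div 3)"
      by (simp add: power_mult[symmetric] power_add[symmetric])
    also have "\<dots> \<le> r ^ 2 * (r ^ 3) ^ (n div 3)"
      using r by (intro mult_right_mono power_increasing) auto
    finally have "norm z ^ n \<le> r ^ 2 * (r ^ 3) ^ (n div 3)" .
    then have "\<bar>airy_coeff p q n\<bar> * norm z ^ n \<le> (C / fact (n div 3)) * (r ^ 2 * (r ^ 3) ^ (n div 3))"
      unfolding C_def by (intro mult_mono abs_airy_coeff_le) auto
    then show ?thesis by (simp add: f_def norm_mult norm_power field_simps)
  qed
  have fnn: "f n \<ge> 0" for n using r C by (auto simp: f_def)
  have S: "summable (\<lambda>k. (r ^ 3) ^ k / fact k)"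
    using summable_exp[of "r^3"] by (simp add: field_simps)
  show "summable f"
  proof (rule bounded_imp_summable)
    show "f n \<ge> 0" for n by (rule fnn)
    fix n
    \<comment> \<open>Padding to complete blocks of three equal terms turns the partial sum into
      \<open>3 * C * r ^ 2\<close> times a partial sum of the series of exp (r^3).\<close>
    have "sum f {..n} \<le> sum f {..<3 * Suc n}" by (intro sum_mono2 fnn) auto
    also have "\<dots> = (\<Sum>k<Suc n. 3 * (C * r ^ 2 * ((r ^ 3) ^ k / fact k)))"
    proof (induction n)
      case 0
      have "{..<3 * Suc 0} = {0, 1, 2::nat}" by auto
      then show ?case by (simp add: f_def)
    next
      case (Suc n)
      have "3 * Suc n div 3 = Suc n" "(3 * Suc n + 1) div 3 = Suc n" "(3 * Suc n + 2) div 3 = Suc n" by auto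
      then have "f (3 * Suc n) + f (3 * Suc n + 1) + f (3 * Suc n + 2)
         = 3 * (C * r ^ 2 * ((r ^ 3) ^ Suc n / fact (Suc n)))"
        by (simp only: f_def)
      moreover have "sum f {..<3 * Suc (Suc n)} = sum f {..<3 * Suc n} + (f (3 * Suc n) + f (3 * Suc n + 1) + f (3 * Suc n + 2))"
      proof -
        have "3 * Suc (Suc n) = Suc (Suc (Suc (3 * Suc n)))" by simp
        then show ?thesis by (simp only: sum.lessThan_Suc) simp
      qed
      ultimately show ?case using Suc.IH by simp
    qed
    also have "\<dots> = 3 * C * r ^ 2 * (\<Sum>k<Suc n. (r ^ 3) ^ k / fact k)"
      by (simp only: sum_distrib_left mult.assoc)
    also have "\<dots> \<le> 3 * C * r ^ 2 * (\<Sum>k. (r ^ 3) ^ k / fact k)"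
      using r C by (intro mult_left_mono sum_le_suminf S) auto
    finally show "sum f {..n} \<le> 3 * C * r ^ 2 * (\<Sum>k. (r ^ 3) ^ k / fact k)" .
  qed
qed

lemma airy_sol_has_derivative:
  "(airy_sol p q has_field_derivative airy_sol_deriv p q z) (at z)"
  unfolding airy_sol_def[abs_def] airy_sol_deriv_def
  by (rule termdiffs_strong_converges_everywhere[OF summable_airy_coeff])

text \<open>Two formal differentiations undo the recursion: (n+2)(n+3) c_(n+3) is c_n again, and the
  constant term is 2 c_2 = 0.\<close>

lemma airy_sol_deriv_has_derivative:
  fixes z :: "'a::{real_normed_field,banach}"
  shows "(airy_sol_deriv p q has_field_derivative z * airy_sol p q z) (at z)"
proof -
  let ?c = "\<lambda>n. of_real (airy_coeff p q n) :: 'a"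
  have s: "summable (\<lambda>n. diffs ?c n * y ^ n)" for y
    by (rule termdiff_converges_all[OF summable_airy_coeff])
  have D: "(airy_sol_deriv p q has_field_derivative (\<Sum>n. diffs (diffs ?c) n * z ^ n)) (at z)"
    unfolding airy_sol_deriv_def[abs_def]
    by (rule termdiffs_strong_converges_everywhere[OF s])
  have d: "diffs (diffs ?c) (Suc n) = ?c n" for n
  proof -
    have "diffs (diffs ?c) (Suc n) = of_real (real (n + 2) * (real (n + 3) * airy_coeff p q (Suc (Suc (Suc n)))))"
      by (simp add: diffs_def add.commute del: airy_coeff.simps)
    also have "real (n + 2) * (real (n + 3) * airy_coeff p q (Suc (Suc (Suc n)))) = airy_coeff p q n"
      by (simp del: of_nat_add)
    finally show ?thesis .
  qed
  have "(\<lambda>n. ?c n * z ^ n) sums airy_sol p q z"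
    unfolding airy_sol_def by (rule summable_sums[OF summable_airy_coeff])
  then have "(\<lambda>n. z * (?c n * z ^ n)) sums (z * airy_sol p q z)"
    by (rule sums_mult)
  then have "(\<lambda>n. diffs (diffs ?c) (Suc n) * z ^ Suc n) sums (z * airy_sol p q z)"
    by (simp add: d mult_ac)
  moreover have "diffs (diffs ?c) 0 = 0" by (simp add: diffs_def numeral_2_eq_2)
  ultimately have "(\<lambda>n. diffs (diffs ?c) n * z ^ n) sums (z * airy_sol p q z)"
    by (subst (asm) sums_Suc_iff) simp
  then show ?thesis using D by (simp add: sums_iff)
qed

lemma airy_sol_0: "airy_sol p q 0 = of_real p"
  by (simp add: airy_sol_def)

lemma airy_sol_of_real:
  "airy_sol p q (of_real x :: 'a::{real_normed_field,banach}) = of_real (airy_sol p q x)"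
  using suminf_of_real[OF summable_airy_coeff[of p q x], where 'a = 'a] by (simp add: airy_sol_def)

lemma airy_sol_deriv_of_real:
  "airy_sol_deriv p q (of_real x :: 'a::{real_normed_field,banach}) = of_real (airy_sol_deriv p q x)"
proof -
  have "summable (\<lambda>n. diffs (\<lambda>n. airy_coeff p q n) n * x ^ n)"
    using termdiff_converges_all[OF summable_airy_coeff[of p q], of x] by (simp add: diffs_def)
  from suminf_of_real[OF this, where 'a = 'a] show ?thesis
    by (simp add: airy_sol_deriv_def diffs_def)
qed

text \<open>The coefficients are real, so conjugation passes through the series. This symmetry later
  makes the complex inverse function real on real arguments.\<close>

lemma airy_sol_cnj: "airy_sol p q (cnj z) = cnj (airy_sol p q z)"
proof -
  have "(\<lambda>n. cnj (of_real (airy_coeff p q n) * z ^ n)) sums cnj (airy_sol p q z)"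
    unfolding sums_cnj airy_sol_def by (rule summable_sums[OF summable_airy_coeff])
  then show ?thesis by (simp add: airy_sol_def sums_iff)
qed

lemma airy_sol_deriv_cnj: "airy_sol_deriv p q (cnj z) = cnj (airy_sol_deriv p q z)"
proof -
  have "(\<lambda>n. cnj (diffs (\<lambda>n. of_real (airy_coeff p q n)) n * z ^ n)) sums cnj (airy_sol_deriv p q z)"
    unfolding sums_cnj airy_sol_deriv_def by (rule summable_sums[OF termdiff_converges_all[OF summable_airy_coeff]])
  then show ?thesis by (simp add: airy_sol_deriv_def sums_iff diffs_def)
qed

section \<open>Identification with the Maclaurin series of the definition\<close>

lemma airy_coeff_linear: "airy_coeff p q n = p * airy_coeff 1 0 n + q * airy_coeff 0 1 n"
  by (induction p q n rule: airy_coeff.induct) (auto simp: add_divide_distrib)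

lemma airy_sol_scale: "airy_sol (c * p) (c * q) (x::real) = c * airy_sol p q x"
proof -
  have "airy_coeff (c * p) (c * q) n = c * airy_coeff p q n" for n
    by (induction p q n rule: airy_coeff.induct) auto
  then show ?thesis
    using suminf_mult[OF summable_airy_coeff[of p q x], of c] by (simp add: airy_sol_def mult.assoc)
qed

text \<open>The recursion never mixes residues mod 3, so the starting values 1, 0, 0 leave only
  multiples of 3. The Pochhammer step contributes 3k+1, the one factor of (3k+3)!/(3k)! that is
  missing from the denominator (3k+2)(3k+3).\<close>

lemma airy_coeff_f: "airy_coeff 1 0 (3*k) = 3 ^ k * pochhammer (1/3) k / fact (3*k)"
    "airy_coeff 1 0 (3*k+1) = 0" "airy_coeff 1 0 (3*k+2) = 0"
proof -
  show "airy_coeff 1 0 (3*k) = 3 ^ k * pochhammer (1/3) k / fact (3*k)"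
  proof (induction k)
    case (Suc k)
    have frac: "(P / F) / (b * c) = (a * P) / (c * (b * (a * F)))" if "a \<noteq> 0" for a b c P F :: real
      using that by simp
    have k: "3 * Suc k = Suc (Suc (Suc (3*k)))" by simp
    have "airy_coeff 1 0 (3 * Suc k) = airy_coeff 1 0 (3*k) / (real (3*k + 2) * real (3*k + 3))"
      unfolding k by simp
    moreover have "(fact (3 * Suc k) :: real) = real (3*k+3) * (real (3*k+2) * (real (3*k+1) * fact (3*k)))"
      unfolding k by simp
    moreover have "3 ^ Suc k * pochhammer (1/3) (Suc k) = real (3*k+1) * (3 ^ k * pochhammer (1/3::real) k)"
      by (simp add: pochhammer_rec' algebra_simps)
    ultimately show ?case unfolding Suc.IH by (simp only: frac[of "real (3*k+1)"])
  qed simp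
  show "airy_coeff 1 0 (3*k+1) = 0"
  proof (induction k)
    case (Suc k)
    have "3 * Suc k+1 = Suc (Suc (Suc (3*k+1)))" by simp
    then show ?case using Suc by (simp only: airy_coeff.simps; simp)
  qed simp
  show "airy_coeff 1 0 (3*k+2) = 0"
  proof (induction k)
    case (Suc k)
    have "3 * Suc k+2 = Suc (Suc (Suc (3*k+2)))" by simp
    then show ?case using Suc by (simp only: airy_coeff.simps; simp)
  qed (simp add: numeral_2_eq_2)
qed

lemma airy_coeff_g: "airy_coeff 0 1 (3*k+1) = 3 ^ k * pochhammer (2/3) k / fact (3*k+1)"
    "airy_coeff 0 1 (3*k) = 0" "airy_coeff 0 1 (3*k+2) = 0"
proof -
  show "airy_coeff 0 1 (3*k+1) = 3 ^ k * pochhammer (2/3) k / fact (3*k+1)"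
  proof (induction k)
    case (Suc k)
    have frac: "(P / F) / (b * c) = (a * P) / (c * (b * (a * F)))" if "a \<noteq> 0" for a b c P F :: real
      using that by simp
    have k: "3 * Suc k + 1 = Suc (Suc (Suc (3*k+1)))" by simp
    have "airy_coeff 0 1 (3 * Suc k + 1) = airy_coeff 0 1 (3*k+1) / (real (3*k + 3) * real (3*k + 4))"
      unfolding k airy_coeff.simps by (simp add: ac_simps)
    moreover have "(fact (3 * Suc k + 1) :: real) = real (3*k+4) * (real (3*k+3) * (real (3*k+2) * fact (3*k+1)))"
      unfolding k by (simp add: algebra_simps)
    moreover have "3 ^ Suc k * pochhammer (2/3) (Suc k) = real (3*k+2) * (3 ^ k * pochhammer (2/3::real) k)"
      by (simp add: pochhammer_rec' algebra_simps)
    ultimately show ?case unfolding Suc.IH by (simp only:) (rule frac, simp)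
  qed simp
  show "airy_coeff 0 1 (3*k) = 0"
  proof (induction k)
    case (Suc k)
    have "3 * Suc k = Suc (Suc (Suc (3*k)))" by simp
    then show ?case using Suc by (simp only: airy_coeff.simps; simp)
  qed simp
  show "airy_coeff 0 1 (3*k+2) = 0"
  proof (induction k)
    case (Suc k)
    have "3 * Suc k+2 = Suc (Suc (Suc (3*k+2)))" by simp
    then show ?case using Suc by (simp only: airy_coeff.simps; simp)
  qed (simp add: numeral_2_eq_2)
qed

lemma nat_mod_3_cases:
  obtains k where "n = 3 * k" | k where "n = 3 * k + 1" | k where "n = 3 * k + (2::nat)"
proof -
  have "n = 3 * (n div 3) + n mod 3" by simp
  moreover have "n mod 3 = 0 \<or> n mod 3 = 1 \<or> n mod 3 = 2" by linarith
  ultimately show ?thesis using that[of "n div 3"] by fastforce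
qed

lemma airy_f_eq: "airy_f x = airy_sol 1 0 x"
proof -
  have "(\<lambda>n. airy_coeff 1 0 n * x ^ n) sums airy_sol 1 0 x"
    using summable_sums[OF summable_airy_coeff[of 1 0 x]] by (simp add: airy_sol_def)
  moreover have "strict_mono (\<lambda>k::nat. 3 * k)" by (simp add: strict_mono_def)
  moreover have "airy_coeff 1 0 n * x ^ n = 0" if "n \<notin> range (\<lambda>k. 3 * k)" for n
    using that airy_coeff_f(2,3) by (cases n rule: nat_mod_3_cases) (simp_all only: mult_zero_left, auto)
  ultimately have "(\<lambda>k. airy_coeff 1 0 (3 * k) * x ^ (3 * k)) sums airy_sol 1 0 x"
    by (subst sums_mono_reindex[where f="\<lambda>n. airy_coeff 1 0 n * x ^ n" and g="\<lambda>k. 3 * k"]) auto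
  then show ?thesis unfolding airy_f_def by (simp add: airy_coeff_f sums_iff)
qed

lemma airy_g_eq: "airy_g x = airy_sol 0 1 x"
proof -
  have "(\<lambda>n. airy_coeff 0 1 n * x ^ n) sums airy_sol 0 1 x"
    using summable_sums[OF summable_airy_coeff[of 0 1 x]] by (simp add: airy_sol_def)
  moreover have "strict_mono (\<lambda>k::nat. 3 * k + 1)" by (simp add: strict_mono_def)
  moreover have "airy_coeff 0 1 n * x ^ n = 0" if "n \<notin> range (\<lambda>k. 3 * k + 1)" for n
    using that airy_coeff_g(2,3) by (cases n rule: nat_mod_3_cases) (simp_all only: mult_zero_left, auto)
  ultimately have "(\<lambda>k. airy_coeff 0 1 (3 * k + 1) * x ^ (3 * k + 1)) sums airy_sol 0 1 x"
    by (subst sums_mono_reindex[where f="\<lambda>n. airy_coeff 0 1 n * x ^ n" and g="\<lambda>k. 3 * k + 1"]) auto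
  then show ?thesis unfolding airy_g_def by (simp only: airy_coeff_g times_divide_eq_left sums_iff)
qed

definition airy_Ai0 :: real where "airy_Ai0 = 1 / (3 powr (2/3) * Gamma (2/3))"
definition airy_Ai0' :: real where "airy_Ai0' = - 1 / (3 powr (1/3) * Gamma (1/3))"

lemma airy_Ai0_pos: "airy_Ai0 > 0"
  by (simp add: airy_Ai0_def Gamma_real_pos)

lemma airy_Ai_eq: "airy_Ai x = airy_sol airy_Ai0 airy_Ai0' x"
proof -
  let ?p = airy_Ai0 and ?q = airy_Ai0'
  have "(\<lambda>n. ?p * (airy_coeff 1 0 n * x ^ n) + ?q * (airy_coeff 0 1 n * x ^ n)) sums
     (?p * airy_sol 1 0 x + ?q * airy_sol 0 1 x)"
    using summable_sums[OF summable_airy_coeff[of 1 0 x]] summable_sums[OF summable_airy_coeff[of 0 1 x]]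
    by (intro sums_add sums_mult) (simp_all add: airy_sol_def)
  moreover have "?p * (airy_coeff 1 0 n * x ^ n) + ?q * (airy_coeff 0 1 n * x ^ n) = airy_coeff ?p ?q n * x ^ n" for n
    by (subst airy_coeff_linear[of ?p]) (simp add: algebra_simps)
  ultimately have "(\<lambda>n. airy_coeff ?p ?q n * x ^ n) sums (?p * airy_sol 1 0 x + ?q * airy_sol 0 1 x)"
    by simp
  then have "airy_sol ?p ?q x = ?p * airy_sol 1 0 x + ?q * airy_sol 0 1 x"
    by (simp add: airy_sol_def sums_iff)
  then show ?thesis
    by (simp add: airy_Ai_def airy_f_eq airy_g_eq airy_Ai0_def airy_Ai0'_def)
qed

section \<open>Boundedness of the Airy function on the positive half-line\<close>

text \<open>Bridge from gauge integrals, in which the Gamma and exponential integrals are stated, to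
  Bochner integrals, on which dominated convergence works; nonnegativity of the integrand makes the
  passage valid.\<close>

lemma has_bochner_integral_of_nonneg_has_integral:
  fixes f :: "real \<Rightarrow> real"
  assumes I: "(f has_integral I) S" and nn: "\<And>x. x \<in> S \<Longrightarrow> 0 \<le> f x"
    and m: "(\<lambda>x. indicator S x * f x) \<in> borel_measurable borel"
  shows "has_bochner_integral lborel (\<lambda>x. indicator S x * f x) I"
proof (rule has_bochner_integral_nn_integral)
  show "(\<lambda>x. indicator S x * f x) \<in> borel_measurable lborel" using m by simp
  show "AE x in lborel. 0 \<le> indicator S x * f x" using nn by (auto simp: indicator_def)
  show "0 \<le> I" using has_integral_nonneg[OF I nn] .
  show "(\<integral>\<^sup>+ x. ennreal (indicator S x * f x) \<partial>lborel) = ennreal I"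
    by (rule nn_integral_has_integral_lebesgue[OF nn I])
qed

lemma integrable_exp_mscale_half_line:
  fixes c :: real assumes "c > 0"
  shows "integrable lborel (\<lambda>x. indicator {0..} x * exp (- c * x))"
  by (rule has_bochner_integral_of_nonneg_has_integral[OF has_integral_exp_minus_to_infinity[OF assms],
        THEN integrable.intros]) auto

text \<open>Substitute t = s^3/3 in Euler's integral for Gamma((n+1)/3): dt = s^2 ds and
  (3t)^((n-2)/3) = s^(n-2).\<close>

lemma has_bochner_integral_airy_moment:
  "has_bochner_integral lborel (\<lambda>s. indicator {0..} s * (s ^ n * exp (- (s ^ 3) / 3)))
     (3 powr ((real n - 2) / 3) * Gamma ((real n + 1) / 3))"
proof -
  define I where "I = 3 powr ((real n - 2) / 3) * Gamma ((real n + 1) / 3)"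
  define f where "f t = (3 * t) powr ((real n - 2) / 3) * exp (- t)" for t :: real
  define g where "g s = s ^ 3 / 3" for s :: real
  have g_img: "g ` {0..} = {0..}"
  proof safe
    fix t :: real assume "t \<ge> 0"
    then have "t = g (root 3 (3 * t))" by (simp add: g_def)
    then show "t \<in> g ` {0..}" using \<open>t \<ge> 0\<close> by (intro image_eqI[of _ _ "root 3 (3 * t)"]) auto
  qed (auto simp: g_def)
  have inj: "inj_on g {0..}"
    by (auto simp: inj_on_def g_def dest: power_eq_imp_eq_base[of _ 3])
  have "((\<lambda>t. t powr ((real n + 1) / 3 - 1) / exp t) has_integral Gamma ((real n + 1) / 3)) {0..}"
    by (rule Gamma_integral_real) simp
  then have "((\<lambda>t. 3 powr ((real n - 2) / 3) * (t powr ((real n + 1) / 3 - 1) / exp t)) has_integral I) {0..}"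
    unfolding I_def by (rule has_integral_mult_right)
  moreover have "(real n + 1) / 3 - 1 = (real n - 2) / 3" by (simp add: field_simps)
  ultimately have fI: "(f has_integral I) {0..}"
    by (elim has_integral_eq[rotated]) (simp add: f_def powr_mult exp_minus field_simps)
  then have "f absolutely_integrable_on g ` {0..} \<and> integral (g ` {0..}) f = I"
    unfolding g_img by (auto simp: f_def intro!: nonnegative_absolutely_integrable_1)
  moreover have "(g has_field_derivative s ^ 2) (at s within {0..})" for s
    unfolding g_def by (auto intro!: derivative_eq_intros simp: power2_eq_square)
  ultimately have "(\<lambda>s. \<bar>s ^ 2\<bar> * f (g s)) absolutely_integrable_on {0..} \<and>
      integral {0..} (\<lambda>s. \<bar>s ^ 2\<bar> * f (g s)) = I"
    using has_absolute_integral_change_of_variables_1'[of "{0..}" g "\<lambda>s. s ^ 2" f I] inj by auto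
  then have h: "((\<lambda>s. \<bar>s ^ 2\<bar> * f (g s)) has_integral I) {0..}"
    using absolutely_integrable_on_def integrable_integral by blast
  \<comment> \<open>For n = 0 the two integrands differ at s = 0 (1 against 0), so the origin is
    discarded as a null set.\<close>
  have "((\<lambda>s. s ^ n * exp (- (s ^ 3) / 3)) has_integral I) {0..}"
  proof (rule has_integral_spike[OF negligible_sing[of 0] _ h])
    fix s :: real assume "s \<in> {0..} - {0}"
    then have s: "s > 0" by auto
    have "3 * g s = s powr real 3" using s by (simp add: g_def powr_realpow)
    then have "(3 * g s) powr ((real n - 2) / 3) = s powr (real 3 * ((real n - 2) / 3))"
      by (simp only: powr_powr)
    also have "real 3 * ((real n - 2) / 3) = real n - 2" by simp
    finally have 1: "(3 * g s) powr ((real n - 2) / 3) = s powr (real n - 2)" .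
    have "s ^ 2 * s powr (real n - 2) = s powr (real 2 + (real n - 2))"
      using s by (simp only: powr_add powr_realpow)
    also have "\<dots> = s ^ n" using s by (simp add: powr_realpow)
    finally have "s ^ 2 * (3 * g s) powr ((real n - 2) / 3) = s ^ n" unfolding 1 .
    then show "s ^ n * exp (- (s ^ 3) / 3) = \<bar>s ^ 2\<bar> * f (g s)"
      by (simp add: f_def g_def mult.assoc[symmetric])
  qed
  then show ?thesis unfolding I_def
    by (rule has_bochner_integral_of_nonneg_has_integral) auto
qed

lemma integrable_airy_weight:
  fixes x :: real
  shows "integrable lborel (\<lambda>s. indicator {0..} s * (exp (- (s ^ 3) / 3) * exp (x * s)))"
proof -
  \<comment> \<open>The slope \<open>a\<close> exceeds |x| by 1, so bounding s^3/3 below by its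
    tangent of slope \<open>a\<close>, taken at s = \<open>t\<close>, leaves the factor exp (-s).
    The inequality (s - t)^2 (s + 2t) \<ge> 0 is that tangent bound.\<close>
  define a where "a = \<bar>x\<bar> + 1"
  define t where "t = sqrt a"
  have t: "t > 0" "t ^ 2 = a" by (auto simp: t_def a_def)
  define K where "K = 2 * t ^ 3 / 3"
  have K: "x * s - s ^ 3 / 3 \<le> K - s" if "s \<ge> 0" for s
  proof -
    have "(s - t) ^ 2 * (s + 2 * t) \<ge> 0" using t that by auto
    also have "(s - t) ^ 2 * (s + 2 * t) = s ^ 3 + 2 * t ^ 3 - 3 * (s * t ^ 2)"
      by (simp add: power2_eq_square power3_eq_cube algebra_simps)
    finally have "s * a \<le> s ^ 3 / 3 + K" by (simp add: t K_def field_simps)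
    moreover have "x * s \<le> \<bar>x\<bar> * s" using that by (intro mult_right_mono) auto
    ultimately show ?thesis by (simp add: a_def algebra_simps)
  qed
  have "integrable lborel (\<lambda>s::real. exp K * (indicator {0..} s * exp (- 1 * s)))"
    by (intro integrable_mult_right integrable_exp_mscale_half_line) simp
  then show ?thesis
  proof (rule Bochner_Integration.integrable_bound)
    show "AE s in lborel. norm (indicator {0..} s * (exp (- (s ^ 3) / 3) * exp (x * s)))
           \<le> norm (exp K * (indicator {0..} s * exp (- 1 * s)))"
    proof (rule AE_I2)
      fix s :: real
      show "norm (indicator {0..} s * (exp (- (s ^ 3) / 3) * exp (x * s)))
           \<le> norm (exp K * (indicator {0..} s * exp (- 1 * s)))"
        using K[of s] by (auto simp: indicator_def abs_mult exp_add[symmetric] exp_diff[symmetric] exp_minus field_simps)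
    qed
  qed auto
qed

section \<open>The Airy integral on a rotated ray\<close>

abbreviation airy_omega :: complex where "airy_omega \<equiv> cis (2 * pi / 3)"

text \<open>These phases decide the Maclaurin coefficients: the opposite values at n = 0 and n = 1
  account for the signs of Ai(0) and Ai'(0), the vanishing value at n = 2 matches c_2 = 0, and
  omega^3 = 1 makes the pattern repeat.\<close>

lemma Re_airy_phase:
  "Re (cis (pi / 6) * airy_omega ^ 0) = sqrt 3 / 2"
  "Re (cis (pi / 6) * airy_omega ^ 1) = - (sqrt 3 / 2)"
  "Re (cis (pi / 6) * airy_omega ^ 2) = 0"
  "Re (cis (pi / 6) * airy_omega ^ (n + 3)) = Re (cis (pi / 6) * airy_omega ^ n)"
proof -
  show "Re (cis (pi / 6) * airy_omega ^ 0) = sqrt 3 / 2"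
    by (simp add: cos_30)
  have "Re (cis (pi / 6) * airy_omega ^ 1) = cos (pi / 6 + 2 * pi / 3)"
    by (simp only: power_one_right cis_mult cis.sel)
  also have "pi / 6 + 2 * pi / 3 = pi - pi / 6" by simp
  finally show "Re (cis (pi / 6) * airy_omega ^ 1) = - (sqrt 3 / 2)"
    by (simp only: cos_pi_minus cos_30)
  have "Re (cis (pi / 6) * airy_omega ^ 2) = cos (pi / 6 + (2 * pi / 3 + 2 * pi / 3))"
    by (simp only: power2_eq_square cis_mult cis.sel)
  also have "pi / 6 + (2 * pi / 3 + 2 * pi / 3) = pi / 2 + pi" by simp
  finally show "Re (cis (pi / 6) * airy_omega ^ 2) = 0"
    by (simp only: cos_add) simp
  have "airy_omega ^ 3 = 1" by (simp add: Complex.DeMoivre)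
  then show "Re (cis (pi / 6) * airy_omega ^ (n + 3)) = Re (cis (pi / 6) * airy_omega ^ n)"
    by (simp add: power_add)
qed

text \<open>
  On the ray of direction \<open>e\<^sup>i\<^sup>\<pi>\<^sup>/\<^sup>6\<close> the contour integral defining \<open>Ai\<close> converges absolutely.
  Term-by-term integration of the exponential identifies it with the Maclaurin series, while for
  \<open>x \<ge> 0\<close> the exponential is bounded by 1, because \<open>\<omega>\<close> has negative real part.
\<close>

lemma airy_integral_sums:
  fixes x :: real
  defines "d \<equiv> (\<lambda>n. Re (cis (pi / 6) * airy_omega ^ n) * (3 powr ((real n - 2) / 3) * Gamma ((real n + 1) / 3)) / fact n)"
  shows "(\<lambda>n. d n * x ^ n) sums
    (\<integral>s. indicator {0..} s * (exp (- (s ^ 3) / 3) * Re (cis (pi / 6) * exp (airy_omega * of_real (x * s)))) \<partial>lborel)"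
proof -
  define c where "c n = Re (cis (pi / 6) * airy_omega ^ n)" for n
  have c: "\<bar>c n\<bar> \<le> 1" for n
    using abs_Re_le_cmod[of "cis (pi / 6) * airy_omega ^ n"] by (simp add: c_def norm_mult norm_power)
  define T where "T n s = indicator {0..} s * (exp (- (s ^ 3) / 3) * (c n * (x * s) ^ n / fact n))" for n and s :: real
  \<comment> \<open>The majorant has |x| in place of x: the phases \<open>c n\<close> are at most 1
    in modulus, so every partial sum is bounded by the exponential series at |x| s.\<close>
  define w where "w s = indicator {0..} s * (exp (- (s ^ 3) / 3) * exp (\<bar>x\<bar> * s))" for s :: real
  define f where "f s = indicator {0..} s * (exp (- (s ^ 3) / 3) * Re (cis (pi / 6) * exp (airy_omega * of_real (x * s))))" for s :: real
  have Tint: "has_bochner_integral lborel (T n) (d n * x ^ n)" for n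
  proof -
    have "has_bochner_integral lborel (\<lambda>s. (c n * x ^ n / fact n) * (indicator {0..} s * (s ^ n * exp (- (s ^ 3) / 3))))
       ((c n * x ^ n / fact n) * (3 powr ((real n - 2) / 3) * Gamma ((real n + 1) / 3)))"
      by (intro has_bochner_integral_mult_right has_bochner_integral_airy_moment)
    then show ?thesis
      by (simp add: T_def[abs_def] d_def c_def power_mult_distrib mult_ac)
  qed
  have "(\<lambda>N. \<integral>s. (\<Sum>n<N. T n s) \<partial>lborel) \<longlonglongrightarrow> (\<integral>s. f s \<partial>lborel)"
  proof (rule integral_dominated_convergence[where w = w])
    show "integrable lborel w" unfolding w_def by (rule integrable_airy_weight)
    have [measurable]: "T n \<in> borel_measurable lborel" for n
      using Tint[of n] by (auto simp: has_bochner_integral_iff)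
    show "(\<lambda>s. \<Sum>n<N. T n s) \<in> borel_measurable lborel" for N by measurable
    have [measurable]: "(\<lambda>s. Re (cis (pi / 6) * exp (airy_omega * of_real (x * s)))) \<in> borel_measurable borel"
      by (intro borel_measurable_continuous_onI continuous_intros)
    show "f \<in> borel_measurable lborel" unfolding f_def by measurable
    show "AE s in lborel. (\<lambda>N. \<Sum>n<N. T n s) \<longlonglongrightarrow> f s"
    proof (rule AE_I2)
      fix s :: real
      have "(\<lambda>n. (airy_omega * of_real (x * s)) ^ n /\<^sub>R fact n) sums exp (airy_omega * of_real (x * s))"
        by (rule exp_converges)
      then have "(\<lambda>n. Re (cis (pi / 6) * ((airy_omega * of_real (x * s)) ^ n /\<^sub>R fact n)))
            sums Re (cis (pi / 6) * exp (airy_omega * of_real (x * s)))"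
        by (intro sums_Re sums_mult)
      moreover have "Re (cis (pi / 6) * ((airy_omega * of_real (x * s)) ^ n /\<^sub>R fact n)) = c n * (x * s) ^ n / fact n" for n
      proof -
        have "cis (pi / 6) * ((airy_omega * of_real (x * s)) ^ n /\<^sub>R fact n)
          = of_real ((x * s) ^ n / fact n) * (cis (pi / 6) * airy_omega ^ n)"
          unfolding power_mult_distrib scaleR_conv_of_real divide_inverse of_real_mult of_real_power by (simp only: mult_ac)
        moreover have "Re (of_real r * Z) = r * Re Z" for r Z by simp
        ultimately show ?thesis by (simp only: c_def) simp
      qed
      ultimately have "(\<lambda>n. c n * (x * s) ^ n / fact n) sums Re (cis (pi / 6) * exp (airy_omega * of_real (x * s)))"
        by simp
      then have "(\<lambda>n. T n s) sums f s"
        unfolding T_def f_def by (intro sums_mult)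
      then show "(\<lambda>N. \<Sum>n<N. T n s) \<longlonglongrightarrow> f s" by (simp add: sums_def)
    qed
    show "AE s in lborel. norm (\<Sum>n<N. T n s) \<le> w s" for N
    proof (rule AE_I2)
      fix s :: real
      show "norm (\<Sum>n<N. T n s) \<le> w s"
      proof (cases "s \<ge> 0")
        case True
        have "norm (\<Sum>n<N. T n s) \<le> (\<Sum>n<N. exp (- (s ^ 3) / 3) * ((\<bar>x\<bar> * s) ^ n / fact n))"
        proof (rule sum_norm_le)
          fix n
          have "\<bar>c n\<bar> * \<bar>(x * s) ^ n\<bar> \<le> 1 * (\<bar>x\<bar> * s) ^ n"
            using c True by (intro mult_mono) (auto simp: power_abs abs_mult)
          then show "norm (T n s) \<le> exp (- (s ^ 3) / 3) * ((\<bar>x\<bar> * s) ^ n / fact n)"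
            using True by (simp add: T_def abs_mult divide_right_mono)
        qed
        also have "\<dots> = exp (- (s ^ 3) / 3) * (\<Sum>n<N. (\<bar>x\<bar> * s) ^ n / fact n)"
          by (simp add: sum_distrib_left)
        also have "(\<Sum>n<N. (\<bar>x\<bar> * s) ^ n / fact n) \<le> exp (\<bar>x\<bar> * s)"
          unfolding exp_def using True summable_exp_generic[of "\<bar>x\<bar> * s"]
          by (simp add: scaleR_conv_of_real divide_inverse mult.commute sum_le_suminf)
        finally show ?thesis using True by (simp add: w_def)
      qed (simp add: T_def w_def)
    qed
  qed
  moreover have "(\<integral>s. (\<Sum>n<N. T n s) \<partial>lborel) = (\<Sum>n<N. d n * x ^ n)" for N
    using Tint by (subst Bochner_Integration.integral_sum) (auto simp: has_bochner_integral_iff)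
  ultimately show ?thesis by (simp add: sums_def f_def)
qed

text \<open>Raising n by 3 multiplies the power of 3 by 3 and, by the functional equation, Gamma by
  (n+1)/3. The resulting factor n+1 cancels against (n+3)!/n! and leaves the Airy denominator
  (n+2)(n+3).\<close>

lemma airy_integral_coeff:
  defines "d \<equiv> (\<lambda>n. Re (cis (pi / 6) * airy_omega ^ n) * (3 powr ((real n - 2) / 3) * Gamma ((real n + 1) / 3)) / fact n)"
  shows "d n = airy_coeff (d 0) (d 1) n"
proof -
  have "d n = airy_coeff p q n" if "p = d 0" "q = d 1" for p q
    using that
  proof (induction p q n rule: airy_coeff.induct)
    case (3 p q)
    show ?case using Re_airy_phase(3) by (simp add: d_def numeral_2_eq_2)
  next
    case (4 p q n)
    have n: "Suc (Suc (Suc n)) = n + 3" by simp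
    have f: "(fact (n + 3) :: real) = real (n+3) * (real (n+2) * (real (n+1) * fact n))"
      unfolding n[symmetric] by simp
    have p: "(3::real) powr ((real (n+3) - 2) / 3) = 3 * 3 powr ((real n - 2) / 3)"
    proof -
      have "(real (n+3) - 2) / 3 = 1 + (real n - 2) / 3" by (simp add: field_simps)
      then show ?thesis by (simp only: powr_add) simp
    qed
    have g: "Gamma ((real (n+3) + 1) / 3) = ((real n + 1) / 3) * Gamma ((real n + 1) / 3)"
    proof -
      have "(real n + 1) / 3 \<notin> \<int>\<^sub>\<le>\<^sub>0" by (auto elim!: nonpos_Ints_cases)
      from Gamma_plus1[OF this] show ?thesis by (simp add: field_simps)
    qed
    have "d (n + 3) = Re (cis (pi / 6) * airy_omega ^ n) * (3 * 3 powr ((real n - 2) / 3) * (((real n + 1) / 3) * Gamma ((real n + 1) / 3)))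
       / (real (n+3) * (real (n+2) * (real (n+1) * fact n)))"
      unfolding d_def Re_airy_phase(4) f p g ..
    also have "\<dots> = d n / (real (n+2) * real (n+3))"
      unfolding d_def by (simp add: divide_simps)
    also have "d n = airy_coeff p q n" using 4 by simp
    finally show ?case by (simp only: n[symmetric] airy_coeff.simps)
  qed simp_all
  then show ?thesis by blast
qed

text \<open>Boundedness is all that is extracted from the integral; the differential equation then
  upgrades it to square integrability.\<close>

lemma airy_Ai_bounded:
  obtains B where "\<And>x. x \<ge> 0 \<Longrightarrow> \<bar>airy_Ai x\<bar> \<le> B"
proof -
  define d where "d n = Re (cis (pi / 6) * airy_omega ^ n) * (3 powr ((real n - 2) / 3) * Gamma ((real n + 1) / 3)) / fact n" for n
  define f where "f x s = indicator {0..} s * (exp (- (s ^ 3) / 3) * Re (cis (pi / 6) * exp (airy_omega * of_real (x * s))))" for x s :: real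
  define B where "B = (\<integral>s. indicator {0..} s * (exp (- (s ^ 3) / 3) * exp (0 * (s::real))) \<partial>lborel)"
  have Bd: "\<bar>\<integral>s. f x s \<partial>lborel\<bar> \<le> B" if "x \<ge> 0" for x
  proof -
    have "norm (\<integral>s. f x s \<partial>lborel) \<le> (\<integral>s. indicator {0..} s * (exp (- (s ^ 3) / 3) * exp (0 * (s::real))) \<partial>lborel)"
    proof (rule Bochner_Integration.integral_norm_bound_integral)
      show "integrable lborel (\<lambda>s::real. indicator {0..} s * (exp (- (s ^ 3) / 3) * exp (0 * s)))"
        by (rule integrable_airy_weight)
      have bd: "norm (f x s) \<le> indicator {0..} s * (exp (- (s ^ 3) / 3) * exp (0 * s))" for s
      proof (cases "s \<ge> 0")
        case True
        have "\<bar>Re (cis (pi / 6) * exp (airy_omega * of_real (x * s)))\<bar> \<le> norm (cis (pi / 6) * exp (airy_omega * of_real (x * s)))"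
          by (rule abs_Re_le_cmod)
        also have "\<dots> = exp (- (x * s) / 2)"
          by (simp add: norm_mult cos_120)
        also have "\<dots> \<le> 1" using True that by simp
        finally show ?thesis using True by (simp add: f_def abs_mult)
      qed (simp add: f_def)
      have [measurable]: "(\<lambda>s. Re (cis (pi / 6) * exp (airy_omega * of_real (x * s)))) \<in> borel_measurable borel"
        by (intro borel_measurable_continuous_onI continuous_intros)
      have "f x \<in> borel_measurable lborel" unfolding f_def by measurable
      then show "integrable lborel (f x)"
        by (rule Bochner_Integration.integrable_bound[OF integrable_airy_weight[of 0]])
           (use bd in \<open>auto intro!: AE_I2 order.trans[OF bd]\<close>)
      show "norm (f x s) \<le> indicator {0..} s * (exp (- (s ^ 3) / 3) * exp (0 * s))" for s by (rule bd)
    qed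
    then show ?thesis by (simp add: B_def)
  qed
  have sol: "airy_sol (d 0) (d 1) x = (\<integral>s. f x s \<partial>lborel)" for x
  proof -
    have "airy_coeff (d 0) (d 1) n = d n" for n
      unfolding d_def by (rule airy_integral_coeff[symmetric])
    then have "airy_sol (d 0) (d 1) x = (\<Sum>n. d n * x ^ n)"
      unfolding airy_sol_def by simp
    with airy_integral_sums[of x, folded d_def f_def] show ?thesis by (simp only: sums_iff)
  qed
  \<comment> \<open>By Euler's reflection formula \<open>K\<close> is pi. Both initial values of the
    integral are \<open>K\<close> times those prescribed for Ai, so the two solutions are
    proportional.\<close>
  define K where "K = sqrt 3 / 2 * Gamma (1/3) * Gamma (2/3 :: real)"
  have g: "Gamma (1/3 :: real) > 0" "Gamma (2/3 :: real) > 0" by (auto intro: Gamma_real_pos)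
  have d: "d 0 = K * airy_Ai0" "d 1 = K * airy_Ai0'"
  proof -
    have "d 0 = sqrt 3 / 2 * (3 powr ((real 0 - 2) / 3) * Gamma ((real 0 + 1) / 3)) / fact 0"
      unfolding d_def Re_airy_phase ..
    moreover have "(real 0 - 2) / 3 = - (2 / 3)" by simp
    ultimately show "d 0 = K * airy_Ai0"
      using g(2)[THEN less_imp_neq] by (simp only: powr_minus_divide) (simp add: K_def airy_Ai0_def)
    have "d 1 = - (sqrt 3 / 2) * (3 powr ((real 1 - 2) / 3) * Gamma ((real 1 + 1) / 3)) / fact 1"
      unfolding d_def Re_airy_phase ..
    moreover have "(real 1 - 2) / 3 = - (1 / 3)" by simp
    ultimately show "d 1 = K * airy_Ai0'"
      using g(1)[THEN less_imp_neq] by (simp only: powr_minus_divide) (simp add: K_def airy_Ai0'_def)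
  qed
  have K: "K > 0" using g by (simp add: K_def)
  have eq: "(\<integral>s. f x s \<partial>lborel) = K * airy_Ai x" for x
    unfolding sol[symmetric] d airy_Ai_eq by (simp add: airy_sol_scale)
  have "\<bar>airy_Ai x\<bar> \<le> B / K" if "x \<ge> 0" for x
    using Bd[OF that, unfolded eq] K by (simp add: field_simps abs_mult)
  then show ?thesis using that by blast
qed

section \<open>The Airy equation on the real line\<close>

definition airy_Ai' :: "real \<Rightarrow> real" where
  "airy_Ai' x = airy_sol_deriv airy_Ai0 airy_Ai0' x"

definition airyA' :: "real \<Rightarrow> real" where
  "airyA' x = - airy_Ai' (- x)"

lemma airy_Ai_has_derivative [derivative_intros]:
  "(airy_Ai has_real_derivative airy_Ai' x) (at x)"
  using airy_sol_has_derivative[of airy_Ai0 airy_Ai0' x]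
  by (simp add: airy_Ai'_def airy_Ai_eq[abs_def])

lemma airy_Ai'_has_derivative [derivative_intros]:
  "(airy_Ai' has_real_derivative x * airy_Ai x) (at x)"
  using airy_sol_deriv_has_derivative[of airy_Ai0 airy_Ai0' x]
  by (simp add: airy_Ai'_def[abs_def] airy_Ai_eq)

lemma airyA_has_derivative: "(airyA has_real_derivative airyA' x) (at x)"
  unfolding airyA_def[abs_def] airyA'_def
  by (rule DERIV_cong[OF DERIV_chain2[OF airy_Ai_has_derivative, of uminus "- 1"]]) (auto intro!: derivative_eq_intros)

lemma airyA'_has_derivative: "(airyA' has_real_derivative - x * airyA x) (at x)"
proof -
  have "((\<lambda>x. airy_Ai' (- x)) has_real_derivative (- x * airy_Ai (- x)) * (- 1)) (at x)"
    by (rule DERIV_chain2[OF airy_Ai'_has_derivative]) (auto intro!: derivative_eq_intros)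
  from DERIV_minus[OF this] show ?thesis
    by (simp add: airyA'_def[abs_def] airyA_def)
qed

lemma continuous_on_airy_Ai [continuous_intros]: "continuous_on S f \<Longrightarrow> continuous_on S (\<lambda>x. airy_Ai (f x))"
  by (rule continuous_on_compose2[of UNIV airy_Ai])
    (auto intro!: DERIV_continuous_on[OF has_field_derivative_at_within[OF airy_Ai_has_derivative]])

lemma continuous_on_airy_Ai' [continuous_intros]: "continuous_on S f \<Longrightarrow> continuous_on S (\<lambda>x. airy_Ai' (f x))"
  by (rule continuous_on_compose2[of UNIV airy_Ai'])
    (auto intro!: DERIV_continuous_on[OF has_field_derivative_at_within[OF airy_Ai'_has_derivative]])

lemma continuous_on_airyA [continuous_intros]: "continuous_on S f \<Longrightarrow> continuous_on S (\<lambda>x. airyA (f x))"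
  unfolding airyA_def by (intro continuous_intros)

lemma continuous_on_airyA' [continuous_intros]: "continuous_on S f \<Longrightarrow> continuous_on S (\<lambda>x. airyA' (f x))"
  unfolding airyA'_def by (intro continuous_intros)

lemma airyA_0_pos: "airyA 0 > 0"
  using airy_Ai0_pos by (simp add: airyA_def airy_Ai_eq airy_sol_0)

section \<open>Energy estimate and square integrability\<close>

lemma deriv_ge_imp_linear_lower_bound:
  fixes f :: "real \<Rightarrow> real"
  assumes "\<And>x. x \<ge> a \<Longrightarrow> (f has_real_derivative f' x) (at x)" "\<And>x. x \<ge> a \<Longrightarrow> f' x \<ge> k" "x \<ge> a"
  shows "f x \<ge> f a + k * (x - a)"
proof -
  have "(\<lambda>x. f x - k * x) a \<le> (\<lambda>x. f x - k * x) x"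
  proof (rule DERIV_nonneg_imp_nondecreasing[OF \<open>x \<ge> a\<close>])
    fix t assume "a \<le> t" "t \<le> x"
    then have "((\<lambda>x. f x - k * x) has_real_derivative (f' t - k)) (at t)"
      by (auto intro!: derivative_eq_intros assms)
    then show "\<exists>y. ((\<lambda>x. f x - k * x) has_real_derivative y) (at t) \<and> 0 \<le> y"
      using assms(2)[of t] \<open>a \<le> t\<close> by force
  qed
  then show ?thesis by (simp add: algebra_simps)
qed

lemma airy_Ai_mult_deriv_has_derivative:
  "((\<lambda>x. airy_Ai x * airy_Ai' x) has_real_derivative ((airy_Ai' x)\<^sup>2 + x * (airy_Ai x)\<^sup>2)) (at x)"
  by (auto intro!: derivative_eq_intros simp: power2_eq_square algebra_simps)

lemma airy_Ai_mult_deriv_mono: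
  assumes "0 \<le> x" "x \<le> y"
  shows "airy_Ai x * airy_Ai' x \<le> airy_Ai y * airy_Ai' y"
proof (rule DERIV_nonneg_imp_nondecreasing[OF assms(2)])
  fix t assume "x \<le> t" "t \<le> y"
  then show "\<exists>d. ((\<lambda>x. airy_Ai x * airy_Ai' x) has_real_derivative d) (at t) \<and> 0 \<le> d"
    using airy_Ai_mult_deriv_has_derivative[of t] assms by fastforce
qed

text \<open>If y y' were positive at some point, it would stay at least as large to the right, and
  y^2, whose derivative is 2 y y', would outgrow every bound.\<close>

lemma airy_Ai_mult_deriv_nonpos:
  assumes "x \<ge> 0"
  shows "airy_Ai x * airy_Ai' x \<le> 0"
proof (rule ccontr)
  assume neg: "\<not> airy_Ai x * airy_Ai' x \<le> 0"
  define k where "k = 2 * (airy_Ai x * airy_Ai' x)"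
  have k: "k > 0" using neg by (simp add: k_def)
  obtain B where B: "\<And>x. x \<ge> 0 \<Longrightarrow> \<bar>airy_Ai x\<bar> \<le> B" using airy_Ai_bounded by blast
  \<comment> \<open>By this point the linear lower bound for Ai^2 has grown by B^2 + 1, beyond the
    bound B^2.\<close>
  define y where "y = x + (B\<^sup>2 + 1) / k"
  have y: "y \<ge> x" using k by (simp add: y_def)
  have "(airy_Ai y)\<^sup>2 \<ge> (airy_Ai x)\<^sup>2 + k * (y - x)"
  proof (rule deriv_ge_imp_linear_lower_bound[OF _ _ y])
    fix t assume t: "t \<ge> x"
    show "((\<lambda>x. (airy_Ai x)\<^sup>2) has_real_derivative 2 * (airy_Ai t * airy_Ai' t)) (at t)"
      by (auto intro!: derivative_eq_intros)
    show "k \<le> 2 * (airy_Ai t * airy_Ai' t)"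
      using airy_Ai_mult_deriv_mono[OF assms t] by (simp add: k_def)
  qed
  moreover have "k * (y - x) = B\<^sup>2 + 1" using k by (simp add: y_def)
  moreover have "(airy_Ai y)\<^sup>2 \<le> B\<^sup>2"
    using B[of y] y assms by (metis abs_le_square_iff abs_of_nonneg abs_ge_zero order.trans)
  ultimately show False using zero_le_power2[of "airy_Ai x"] by linarith
qed

lemma integrable_airy_energy:
  "set_integrable lborel {0..} (\<lambda>x. (airy_Ai' x)\<^sup>2 + x * (airy_Ai x)\<^sup>2)"
proof -
  define F where "F x = airy_Ai x * airy_Ai' x" for x
  define f where "f x = (airy_Ai' x)\<^sup>2 + x * (airy_Ai x)\<^sup>2" for x
  \<comment> \<open>\<open>F\<close> increases and is at most 0, so its limit is its supremum, and
    the integral of its derivative over the half-line is \<open>T - F 0\<close>.\<close>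
  define T where "T = (SUP x\<in>{0..}. F x)"
  have bdd: "bdd_above (F ` {0..})"
    using airy_Ai_mult_deriv_nonpos by (auto simp: F_def bdd_above_def)
  have le: "F x \<le> T" if "x \<ge> 0" for x
    unfolding T_def using that by (intro cSUP_upper bdd) auto
  have lim: "(F \<longlongrightarrow> T) at_top"
  proof (rule increasing_tendsto)
    show "\<forall>\<^sub>F x in at_top. F x \<le> T"
      using eventually_ge_at_top[of 0] by eventually_elim (rule le)
    fix t assume "t < T"
    then obtain x where x: "x \<ge> 0" "t < F x"
      unfolding T_def using bdd by (subst (asm) less_cSUP_iff) auto
    show "\<forall>\<^sub>F x in at_top. t < F x"
      using eventually_ge_at_top[of x]
    proof eventually_elim
      case (elim y)
      then show ?case using airy_Ai_mult_deriv_mono[of x y] x by (simp add: F_def)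
    qed
  qed
  have [measurable]: "f \<in> borel_measurable borel"
    unfolding f_def by (intro borel_measurable_continuous_onI continuous_intros)
  have nn: "f x \<ge> 0" if "x \<ge> 0" for x using that by (simp add: f_def)
  have nnint: "(\<integral>\<^sup>+x. ennreal (f x) * indicator {0..} x \<partial>lborel) = ennreal (T - F 0)"
    by (rule nn_integral_FTC_atLeast[OF \<open>f \<in> borel_measurable borel\<close> _ nn lim])
       (auto simp: F_def[abs_def] f_def airy_Ai_mult_deriv_has_derivative)
  have "has_bochner_integral lborel (\<lambda>x. indicator {0..} x * f x) (T - F 0)"
  proof (rule has_bochner_integral_nn_integral)
    show "0 \<le> T - F 0" using le[of 0] by simp
    show "AE x in lborel. 0 \<le> indicator {0..} x * f x" using nn by (auto simp: indicator_def)
    show "(\<integral>\<^sup>+x. ennreal (indicator {0..} x * f x) \<partial>lborel) = ennreal (T - F 0)"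
      unfolding nnint[symmetric] by (intro nn_integral_cong) (auto simp: indicator_def)
  qed simp
  then show ?thesis
    by (simp add: set_integrable_def f_def[abs_def] has_bochner_integral_iff)
qed

text \<open>From 1 on the energy density also dominates y^2 itself, through y^2 \<le> x y^2; to the
  left continuity on a compact interval suffices. The start \<open>a\<close> is arbitrary because
  the Airy argument at z = 0 will be -m.\<close>

lemma set_integrable_airy_dominated:
  fixes g :: "real \<Rightarrow> real"
  assumes cont: "continuous_on UNIV g"
    and bd: "\<And>x. x \<ge> 1 \<Longrightarrow> \<bar>g x\<bar> \<le> (airy_Ai' x)\<^sup>2 + x * (airy_Ai x)\<^sup>2"
  shows "set_integrable lborel {a..} g"
proof -
  have [measurable]: "g \<in> borel_measurable borel"
    by (rule borel_measurable_continuous_onI[OF cont])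
  have 1: "set_integrable lborel {a..1} g"
    by (rule borel_integrable_atLeastAtMost'[OF continuous_on_subset[OF cont]]) simp
  have "set_integrable lborel {1..} (\<lambda>x. (airy_Ai' x)\<^sup>2 + x * (airy_Ai x)\<^sup>2)"
    by (rule set_integrable_subset[OF integrable_airy_energy]) auto
  then have 2: "set_integrable lborel {1..} g"
    by (rule set_integrable_bound) (use bd in \<open>force simp: set_borel_measurable_def\<close>)+
  show ?thesis
    by (rule set_integrable_subset[OF set_integrable_Un[OF 1 2]]) auto
qed

lemma set_integrable_airy_squares:
  "set_integrable lborel {a..} (\<lambda>x. (airy_Ai x)\<^sup>2)"
  "set_integrable lborel {a..} (\<lambda>x. (airy_Ai' x)\<^sup>2)"
  "set_integrable lborel {a..} (\<lambda>x. x * (airy_Ai x)\<^sup>2)"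
proof -
  have "(airy_Ai x)\<^sup>2 \<le> x * (airy_Ai x)\<^sup>2" if "x \<ge> 1" for x
    using mult_right_mono[OF that, of "(airy_Ai x)\<^sup>2"] by simp
  then have "\<bar>(airy_Ai x)\<^sup>2\<bar> \<le> (airy_Ai' x)\<^sup>2 + x * (airy_Ai x)\<^sup>2" if "x \<ge> 1" for x
    using that by (simp add: add_increasing)
  then show "set_integrable lborel {a..} (\<lambda>x. (airy_Ai x)\<^sup>2)"
    by (intro set_integrable_airy_dominated) (auto intro!: continuous_intros)
  show "set_integrable lborel {a..} (\<lambda>x. (airy_Ai' x)\<^sup>2)"
    "set_integrable lborel {a..} (\<lambda>x. x * (airy_Ai x)\<^sup>2)"
    by (rule set_integrable_airy_dominated; force intro!: continuous_intros)+
qed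

section \<open>Cauchy uniqueness and the zeros of the Airy function\<close>

text \<open>Gronwall: u^2 + D^2 damped by exp (-(1+K) t) cannot increase, and it starts at 0.
  Derivatives are asked for only in the open interval, so that the jump of the potential may sit at
  the endpoint \<open>a\<close>.\<close>

lemma linear_ode_zero:
  fixes u D q :: "real \<Rightarrow> real"
  assumes "a \<le> x" "continuous_on {a..x} u" "continuous_on {a..x} D"
    and u: "\<And>t. a < t \<Longrightarrow> t < x \<Longrightarrow> (u has_real_derivative D t) (at t)"
    and D: "\<And>t. a < t \<Longrightarrow> t < x \<Longrightarrow> (D has_real_derivative q t * u t) (at t)"
    and q: "\<And>t. a < t \<Longrightarrow> t < x \<Longrightarrow> \<bar>q t\<bar> \<le> K"
    and 0: "u a = 0" "D a = 0"
  shows "u x = 0" "D x = 0"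
proof -
  define E where "E t = ((u t)\<^sup>2 + (D t)\<^sup>2) * exp (- (1 + K) * t)" for t
  have "E x \<le> E a"
  proof (cases "a = x")
    case False
    then have ax: "a < x" using assms by simp
    show ?thesis
    proof (rule DERIV_nonpos_imp_decreasing_open[OF less_imp_le[OF ax]])
      show "continuous_on {a..x} E"
        unfolding E_def by (intro continuous_intros assms)
      fix t assume t: "a < t" "t < x"
      define d where "d = (2 * u t * D t + 2 * D t * (q t * u t) - (1 + K) * ((u t)\<^sup>2 + (D t)\<^sup>2)) * exp (- (1 + K) * t)"
      have "(E has_real_derivative d) (at t)"
        unfolding E_def d_def using u[OF t] D[OF t]
        by (auto intro!: derivative_eq_intros simp: algebra_simps)
      moreover have "d \<le> 0"
      proof -
        have "2 * u t * D t + 2 * D t * (q t * u t) = (2 * u t * D t) * (1 + q t)" by (simp add: algebra_simps)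
        also have "\<dots> \<le> \<bar>2 * u t * D t\<bar> * \<bar>1 + q t\<bar>" by (simp add: abs_mult[symmetric])
        also have "\<dots> \<le> ((u t)\<^sup>2 + (D t)\<^sup>2) * (1 + K)"
        proof (rule mult_mono)
          have "0 \<le> (\<bar>u t\<bar> - \<bar>D t\<bar>)\<^sup>2" by simp
          then show "\<bar>2 * u t * D t\<bar> \<le> (u t)\<^sup>2 + (D t)\<^sup>2"
            by (simp add: power2_diff abs_mult)
          show "\<bar>1 + q t\<bar> \<le> 1 + K" using q[OF t] by linarith
        qed auto
        finally show ?thesis unfolding d_def by (intro mult_nonpos_nonneg) (auto simp: mult.commute)
      qed
      ultimately show "\<exists>y. (E has_real_derivative y) (at t) \<and> y \<le> 0" by blast
    qed
  qed simp
  also have "E a = 0" by (simp add: E_def 0)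
  finally have "(u x)\<^sup>2 + (D x)\<^sup>2 \<le> 0" by (simp add: E_def mult_le_0_iff)
  then have "(u x)\<^sup>2 + (D x)\<^sup>2 = 0" by (meson antisym sum_power2_ge_zero)
  then show "u x = 0" "D x = 0" by (simp_all add: sum_power2_eq_zero_iff)
qed

text \<open>Zero Cauchy data would propagate to the origin, where A is positive.\<close>

lemma airyA_zero_simple:
  assumes "airyA x = 0"
  shows "airyA' x \<noteq> 0"
proof
  assume d: "airyA' x = 0"
  show False
  proof (cases "x \<ge> 0")
    case True
    \<comment> \<open>The origin lies to the left of x, so the equation is run backwards, as one for
      A(x - t).\<close>
    have "(\<lambda>t. airyA (x - t)) x = 0"
    proof (rule linear_ode_zero(1)[where u = "\<lambda>t. airyA (x - t)" and D = "\<lambda>t. - airyA' (x - t)" and q = "\<lambda>t. - (x - t)" and K = x, OF True])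
      fix t :: real
      show "((\<lambda>t. airyA (x - t)) has_real_derivative - airyA' (x - t)) (at t)"
        by (rule DERIV_cong[OF DERIV_chain2[OF airyA_has_derivative, of "\<lambda>t. x - t" "- 1"]]) (auto intro!: derivative_eq_intros)
      show "((\<lambda>t. - airyA' (x - t)) has_real_derivative - (x - t) * airyA (x - t)) (at t)"
        by (rule DERIV_cong[OF DERIV_minus[OF DERIV_chain2[OF airyA'_has_derivative, of "\<lambda>t. x - t" "- 1"]]]) (auto intro!: derivative_eq_intros)
    qed (use assms d True in \<open>auto intro!: continuous_intros\<close>)
    then show False using airyA_0_pos by simp
  next
    case False
    have "airyA 0 = 0"
    proof (rule linear_ode_zero(1)[where u = airyA and D = airyA' and q = uminus and K = "-x" and a = x])
      fix t :: real
      show "(airyA' has_real_derivative - t * airyA t) (at t)" by (rule airyA'_has_derivative)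
      show "(airyA has_real_derivative airyA' t) (at t)" by (rule airyA_has_derivative)
    qed (use assms d False in \<open>auto intro!: continuous_on_airyA continuous_on_airyA'\<close>)
    then show False using airyA_0_pos by simp
  qed
qed

text \<open>A Sturm-type concavity argument. Without zeros beyond M, y = |A| solves y'' = -x y and
  is concave from \<open>a\<close> on. Its slope cannot be negative, since y would then reach 0; so
  y stays above y(a). But then the slope falls at least at the rate y(a) and becomes negative after
  all.\<close>

lemma airyA_zeros_unbounded: "\<exists>x>M. airyA x = 0"
proof (rule ccontr)
  assume "\<not> ?thesis"
  then have nz: "airyA x \<noteq> 0" if "x > M" for x using that by auto
  define a where "a = max M 0 + 1"
  have a: "a > M" "a \<ge> 1" by (auto simp: a_def)
  define s where "s = sgn (airyA a)"
  define y where "y x = s * airyA x" for x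
  define d where "d x = s * airyA' x" for x
  have s: "s \<noteq> 0" using nz[OF a(1)] by (simp add: s_def sgn_zero_iff)
  have ya: "y a > 0" using nz[OF a(1)] by (simp add: y_def s_def sgn_if)
  have ynz: "y x \<noteq> 0" if "x \<ge> a" for x using nz[of x] that a s by (simp add: y_def)
  have ypos: "y x > 0" if "x \<ge> a" for x
  proof (rule ccontr)
    assume "\<not> y x > 0"
    then have "y x \<le> 0" by simp
    moreover have "continuous_on {a..x} y" unfolding y_def by (intro continuous_intros)
    ultimately obtain t where "a \<le> t" "t \<le> x" "y t = 0"
      using IVT2'[of y x 0 a] ya \<open>x \<ge> a\<close> by auto
    then show False using ynz by auto
  qed
  have yd: "(y has_real_derivative d x) (at x)" for x
    unfolding y_def d_def by (rule DERIV_cmult[OF airyA_has_derivative])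
  have dd: "(d has_real_derivative - (x * y x)) (at x)" for x
    using DERIV_cmult[OF airyA'_has_derivative, of s x] by (simp add: y_def d_def[abs_def] mult_ac)
  have dneg: "(\<lambda>x. - d x) t \<ge> - d b + 0 * (t - b)" if "a \<le> b" "b \<le> t" for b t
  proof (rule deriv_ge_imp_linear_lower_bound[OF _ _ that(2)])
    fix x assume "b \<le> x"
    then show "((\<lambda>x. - d x) has_real_derivative x * y x) (at x)" using DERIV_minus[OF dd[of x]] by simp
    show "0 \<le> x * y x" using ypos[of x] \<open>b \<le> x\<close> a that by simp
  qed
  have dnn: "d x \<ge> 0" if "x \<ge> a" for x
  proof (rule ccontr)
    assume "\<not> d x \<ge> 0"
    then have dx: "d x < 0" by simp
    \<comment> \<open>Where the tangent at x meets the axis; by concavity y is nonpositive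
      there.\<close>
    define t where "t = x + y x / (- d x)"
    have t: "t \<ge> x" using dx ypos[OF that] by (simp add: t_def divide_nonneg_neg)
    have "(\<lambda>x. - y x) t \<ge> - y x + (- d x) * (t - x)"
    proof (rule deriv_ge_imp_linear_lower_bound[OF _ _ t])
      show "((\<lambda>x. - y x) has_real_derivative - d z) (at z)" for z by (rule DERIV_minus[OF yd])
      show "- d x \<le> - d z" if "x \<le> z" for z using dneg[OF \<open>x \<ge> a\<close> that] by simp
    qed
    also have "(- d x) * (t - x) = y x" using dx by (simp add: t_def)
    finally show False using ypos[of t] t that by simp
  qed
  have ymono: "y t \<ge> y a" if "t \<ge> a" for t
    using deriv_ge_imp_linear_lower_bound[of a y d 0 t, OF yd dnn that] by simp
  \<comment> \<open>By this point the slope has dropped from \<open>d a\<close> to at most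
    -1.\<close>
  define t where "t = a + (d a + 1) / y a"
  have t: "t \<ge> a" using dnn[of a] ya by (simp add: t_def)
  have "(\<lambda>x. - d x) t \<ge> - d a + y a * (t - a)"
  proof (rule deriv_ge_imp_linear_lower_bound[OF _ _ t])
    fix x assume x: "a \<le> x"
    then show "((\<lambda>x. - d x) has_real_derivative x * y x) (at x)" using DERIV_minus[OF dd[of x]] by simp
    show "y a \<le> x * y x"
      using mult_mono[of 1 x "y a" "y x"] ymono[OF x] a x ya by simp
  qed
  also have "y a * (t - a) = d a + 1" using ya by (simp add: t_def)
  finally show False using dnn[OF t] by simp
qed

text \<open>The complex series is entire, and a nonconstant entire function has finitely many zeros
  in a closed disc. An existing zero, set against A(0) > 0, rules out constancy; if there is none,
  the set is empty.\<close>

lemma finite_airyA_zeros: "finite {x. 0 < x \<and> x \<le> M \<and> airyA x = 0}"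
proof (cases "\<exists>x. airyA x = 0")
  case True
  then obtain x0 where x0: "airyA x0 = 0" by blast
  let ?f = "\<lambda>z. airy_sol airy_Ai0 airy_Ai0' (- z) :: complex"
  have f: "?f (of_real x) = of_real (airyA x)" for x
    by (simp add: airyA_def airy_Ai_eq airy_sol_of_real flip: of_real_minus)
  have "finite {z \<in> cball 0 M. ?f z = 0}"
  proof (rule holomorphic_compact_finite_zeros)
    show "?f holomorphic_on UNIV"
      unfolding holomorphic_on_def field_differentiable_def
      by (auto intro!: exI DERIV_chain2[OF airy_sol_has_derivative] derivative_eq_intros)
    show "\<not> ?f constant_on UNIV"
    proof
      assume "?f constant_on UNIV"
      then have "?f (of_real x0) = ?f (of_real 0)" by (metis UNIV_I constant_on_def)
      then show False using x0 airyA_0_pos by (simp only: f) simp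
    qed
  qed auto
  moreover have "of_real ` {x. 0 < x \<and> x \<le> M \<and> airyA x = 0} \<subseteq> {z \<in> cball 0 M. ?f z = 0}"
    by (auto simp: f simp del: of_real_minus)
  ultimately have "finite (complex_of_real ` {x. 0 < x \<and> x \<le> M \<and> airyA x = 0})"
    by (rule finite_subset[rotated])
  then show ?thesis by (rule finite_imageD) (simp add: inj_on_def)
qed simp

section \<open>Integration lemmas\<close>

lemma set_integral_Icc_split:
  fixes f :: "real \<Rightarrow> real"
  assumes "set_integrable lborel {a..b} f" "a \<le> c" "c \<le> b"
  shows "(LINT t:{a..b}|lborel. f t) = (LINT t:{a..c}|lborel. f t) + (LINT t:{c..b}|lborel. f t)"
proof -
  have 1: "set_integrable lborel {a..c} f" "set_integrable lborel {c..b} f"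
    using assms by (auto intro: set_integrable_subset)
  show ?thesis
    using Henstock_Kurzweil_Integration.integral_combine[OF assms(2,3) set_borel_integral_eq_integral(1)[OF assms(1)]] assms(1)
    by (simp add: set_borel_integral_eq_integral 1)
qed

text \<open>Fubini on the triangle \<open>s \<le> t\<close>.\<close>

lemma absolutely_continuous_integral_by_parts:
  fixes p q U V :: "real \<Rightarrow> real"
  assumes ab: "a \<le> b"
    and p: "set_integrable lborel {a..b} p" and q: "set_integrable lborel {a..b} q"
    and U: "\<And>x. x \<in> {a..b} \<Longrightarrow> U x - U a = (LINT t:{a..x}|lborel. p t)"
    and V: "\<And>x. x \<in> {a..b} \<Longrightarrow> V x - V a = (LINT t:{a..x}|lborel. q t)"
  shows "set_integrable lborel {a..b} (\<lambda>x. U x * q x)"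
    and "set_integrable lborel {a..b} (\<lambda>x. p x * V x)"
    and "(LINT x:{a..b}|lborel. U x * q x) + (LINT x:{a..b}|lborel. p x * V x) = U b * V b - U a * V a"
proof -
  define P where "P t = indicator {a..b} t * p t" for t
  define Q where "Q t = indicator {a..b} t * q t" for t
  have iP: "integrable lborel P" and iQ: "integrable lborel Q"
    using p q by (simp_all add: P_def[abs_def] Q_def[abs_def] set_integrable_def)
  have [measurable]: "P \<in> borel_measurable borel" "Q \<in> borel_measurable borel"
    using borel_measurable_integrable[OF iP] borel_measurable_integrable[OF iQ] by simp_all
  have IF: "integrable (lborel \<Otimes>\<^sub>M lborel) (\<lambda>(s, t). P s * Q t)"
  proof (rule lborel_pair.Fubini_integrable)
    show "(\<lambda>(s, t). P s * Q t) \<in> borel_measurable (lborel \<Otimes>\<^sub>M lborel)" by measurable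
    have "(\<lambda>x. \<integral>y. norm (case (x, y) of (s, t) \<Rightarrow> P s * Q t) \<partial>lborel) = (\<lambda>x. \<bar>P x\<bar> * (\<integral>y. \<bar>Q y\<bar> \<partial>lborel))"
      by (simp add: abs_mult)
    then show "integrable lborel (\<lambda>x. \<integral>y. norm (case (x, y) of (s, t) \<Rightarrow> P s * Q t) \<partial>lborel)"
      using iP by simp
    show "AE x in lborel. integrable lborel (\<lambda>y. case (x, y) of (s, t) \<Rightarrow> P s * Q t)"
      using iQ by simp
  qed
  define G where "G s t = (if s \<le> t then P s * Q t else 0)" for s t
  have IG: "integrable (lborel \<Otimes>\<^sub>M lborel) (case_prod G)"
    by (rule Bochner_Integration.integrable_bound[OF IF])
       (auto simp: G_def[abs_def] split_beta')
  have inner_s: "(\<integral>s. G s t \<partial>lborel) = Q t * (U t - U a)" for t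
  proof (cases "t \<in> {a..b}")
    case True
    have "(\<integral>s. G s t \<partial>lborel) = (\<integral>s. Q t * (indicator {a..t} s *\<^sub>R p s) \<partial>lborel)"
      using True by (intro Bochner_Integration.integral_cong) (auto simp: G_def P_def indicator_def)
    also have "\<dots> = Q t * (U t - U a)"
      unfolding U[OF True] by (simp add: set_lebesgue_integral_def)
    finally show ?thesis .
  next
    case False
    then have "Q t = 0" by (simp add: Q_def)
    then show ?thesis by (simp add: G_def cong: if_cong)
  qed
  have inner_t: "(\<integral>t. G s t \<partial>lborel) = P s * (V b - V s)" for s
  proof (cases "s \<in> {a..b}")
    case True
    have "(\<integral>t. G s t \<partial>lborel) = (\<integral>t. P s * (indicator {s..b} t *\<^sub>R q t) \<partial>lborel)"
      using True by (intro Bochner_Integration.integral_cong) (auto simp: G_def Q_def indicator_def)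
    also have "\<dots> = P s * (LINT t:{s..b}|lborel. q t)" by (simp add: set_lebesgue_integral_def)
    also have "(LINT t:{s..b}|lborel. q t) = V b - V s"
      using set_integral_Icc_split[OF q, of s] V[of b] V[OF True] True by simp
    finally show ?thesis .
  next
    case False
    then have "P s = 0" by (simp add: P_def)
    then show ?thesis by (simp add: G_def cong: if_cong)
  qed
  have i1: "integrable lborel (\<lambda>t. Q t * (U t - U a))"
    using lborel_pair.integrable_snd[OF IG] by (simp add: inner_s)
  have i2: "integrable lborel (\<lambda>s. P s * (V b - V s))"
    using lborel_pair.integrable_fst[OF IG] by (simp add: inner_t)
  have eq: "(\<integral>t. Q t * (U t - U a) \<partial>lborel) = (\<integral>s. P s * (V b - V s) \<partial>lborel)"
    using lborel_pair.Fubini_integral[OF IG] by (simp add: inner_s inner_t)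
  have QU: "(\<lambda>t. Q t * U t) = (\<lambda>t. Q t * (U t - U a) + U a * Q t)" by (auto simp: algebra_simps)
  have PV: "(\<lambda>t. P t * V t) = (\<lambda>t. V b * P t - P t * (V b - V t))" by (auto simp: algebra_simps)
  have iQU: "integrable lborel (\<lambda>t. Q t * U t)" unfolding QU using i1 iQ by simp
  have iPV: "integrable lborel (\<lambda>t. P t * V t)" unfolding PV using i2 iP by simp
  have "(\<integral>t. Q t * U t \<partial>lborel) + (\<integral>t. P t * V t \<partial>lborel)
      = U a * (\<integral>t. Q t \<partial>lborel) + V b * (\<integral>t. P t \<partial>lborel)"
    unfolding QU PV using i1 i2 iP iQ eq by simp
  also have "(\<integral>t. Q t \<partial>lborel) = V b - V a"
    using V[of b] ab by (simp add: Q_def set_lebesgue_integral_def)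
  also have "(\<integral>t. P t \<partial>lborel) = U b - U a"
    using U[of b] ab by (simp add: P_def set_lebesgue_integral_def)
  finally have main: "(\<integral>t. Q t * U t \<partial>lborel) + (\<integral>t. P t * V t \<partial>lborel) = U b * V b - U a * V a"
    by (simp add: algebra_simps)
  have e1: "(\<lambda>x. indicator {a..b} x *\<^sub>R (U x * q x)) = (\<lambda>t. Q t * U t)"
    and e2: "(\<lambda>x. indicator {a..b} x *\<^sub>R (p x * V x)) = (\<lambda>t. P t * V t)"
    by (auto simp: Q_def P_def)
  show "set_integrable lborel {a..b} (\<lambda>x. U x * q x)"
    and "set_integrable lborel {a..b} (\<lambda>x. p x * V x)"
    unfolding set_integrable_def e1 e2 by (fact iQU, fact iPV)
  show "(LINT x:{a..b}|lborel. U x * q x) + (LINT x:{a..b}|lborel. p x * V x) = U b * V b - U a * V a"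
    unfolding set_lebesgue_integral_def e1 e2 by (fact main)
qed

text \<open>If |f| stayed above some c > 0 on a half-line, intervals of length n would push its
  integral above n c for every n. This turns "constant and integrable" into "zero" for the
  Wronskians.\<close>

lemma integrable_lower_bound_at_top:
  fixes f :: "real \<Rightarrow> real"
  assumes f: "integrable lborel f" and c: "\<And>x. x \<ge> R \<Longrightarrow> c \<le> \<bar>f x\<bar>"
  shows "c \<le> 0"
proof (rule ccontr)
  assume "\<not> c \<le> 0"
  then have c0: "c > 0" by simp
  obtain n :: nat where n: "real n * c > (\<integral>x. \<bar>f x\<bar> \<partial>lborel)"
    using ex_less_of_nat_mult[OF c0] by blast
  have "(\<integral>x. c * indicator {R..R + real n} x \<partial>lborel) \<le> (\<integral>x. \<bar>f x\<bar> \<partial>lborel)"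
  proof (rule integral_mono)
    show "integrable lborel (\<lambda>x. c * indicator {R..R + real n} x)" by simp
    show "integrable lborel (\<lambda>x. \<bar>f x\<bar>)" using f by simp
    show "c * indicator {R..R + real n} x \<le> \<bar>f x\<bar>" for x using c[of x] by (auto simp: indicator_def)
  qed
  then show False using n by (simp add: mult.commute)
qed

lemma integrable_lower_bound_at_bot:
  fixes f :: "real \<Rightarrow> real"
  assumes f: "integrable lborel f" and c: "\<And>x. x \<le> R \<Longrightarrow> c \<le> \<bar>f x\<bar>"
  shows "c \<le> 0"
proof (rule integrable_lower_bound_at_top)
  show "integrable lborel (\<lambda>x. f (0 + (- 1) * x))"
    by (rule lborel_integrable_real_affine[OF f]) simp
  show "c \<le> \<bar>f (0 + (- 1) * x)\<bar>" if "- R \<le> x" for x using c[of "- x"] that by simp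
qed

text \<open>Meant for boundary terms: their limit exists because the integrals converge, and their
  integrability in the cut-off forces that limit to be 0.\<close>

lemma integrable_tendsto_at_top_eq_0:
  fixes f :: "real \<Rightarrow> real"
  assumes f: "integrable lborel f" and L: "(f \<longlongrightarrow> L) at_top"
  shows "L = 0"
proof (rule ccontr)
  assume "L \<noteq> 0"
  then have "\<forall>\<^sub>F x in at_top. \<bar>f x - L\<bar> < \<bar>L\<bar> / 2"
    using tendstoD[OF L, of "\<bar>L\<bar> / 2"] by (simp add: dist_real_def)
  then obtain R where "\<And>x. x \<ge> R \<Longrightarrow> \<bar>f x - L\<bar> < \<bar>L\<bar> / 2"
    by (auto simp: eventually_at_top_linorder)
  then have "\<And>x. x \<ge> R \<Longrightarrow> \<bar>L\<bar> / 2 \<le> \<bar>f x\<bar>" by (smt (verit) field_sum_of_halves)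
  from integrable_lower_bound_at_top[OF f this] show False using \<open>L \<noteq> 0\<close> by simp
qed

lemma integrable_mult_of_squares:
  fixes f g :: "'a \<Rightarrow> real"
  assumes [measurable]: "f \<in> borel_measurable M" "g \<in> borel_measurable M"
    and "integrable M (\<lambda>x. (f x)\<^sup>2)" "integrable M (\<lambda>x. (g x)\<^sup>2)"
  shows "integrable M (\<lambda>x. f x * g x)"
proof (rule Bochner_Integration.integrable_bound)
  show "integrable M (\<lambda>x. (f x)\<^sup>2 + (g x)\<^sup>2)" using assms by simp
  have "\<bar>f x * g x\<bar> \<le> (f x)\<^sup>2 + (g x)\<^sup>2" for x
  proof -
    have "0 \<le> (\<bar>f x\<bar> - \<bar>g x\<bar>)\<^sup>2" by simp
    then have "2 * \<bar>f x * g x\<bar> \<le> (f x)\<^sup>2 + (g x)\<^sup>2" by (simp add: power2_diff abs_mult)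
    then show ?thesis by linarith
  qed
  then show "AE x in M. norm (f x * g x) \<le> norm ((f x)\<^sup>2 + (g x)\<^sup>2)" by simp
qed measurable

lemma integral_Icc_tendsto:
  fixes f :: "real \<Rightarrow> real"
  assumes f: "integrable lborel f"
  shows "((\<lambda>R. LINT x:{-R..R}|lborel. f x) \<longlongrightarrow> (\<integral>x. f x \<partial>lborel)) at_top"
  unfolding set_lebesgue_integral_def
proof (rule integral_dominated_convergence_at_top[where w = "\<lambda>x. norm (f x)"])
  have [measurable]: "f \<in> borel_measurable borel" using borel_measurable_integrable[OF f] by simp
  show "f \<in> borel_measurable lborel" "integrable lborel (\<lambda>x. norm (f x))" using f by auto
  show "(\<lambda>x. indicat_real {- t..t} x *\<^sub>R f x) \<in> borel_measurable lborel" for t by measurable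
  show "AE x in lborel. ((\<lambda>i. indicat_real {- i..i} x *\<^sub>R f x) \<longlongrightarrow> f x) at_top"
  proof (rule AE_I2)
    fix x :: real
    have "\<forall>\<^sub>F i in at_top. f x = indicat_real {- i..i} x *\<^sub>R f x"
      using eventually_ge_at_top[of "\<bar>x\<bar>"] by eventually_elim (auto simp: indicator_def)
    then show "((\<lambda>i. indicat_real {- i..i} x *\<^sub>R f x) \<longlongrightarrow> f x) at_top"
      by (rule Lim_transform_eventually[OF tendsto_const])
  qed
  show "\<forall>\<^sub>F i in at_top. AE x in lborel. norm (indicat_real {- i..i} x *\<^sub>R f x) \<le> norm (f x)"
    by (intro always_eventually allI AE_I2) (auto simp: indicator_def)
qed

section \<open>The potential and products of form-domain functions\<close>

lemma toy_W_measurable [measurable]: "toy_W \<in> borel_measurable borel"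
  unfolding toy_W_def[abs_def] by measurable

lemma toy_W_nonneg: "toy_W x \<ge> 0" and toy_W_le: "toy_W x \<le> \<bar>x\<bar> + 1"
  by (auto simp: toy_W_def)

lemma set_integrable_toy_W_mult:
  assumes u: "continuous_on {a..b} u"
  shows "set_integrable lborel {a..b} (\<lambda>x. toy_W x * u x)"
proof (rule set_integrable_bound)
  show "set_integrable lborel {a..b} (\<lambda>x. (\<bar>x\<bar> + 1) * \<bar>u x\<bar>)"
    by (intro borel_integrable_atLeastAtMost' continuous_intros u)
  have "(\<lambda>x. indicator {a..b} x *\<^sub>R u x) \<in> borel_measurable borel"
    by (rule borel_measurable_continuous_on_indicator[OF _ u]) simp
  then have "(\<lambda>x. toy_W x * (indicator {a..b} x *\<^sub>R u x)) \<in> borel_measurable borel" by measurable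
  then show "set_borel_measurable lborel {a..b} (\<lambda>x. toy_W x * u x)"
    by (simp add: set_borel_measurable_def mult_ac)
  show "AE x in lborel. x \<in> {a..b} \<longrightarrow> norm (toy_W x * u x) \<le> norm ((\<bar>x\<bar> + 1) * \<bar>u x\<bar>)"
    using toy_W_le toy_W_nonneg by (auto simp: abs_mult intro!: mult_right_mono)
qed

text \<open>The weight is split evenly between the factors, as sqrt W u times sqrt W v, which
  reduces the claim to square integrability.\<close>

lemma integrable_toy_W_mult:
  assumes "u \<in> borel_measurable lborel" "v \<in> borel_measurable lborel"
    and "integrable lborel (\<lambda>x. \<bar>toy_W x\<bar> * (u x)\<^sup>2)" "integrable lborel (\<lambda>x. \<bar>toy_W x\<bar> * (v x)\<^sup>2)"
  shows "integrable lborel (\<lambda>x. toy_W x * u x * v x)"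
proof -
  have [measurable]: "u \<in> borel_measurable borel" "v \<in> borel_measurable borel" using assms by auto
  have "integrable lborel (\<lambda>x. (sqrt (toy_W x) * u x) * (sqrt (toy_W x) * v x))"
    using assms toy_W_nonneg by (intro integrable_mult_of_squares) (auto simp: power_mult_distrib)
  moreover have "(\<lambda>x. (sqrt (toy_W x) * u x) * (sqrt (toy_W x) * v x)) = (\<lambda>x. toy_W x * u x * v x)"
    using toy_W_nonneg by (auto simp: fun_eq_iff)
  ultimately show ?thesis by simp
qed

section \<open>Matching implies eigenvalue\<close>

lemma integrable_imp_set_integrable_Icc:
  "integrable lborel f \<Longrightarrow> set_integrable lborel {a..b} f" for f :: "real \<Rightarrow> real"
  unfolding set_integrable_def by (intro integrable_mult_indicator) auto

text \<open>In the variable -m - z / h^2 the equation to the left of 0 is Airy's equation, and z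
  tending to minus infinity is the decaying end. The shape a + b z is the one in which the affine
  change of variables for Lebesgue integrals is stated.\<close>

definition toy_left :: "real \<Rightarrow> real \<Rightarrow> real \<Rightarrow> real" where
  "toy_left h m z = airy_Ai (- m + (- 1 / h\<^sup>2) * z)"

definition toy_left' :: "real \<Rightarrow> real \<Rightarrow> real \<Rightarrow> real" where
  "toy_left' h m z = - airy_Ai' (- m + (- 1 / h\<^sup>2) * z) / h\<^sup>2"

lemma affine_has_derivative: "((\<lambda>z. a + b * z) has_real_derivative b) (at z)" for a b :: real
  by (auto intro!: derivative_eq_intros)

lemma toy_left_has_derivative: "(toy_left h m has_real_derivative toy_left' h m z) (at z)"
  unfolding toy_left_def[abs_def] toy_left'_def
  by (rule DERIV_cong[OF DERIV_chain2[OF airy_Ai_has_derivative affine_has_derivative]]) simp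

lemma toy_left'_has_derivative:
  assumes "h > 0"
  shows "(toy_left' h m has_real_derivative (- z - h\<^sup>2 * m) / (h ^ 3)\<^sup>2 * toy_left h m z) (at z)"
proof -
  let ?y = "- m + (- 1 / h\<^sup>2) * z"
  have "((\<lambda>z. airy_Ai' (- m + (- 1 / h\<^sup>2) * z)) has_real_derivative (?y * airy_Ai ?y) * (- 1 / h\<^sup>2)) (at z)"
    by (rule DERIV_chain2[OF airy_Ai'_has_derivative affine_has_derivative])
  then have "(toy_left' h m has_real_derivative (- ((?y * airy_Ai ?y) * (- 1 / h\<^sup>2))) / h\<^sup>2) (at z)"
    unfolding toy_left'_def[abs_def] by (intro DERIV_cdivide DERIV_minus)
  then have "(toy_left' h m has_real_derivative ((- (?y * (- 1 / h\<^sup>2))) / h\<^sup>2) * airy_Ai ?y) (at z)"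
    by (rule DERIV_cong) simp
  moreover have "(- (?y * (- 1 / h\<^sup>2))) / h\<^sup>2 = (- z - h\<^sup>2 * m) / (h ^ 3)\<^sup>2"
  proof -
    have "(- (?y * (- 1 / h\<^sup>2))) / h\<^sup>2 = (h\<^sup>2 * ?y) / (h ^ 3)\<^sup>2"
      using assms by (simp add: field_simps power2_eq_square power3_eq_cube)
    also have "h\<^sup>2 * ?y = - z - h\<^sup>2 * m" using assms by (simp add: field_simps)
    finally show ?thesis .
  qed
  ultimately show ?thesis unfolding toy_left_def by (simp only:)
qed

lemma toy_left_0: "toy_left h m 0 = airyA m" and toy_left'_0: "toy_left' h m 0 = airyA' m / h\<^sup>2"
  by (simp_all add: toy_left_def toy_left'_def airyA_def airyA'_def)

lemma continuous_on_toy_left [continuous_intros]: "continuous_on S f \<Longrightarrow> continuous_on S (\<lambda>x. toy_left h m (f x))"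
  and continuous_on_toy_left' [continuous_intros]: "h > 0 \<Longrightarrow> continuous_on S f \<Longrightarrow> continuous_on S (\<lambda>x. toy_left' h m (f x))"
  unfolding toy_left_def toy_left'_def by (intro continuous_intros; simp)+

lemma integrable_toy_left:
  assumes "h > 0"
  shows "integrable lborel (\<lambda>z. indicator {..0} z * (toy_left h m z)\<^sup>2)"
    and "integrable lborel (\<lambda>z. indicator {..0} z * (toy_left' h m z)\<^sup>2)"
    and "integrable lborel (\<lambda>z. indicator {..0} z * (- z * (toy_left h m z)\<^sup>2))"
proof -
  let ?y = "\<lambda>z. - m + (- 1 / h\<^sup>2) * z"
  have affine: "integrable lborel (\<lambda>z. indicator {..0} z * g (?y z))"
    if "set_integrable lborel {-m..} g" for g :: "real \<Rightarrow> real"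
  proof -
    have "integrable lborel (\<lambda>z. indicator {-m..} (?y z) *\<^sub>R g (?y z))"
      using that assms unfolding set_integrable_def by (intro lborel_integrable_real_affine) auto
    moreover have "indicator {-m..} (?y z) = (indicator {..0} z :: real)" for z
      using assms by (auto simp: indicator_def divide_le_0_iff)
    ultimately show ?thesis by simp
  qed
  from affine[OF set_integrable_airy_squares(1)]
  show 1: "integrable lborel (\<lambda>z. indicator {..0} z * (toy_left h m z)\<^sup>2)"
    by (simp add: toy_left_def)
  have "integrable lborel (\<lambda>z. (indicator {..0} z * (airy_Ai' (?y z))\<^sup>2) / h ^ 4)"
    by (intro integrable_divide affine set_integrable_airy_squares)
  then show "integrable lborel (\<lambda>z. indicator {..0} z * (toy_left' h m z)\<^sup>2)"
    by (simp add: toy_left'_def power_divide)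
  \<comment> \<open>From y = -m - z / h^2 one gets -z = h^2 y + h^2 m, so the weighted square is a
    sum of two integrable ones.\<close>
  have "integrable lborel (\<lambda>z. h\<^sup>2 * (indicator {..0} z * (?y z * (airy_Ai (?y z))\<^sup>2)) +
      h\<^sup>2 * m * (indicator {..0} z * (toy_left h m z)\<^sup>2))"
    using affine[OF set_integrable_airy_squares(3)] 1
    by (intro Bochner_Integration.integrable_add integrable_mult_right) blast+
  also have "(\<lambda>z. h\<^sup>2 * (indicator {..0} z * (?y z * (airy_Ai (?y z))\<^sup>2)) +
      h\<^sup>2 * m * (indicator {..0} z * (toy_left h m z)\<^sup>2)) = (\<lambda>z. indicator {..0} z * (- z * (toy_left h m z)\<^sup>2))"
    using assms by (auto simp: toy_left_def fun_eq_iff indicator_def algebra_simps)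
  finally show "integrable lborel (\<lambda>z. indicator {..0} z * (- z * (toy_left h m z)\<^sup>2))" .
qed

lemma integrable_exp_open_half_line:
  fixes c :: real assumes "c > 0"
  shows "integrable lborel (\<lambda>x. indicator {0<..} x * exp (- c * x))"
  by (rule Bochner_Integration.integrable_bound[OF integrable_exp_mscale_half_line[OF assms]])
     (auto simp: indicator_def)

text \<open>The derivative of an eigenfunction need not be differentiable at 0, where W jumps; the
  fundamental theorem tolerates that one exceptional point.\<close>

lemma piecewise_FTC:
  fixes f :: "real \<Rightarrow> real"
  assumes "continuous_on UNIV f" "\<And>x. x \<noteq> 0 \<Longrightarrow> (f has_real_derivative f' x) (at x)"
    "a \<le> b" "set_integrable lborel {a..b} f'"
  shows "f b - f a = (LINT x:{a..b}|lborel. f' x)"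
proof -
  have "(f' has_integral (f b - f a)) {a..b}"
  proof (rule fundamental_theorem_of_calculus_interior_strong[of "{0}"])
    show "(f has_vector_derivative f' x) (at x)" if "x \<in> {a<..<b} - {0}" for x
      using assms(2)[of x] that by (simp add: has_real_derivative_iff_has_vector_derivative)
    show "continuous_on {a..b} f" using assms(1) continuous_on_subset by blast
  qed (use assms in auto)
  then show ?thesis
    using set_borel_integral_eq_integral(2)[OF assms(4)] integral_unique by metis
qed

text \<open>The Airy function on the left is continued by an exponential on the right. Equality of
  values is built in by the factor A(m), and the matching condition is equality of slopes, so the
  glued function is C^1 and integration by parts leaves no term at 0.\<close>

lemma toy_eigenvalue_if_matching:
  assumes h: "h > 0" and lt: "h\<^sup>2 * m < 1"
    and F: "h * airyA' m + sqrt (1 - h\<^sup>2 * m) * airyA m = 0"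
  shows "toy_eigenvalue (h ^ 3) (h\<^sup>2 * m)"
proof -
  define lam where "lam = h\<^sup>2 * m"
  define k where "k = h ^ 3"
  define c where "c = sqrt (1 - lam) / k"
  define A where "A = airyA m"
  have k: "k > 0" using h by (simp add: k_def)
  have c: "c > 0" using lt k by (simp add: c_def lam_def)
  have c2: "c\<^sup>2 = (1 - lam) / k\<^sup>2" using lt by (simp add: c_def lam_def power_divide)
  \<comment> \<open>If A(m) vanished, the matching condition would force A'(m) = 0 as well, against
    simplicity of the zeros.\<close>
  have A: "A \<noteq> 0"
  proof
    assume "A = 0"
    then have "airyA m = 0" by (simp add: A_def)
    then show False using F h airyA_zero_simple[of m] by simp
  qed
  have match: "toy_left' h m 0 = - c * A"
  proof -
    have "airyA' m / h\<^sup>2 = (h * airyA' m) / k" using h by (simp add: k_def power2_eq_square power3_eq_cube)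
    also have "h * airyA' m = - sqrt (1 - lam) * A" using F by (simp add: lam_def A_def)
    finally show ?thesis by (simp add: toy_left'_0 c_def)
  qed
  define u where "u z = (if z \<le> 0 then toy_left h m z else A * exp (- c * z))" for z
  define du where "du z = (if z \<le> 0 then toy_left' h m z else - c * A * exp (- c * z))" for z
  define ddu where "ddu z = (toy_W z - lam) / k\<^sup>2 * u z" for z
  have cu: "continuous_on UNIV u"
    unfolding u_def by (rule continuous_on_cases_le) (auto intro!: continuous_intros simp: toy_left_0 A_def)
  have cdu: "continuous_on UNIV du"
    unfolding du_def by (rule continuous_on_cases_le) (use h match in \<open>auto intro!: continuous_intros\<close>)
  have [measurable]: "u \<in> borel_measurable borel" "du \<in> borel_measurable borel"
    by (intro borel_measurable_continuous_onI cu cdu)+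
  have Du: "(u has_real_derivative du z) (at z)" if "z \<noteq> 0" for z
  proof (cases "z < 0")
    case True
    show ?thesis
    proof (rule has_field_derivative_transform_within_open[of "toy_left h m" _ _ "{..<0}"])
      show "(toy_left h m has_real_derivative du z) (at z)"
        using True toy_left_has_derivative[of h m z] by (simp add: du_def)
    qed (use True in \<open>auto simp: u_def\<close>)
  next
    case False
    show ?thesis
    proof (rule has_field_derivative_transform_within_open[of "\<lambda>z. A * exp (- c * z)" _ _ "{0<..}"])
      show "((\<lambda>z. A * exp (- c * z)) has_real_derivative du z) (at z)"
        using False that by (auto simp: du_def intro!: derivative_eq_intros)
    qed (use False that in \<open>auto simp: u_def\<close>)
  qed
  have Ddu: "(du has_real_derivative ddu z) (at z)" if "z \<noteq> 0" for z
  proof (cases "z < 0")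
    case True
    show ?thesis
    proof (rule has_field_derivative_transform_within_open[of "toy_left' h m" _ _ "{..<0}"])
      show "(toy_left' h m has_real_derivative ddu z) (at z)"
        using True toy_left'_has_derivative[OF h, of m z] by (simp add: ddu_def u_def toy_W_def k_def lam_def)
    qed (use True in \<open>auto simp: du_def\<close>)
  next
    case False
    show ?thesis
    proof (rule has_field_derivative_transform_within_open[of "\<lambda>z. - c * A * exp (- c * z)" _ _ "{0<..}"])
      have "((\<lambda>z. - c * A * exp (- c * z)) has_real_derivative c\<^sup>2 * (A * exp (- c * z))) (at z)"
        by (auto intro!: derivative_eq_intros simp: power2_eq_square)
      then show "((\<lambda>z. - c * A * exp (- c * z)) has_real_derivative ddu z) (at z)"
        using False that by (simp add: ddu_def u_def toy_W_def c2)
    qed (use False that in \<open>auto simp: du_def\<close>)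
  qed
  have iexp: "integrable lborel (\<lambda>x. K * (indicator {0<..} x * exp (- (2 * c) * x)))" for K :: real
    using integrable_exp_open_half_line[of "2 * c"] c by (intro integrable_mult_right) auto
  have u2: "integrable lborel (\<lambda>x. (u x)\<^sup>2)"
  proof -
    have "(\<lambda>x. (u x)\<^sup>2) = (\<lambda>x. indicator {..0} x * (toy_left h m x)\<^sup>2 + A\<^sup>2 * (indicator {0<..} x * exp (- (2 * c) * x)))"
      by (auto simp: u_def fun_eq_iff indicator_def power_mult_distrib exp_double[symmetric] mult_ac)
    then show ?thesis using integrable_toy_left(1)[OF h, of m] iexp by simp
  qed
  have du2: "integrable lborel (\<lambda>x. (du x)\<^sup>2)"
  proof -
    have "(\<lambda>x. (du x)\<^sup>2) = (\<lambda>x. indicator {..0} x * (toy_left' h m x)\<^sup>2 + (c * A)\<^sup>2 * (indicator {0<..} x * exp (- (2 * c) * x)))"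
      by (auto simp: du_def fun_eq_iff indicator_def power_mult_distrib exp_double[symmetric] mult_ac)
    then show ?thesis using integrable_toy_left(2)[OF h, of m] iexp by simp
  qed
  have Wu2: "integrable lborel (\<lambda>x. \<bar>toy_W x\<bar> * (u x)\<^sup>2)"
  proof -
    have "(\<lambda>x. \<bar>toy_W x\<bar> * (u x)\<^sup>2) = (\<lambda>x. indicator {..0} x * (- x * (toy_left h m x)\<^sup>2) + A\<^sup>2 * (indicator {0<..} x * exp (- (2 * c) * x)))"
      by (auto simp: u_def fun_eq_iff indicator_def power_mult_distrib exp_double[symmetric] mult_ac toy_W_def)
    then show ?thesis using integrable_toy_left(3)[OF h, of m] iexp by simp
  qed
  have idu: "set_integrable lborel {a..b} du" for a b
    by (rule borel_integrable_atLeastAtMost'[OF continuous_on_subset[OF cdu]]) simp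
  have iddu: "set_integrable lborel {a..b} ddu" for a b
  proof -
    have "set_integrable lborel {a..b} (\<lambda>x. (1 / k\<^sup>2) * (toy_W x * u x) - lam / k\<^sup>2 * u x)"
      by (intro set_integral_diff set_integrable_mult_right set_integrable_toy_W_mult
          borel_integrable_atLeastAtMost' continuous_on_subset[OF cu]) auto
    then show ?thesis by (simp add: ddu_def[abs_def] diff_divide_distrib left_diff_distrib)
  qed
  have dom: "toy_form_dom u du"
    unfolding toy_form_dom_def using u2 du2 Wu2 idu piecewise_FTC[OF cu Du _ idu] by auto
  have pos: "(\<integral>x. (u x)\<^sup>2 \<partial>lborel) > 0"
  proof -
    have "(\<integral>x. (A * exp (- c))\<^sup>2 * indicator {0<..1} (x::real) \<partial>lborel) \<le> (\<integral>x. (u x)\<^sup>2 \<partial>lborel)"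
    proof (rule integral_mono)
      show "integrable lborel (\<lambda>x. (u x)\<^sup>2)" by (fact u2)
      show "(A * exp (- c))\<^sup>2 * indicator {0<..1} x \<le> (u x)\<^sup>2" for x
        using c by (auto simp: indicator_def u_def power_mult_distrib intro!: mult_left_mono power_mono)
    qed simp
    moreover have "(\<integral>x. (A * exp (- c))\<^sup>2 * indicator {0<..1} (x::real) \<partial>lborel) = (A * exp (- c))\<^sup>2" by simp
    moreover have "(A * exp (- c))\<^sup>2 > 0" using A by simp
    ultimately show ?thesis by linarith
  qed
  have weak: "toy_form k u du v dv = lam * (\<integral>x. u x * v x \<partial>lborel)" if v: "toy_form_dom v dv" for v dv
  proof -
    have vm [measurable]: "v \<in> borel_measurable borel" "dv \<in> borel_measurable borel"
      and v2: "integrable lborel (\<lambda>x. (v x)\<^sup>2)" "integrable lborel (\<lambda>x. (dv x)\<^sup>2)"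
        "integrable lborel (\<lambda>x. \<bar>toy_W x\<bar> * (v x)\<^sup>2)"
      and vac: "\<And>a b. a \<le> b \<Longrightarrow> set_integrable lborel {a..b} dv \<and> v b - v a = (LINT x:{a..b}|lborel. dv x)"
      using v by (auto simp: toy_form_dom_def)
    have i1: "integrable lborel (\<lambda>x. du x * dv x)" and i2: "integrable lborel (\<lambda>x. u x * v x)"
      and i4: "integrable lborel (\<lambda>x. du x * v x)"
      using u2 du2 v2 by (simp_all add: integrable_mult_of_squares)
    have i3: "integrable lborel (\<lambda>x. toy_W x * u x * v x)"
      using Wu2 v2 by (intro integrable_toy_W_mult) simp_all
    have ddu_v: "ddu x * v x = (1 / k\<^sup>2) * (toy_W x * u x * v x) - lam / k\<^sup>2 * (u x * v x)" for x
      by (simp add: ddu_def diff_divide_distrib left_diff_distrib)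
    have i5: "integrable lborel (\<lambda>x. ddu x * v x)"
      unfolding ddu_v using i2 i3 by (intro Bochner_Integration.integrable_diff integrable_mult_right)
    let ?L = "\<integral>x. du x * dv x + ddu x * v x \<partial>lborel"
    have "((\<lambda>R. LINT x:{-R..R}|lborel. du x * dv x + ddu x * v x) \<longlongrightarrow> ?L) at_top"
      by (intro integral_Icc_tendsto Bochner_Integration.integrable_add i1 i5)
    moreover have "\<forall>\<^sub>F R in at_top. (LINT x:{-R..R}|lborel. du x * dv x + ddu x * v x) = du R * v R - du (- R) * v (- R)"
      using eventually_ge_at_top[of 0]
    proof eventually_elim
      case (elim R)
      have "(LINT x:{-R..R}|lborel. du x * dv x) + (LINT x:{-R..R}|lborel. ddu x * v x) = du R * v R - du (- R) * v (- R)"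
      proof (rule absolutely_continuous_integral_by_parts(3))
        show "du x - du (- R) = (LINT t:{- R..x}|lborel. ddu t)" if "x \<in> {- R..R}" for x
          using piecewise_FTC[OF cdu Ddu _ iddu] that by simp
      qed (use elim vac iddu in auto)
      moreover have "set_integrable lborel {-R..R} (\<lambda>x. du x * dv x)" "set_integrable lborel {-R..R} (\<lambda>x. ddu x * v x)"
        using i1 i5 by (simp_all add: integrable_imp_set_integrable_Icc)
      ultimately show ?case by (simp add: set_integral_add)
    qed
    ultimately have lim: "((\<lambda>R. du R * v R - du (- R) * v (- R)) \<longlongrightarrow> ?L) at_top"
      by (rule Lim_transform_eventually)
    \<comment> \<open>The boundary term combines \<open>du v\<close> at R and at -R, hence is
      integrable as a function of R; since it also converges, its limit is 0.\<close>
    have "integrable lborel (\<lambda>x. (\<lambda>x. du x * v x) (0 + (- 1) * x))"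
      by (rule lborel_integrable_real_affine[OF i4]) simp
    then have "integrable lborel (\<lambda>R. du R * v R - du (- R) * v (- R))" using i4 by simp
    from integrable_tendsto_at_top_eq_0[OF this lim]
    have "(\<integral>x. du x * dv x \<partial>lborel) + (\<integral>x. ddu x * v x \<partial>lborel) = 0" using i1 i5 by simp
    also have "(\<integral>x. ddu x * v x \<partial>lborel)
       = (1 / k\<^sup>2) * (\<integral>x. toy_W x * u x * v x \<partial>lborel) - lam / k\<^sup>2 * (\<integral>x. u x * v x \<partial>lborel)"
      unfolding ddu_v using i2 i3 by simp
    finally show ?thesis using k by (simp add: toy_form_def field_simps)
  qed
  show ?thesis
    unfolding toy_eigenvalue_def using dom pos weak unfolding k_def lam_def by blast
qed

section \<open>Regularity of weak eigenfunctions\<close>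

lemma toy_form_dom_continuous:
  assumes "toy_form_dom u du"
  shows "continuous_on UNIV u"
proof -
  have ac: "set_integrable lborel {a..b} du" "u b - u a = (LINT x:{a..b}|lborel. du x)" if "a \<le> b" for a b
    using assms that by (auto simp: toy_form_dom_def)
  have "isCont u x" for x
  proof -
    let ?I = "{x - 1..x + 1}"
    have i: "set_integrable lborel ?I du" by (rule ac) simp
    have "continuous_on ?I (\<lambda>y. u (x - 1) + integral {x - 1..y} du)"
      by (intro continuous_intros indefinite_integral_continuous_1 set_borel_integral_eq_integral(1)[OF i])
    moreover have "u (x - 1) + integral {x - 1..y} du = u y" if "y \<in> ?I" for y
      using ac[of "x - 1" y] that by (simp add: set_borel_integral_eq_integral)
    ultimately have "continuous_on ?I u" by (rule continuous_on_eq)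
    then show ?thesis by (rule continuous_on_interior) simp
  qed
  then show ?thesis by (simp add: continuous_at_imp_continuous_on)
qed

lemma isCont_toy_W: "x \<noteq> 0 \<Longrightarrow> isCont toy_W x"
proof (cases "x < 0")
  case True
  have "\<forall>\<^sub>F y in nhds x. toy_W y = - y"
    using eventually_nhds_in_open[of "{..<0}" x] True by (auto elim!: eventually_mono simp: toy_W_def)
  then show ?thesis by (subst isCont_cong) (auto intro!: continuous_intros)
next
  case False
  assume "x \<noteq> 0"
  then have "\<forall>\<^sub>F y in nhds x. toy_W y = 1"
    using eventually_nhds_in_open[of "{0<..}" x] False by (auto elim!: eventually_mono simp: toy_W_def)
  then show ?thesis by (subst isCont_cong) auto
qed

text \<open>
  Testing the weak equation against the primitive of \<open>du - G - c\<close>, where \<open>G\<close> is a primitive of the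
  right-hand side and \<open>c\<close> makes the primitive vanish at both ends, gives \<open>du = G + c\<close> a.e.
\<close>

lemma toy_weak_regularity_local:
  assumes k: "k > 0" and R: "R > 0"
    and dom: "toy_form_dom u du"
    and weak: "\<And>v dv. toy_form_dom v dv \<Longrightarrow> toy_form k u du v dv = lam * (\<integral>x. u x * v x \<partial>lborel)"
  obtains D where "\<And>x. x \<in> {-R<..<R} \<Longrightarrow> (u has_real_derivative D x) (at x)"
    and "continuous_on {-R..R} D"
    and "\<And>x. x \<in> {-R<..<R} \<Longrightarrow> x \<noteq> 0 \<Longrightarrow> (D has_real_derivative (toy_W x - lam) / k\<^sup>2 * u x) (at x)"
    and "AE x in lborel. x \<in> {-R..R} \<longrightarrow> du x = D x"
proof -
  define a b where "a = - R" and "b = R"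
  have ab: "a < b" using R by (simp add: a_def b_def)
  have um [measurable]: "u \<in> borel_measurable borel" "du \<in> borel_measurable borel"
    and u2: "integrable lborel (\<lambda>x. (u x)\<^sup>2)" "integrable lborel (\<lambda>x. (du x)\<^sup>2)"
      "integrable lborel (\<lambda>x. \<bar>toy_W x\<bar> * (u x)\<^sup>2)"
    and uac: "\<And>a b. a \<le> b \<Longrightarrow> set_integrable lborel {a..b} du" "\<And>a b. a \<le> b \<Longrightarrow> u b - u a = (LINT x:{a..b}|lborel. du x)"
    using dom by (auto simp: toy_form_dom_def)
  have cu: "continuous_on UNIV u" by (rule toy_form_dom_continuous[OF dom])
  define g where "g x = (toy_W x - lam) / k\<^sup>2 * u x" for x
  have ig: "set_integrable lborel {s..t} g" for s t
  proof -
    have "set_integrable lborel {s..t} (\<lambda>x. (1 / k\<^sup>2) * (toy_W x * u x) - lam / k\<^sup>2 * u x)"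
      by (intro set_integral_diff set_integrable_mult_right set_integrable_toy_W_mult
          borel_integrable_atLeastAtMost' continuous_on_subset[OF cu]) auto
    then show ?thesis by (simp add: g_def[abs_def] diff_divide_distrib left_diff_distrib)
  qed
  define G where "G x = integral {a..x} g" for x
  have GL: "G x = (LINT t:{a..x}|lborel. g t)" for x
    by (simp add: G_def set_borel_integral_eq_integral[OF ig])
  have cG: "continuous_on {a..b} G"
    unfolding G_def by (intro indefinite_integral_continuous_1 set_borel_integral_eq_integral(1)[OF ig])
  have Ga: "G a = 0" by (simp add: G_def)
  define Y where "Y x = indicator {a..b} x * G x" for x
  have Ym [measurable]: "Y \<in> borel_measurable borel"
    using borel_measurable_continuous_on_indicator[OF _ cG] by (simp add: Y_def[abs_def])
  have iY: "integrable lborel Y"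
    using borel_integrable_atLeastAtMost'[OF cG] by (simp add: Y_def[abs_def] set_integrable_def)
  define X where "X x = indicator {a..b} x * du x" for x
  have [measurable]: "X \<in> borel_measurable borel" unfolding X_def by measurable
  have iX: "integrable lborel X"
    using uac(1)[of a b] ab by (simp add: X_def[abs_def] set_integrable_def)
  define c where "c = (\<integral>x. X x - Y x \<partial>lborel) / (b - a)"
  define C where "C x = c * indicator {a..b} x" for x
  have iC: "integrable lborel C" and C0: "(\<integral>x. C x \<partial>lborel) = c * (b - a)"
    using ab by (simp_all add: C_def[abs_def])
  define w where "w x = X x - Y x - C x" for x
  have w_out: "w x = 0" if "x \<notin> {a..b}" for x using that by (simp add: w_def X_def Y_def C_def)
  have w_in: "w x = du x - G x - c" if "x \<in> {a..b}" for x using that by (simp add: w_def X_def Y_def C_def)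
  have [measurable]: "w \<in> borel_measurable borel" unfolding w_def C_def by measurable
  have iw: "integrable lborel w" unfolding w_def using iX iY iC by simp
  have w0: "(\<integral>x. w x \<partial>lborel) = 0"
    unfolding w_def using iX iY iC ab by (simp add: C0 c_def)
  \<comment> \<open>Square integrability of \<open>w\<close> makes its primitive an admissible test
    function: \<open>X\<close> inherits it from \<open>du\<close>, the remainder is continuous on a
    compact interval.\<close>
  have iX2: "integrable lborel (\<lambda>x. (X x)\<^sup>2)"
    by (rule Bochner_Integration.integrable_bound[OF u2(2)]) (auto simp: X_def indicator_def)
  have iYC2: "integrable lborel (\<lambda>x. (Y x + C x)\<^sup>2)"
  proof -
    have "set_integrable lborel {a..b} (\<lambda>x. (G x + c)\<^sup>2)"
      by (intro borel_integrable_atLeastAtMost' continuous_intros cG)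
    moreover have "(\<lambda>x. (Y x + C x)\<^sup>2) = (\<lambda>x. indicator {a..b} x *\<^sub>R (G x + c)\<^sup>2)"
      by (auto simp: fun_eq_iff Y_def C_def indicator_def)
    ultimately show ?thesis by (simp add: set_integrable_def)
  qed
  have iXYC: "integrable lborel (\<lambda>x. X x * (Y x + C x))"
    by (rule integrable_mult_of_squares[OF _ _ iX2 iYC2]) (auto simp: C_def)
  have iw2: "integrable lborel (\<lambda>x. (w x)\<^sup>2)"
  proof -
    have "(\<lambda>x. (w x)\<^sup>2) = (\<lambda>x. (X x)\<^sup>2 - 2 * (X x * (Y x + C x)) + (Y x + C x)\<^sup>2)"
      by (auto simp: w_def fun_eq_iff power2_eq_square algebra_simps)
    then show ?thesis using iX2 iYC2 iXYC by simp
  qed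
  \<comment> \<open>Written as an integral over the whole line with a case distinction, so that
    measurability in x follows from joint measurability in (x, t).\<close>
  define v where "v x = (\<integral>t. (if t \<le> x then w t else 0) \<partial>lborel)" for x
  have iwx: "integrable lborel (\<lambda>t. if t \<le> x then w t else 0)" for x
    by (rule Bochner_Integration.integrable_bound[OF iw]) auto
  have vm [measurable]: "v \<in> borel_measurable borel"
  proof -
    have "(\<lambda>x. \<integral>t. (if t \<le> x then w t else 0) \<partial>lborel) \<in> borel_measurable lborel"
      by (rule lborel.borel_measurable_lebesgue_integral) measurable
    then show ?thesis by (simp add: v_def[abs_def])
  qed
  have vdiff: "v t - v s = (LINT x:{s..t}|lborel. w x)" if "s \<le> t" for s t
  proof -
    have "v t - v s = (\<integral>x. (if x \<le> t then w x else 0) - (if x \<le> s then w x else 0) \<partial>lborel)"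
      unfolding v_def using iwx by simp
    also have "\<dots> = (LINT x:{s..t}|lborel. w x)"
      unfolding set_lebesgue_integral_def
    proof (rule integral_cong_AE)
      show "AE x in lborel. (if x \<le> t then w x else 0) - (if x \<le> s then w x else 0) = indicat_real {s..t} x *\<^sub>R w x"
        using AE_lborel_singleton[of s] by eventually_elim (use that in \<open>auto simp: indicator_def\<close>)
    qed auto
    finally show ?thesis .
  qed
  have v_below: "v x = 0" if "x \<le> a" for x
    unfolding v_def
  proof (rule integral_eq_zero_AE)
    show "AE t in lborel. (if t \<le> x then w t else 0) = 0"
      using AE_lborel_singleton[of a] by eventually_elim (use that w_out in auto)
  qed
  have v_above: "v x = 0" if "x \<ge> b" for x
  proof -
    have "(\<lambda>t. if t \<le> x then w t else 0) = w" using that w_out by (auto simp: fun_eq_iff)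
    then show ?thesis by (simp add: v_def w0)
  qed
  define B where "B = (\<integral>t. \<bar>w t\<bar> \<partial>lborel)"
  have vB: "\<bar>v x\<bar> \<le> B" for x
  proof -
    have "norm (v x) \<le> (\<integral>t. norm (if t \<le> x then w t else 0) \<partial>lborel)"
      unfolding v_def by (rule integral_norm_bound)
    also have "\<dots> \<le> B"
      unfolding B_def
    proof (rule integral_mono)
      show "integrable lborel (\<lambda>t. norm (if t \<le> x then w t else 0))" using iwx by (rule integrable_norm)
    qed (use iw in auto)
    finally show ?thesis by simp
  qed
  have B: "B \<ge> 0" using vB[of 0] by linarith
  have v_sq: "(v x)\<^sup>2 \<le> B\<^sup>2 * indicator {a..b} x" for x
  proof (cases "x \<in> {a..b}")
    case True
    then show ?thesis using vB[of x] B by (simp add: abs_le_square_iff[symmetric])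
  next
    case False
    then show ?thesis using v_below[of x] v_above[of x] by auto
  qed
  have vdom: "toy_form_dom v w"
    unfolding toy_form_dom_def
  proof (intro conjI allI impI)
    show "v \<in> borel_measurable lborel" "w \<in> borel_measurable lborel" by simp_all
    show "integrable lborel (\<lambda>x. (v x)\<^sup>2)"
    proof (rule Bochner_Integration.integrable_bound)
      show "integrable lborel (\<lambda>x. B\<^sup>2 * indicator {a..b} x)" using ab by simp
    qed (use v_sq in auto)
    show "integrable lborel (\<lambda>x. (w x)\<^sup>2)" by (rule iw2)
    show "integrable lborel (\<lambda>x. \<bar>toy_W x\<bar> * (v x)\<^sup>2)"
    proof (rule Bochner_Integration.integrable_bound[where f = "\<lambda>x. (R + 1) * (B\<^sup>2 * indicator {a..b} x)"])
      show "AE x in lborel. norm (\<bar>toy_W x\<bar> * (v x)\<^sup>2) \<le> norm ((R + 1) * (B\<^sup>2 * indicator {a..b} x))"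
      proof (rule AE_I2)
        fix x
        have "\<bar>toy_W x\<bar> * (v x)\<^sup>2 \<le> (R + 1) * (B\<^sup>2 * indicator {a..b} x)"
        proof (cases "x \<in> {a..b}")
          case True
          then have "\<bar>toy_W x\<bar> \<le> R + 1" using toy_W_le[of x] toy_W_nonneg[of x] by (auto simp: a_def b_def)
          then show ?thesis using v_sq[of x] R by (intro mult_mono) auto
        next
          case False
          then show ?thesis using v_sq[of x] by simp
        qed
        then show "norm (\<bar>toy_W x\<bar> * (v x)\<^sup>2) \<le> norm ((R + 1) * (B\<^sup>2 * indicator {a..b} x))" using R by simp
      qed
    qed (use ab in simp_all)
    show "set_integrable lborel {s..t} w" for s t
      using iw by (rule integrable_imp_set_integrable_Icc)
    show "v t - v s = (LINT x:{s..t}|lborel. w x)" if "s \<le> t" for s t by (rule vdiff[OF that])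
  qed
  have v2: "integrable lborel (\<lambda>x. (v x)\<^sup>2)" "integrable lborel (\<lambda>x. \<bar>toy_W x\<bar> * (v x)\<^sup>2)"
    using vdom by (auto simp: toy_form_dom_def)
  have i1: "integrable lborel (\<lambda>x. du x * w x)" and i2: "integrable lborel (\<lambda>x. u x * v x)"
    using u2 v2 iw2 by (simp_all add: integrable_mult_of_squares)
  have i3: "integrable lborel (\<lambda>x. toy_W x * u x * v x)"
    using u2 v2 by (intro integrable_toy_W_mult) simp_all
  have iYw: "integrable lborel (\<lambda>x. Y x * w x)"
  proof (rule integrable_mult_of_squares)
    have "set_integrable lborel {a..b} (\<lambda>x. (G x)\<^sup>2)"
      by (intro borel_integrable_atLeastAtMost' continuous_intros cG)
    moreover have "(\<lambda>x. (Y x)\<^sup>2) = (\<lambda>x. indicator {a..b} x *\<^sub>R (G x)\<^sup>2)"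
      by (auto simp: fun_eq_iff Y_def indicator_def)
    ultimately show "integrable lborel (\<lambda>x. (Y x)\<^sup>2)" by (simp add: set_integrable_def)
  qed (use iw2 in auto)
  have "(LINT x:{a..b}|lborel. G x * w x) + (LINT x:{a..b}|lborel. g x * v x) = G b * v b - G a * v a"
  proof (rule absolutely_continuous_integral_by_parts(3))
    show "a \<le> b" using ab by simp
    show "set_integrable lborel {a..b} g" by (rule ig)
    show "set_integrable lborel {a..b} w" using vdom ab by (simp add: toy_form_dom_def)
    show "G x - G a = (LINT t:{a..x}|lborel. g t)" for x using GL[of x] Ga by simp
    show "v x - v a = (LINT t:{a..x}|lborel. w t)" if "x \<in> {a..b}" for x using vdiff that by simp
  qed
  also have "\<dots> = 0" using v_below[of a] v_above[of b] by simp
  also have "(LINT x:{a..b}|lborel. G x * w x) = (\<integral>x. Y x * w x \<partial>lborel)"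
    unfolding set_lebesgue_integral_def by (intro Bochner_Integration.integral_cong) (auto simp: Y_def)
  also have "(LINT x:{a..b}|lborel. g x * v x) = (\<integral>x. (1 / k\<^sup>2) * (toy_W x * u x * v x) - lam / k\<^sup>2 * (u x * v x) \<partial>lborel)"
    unfolding set_lebesgue_integral_def
  proof (intro Bochner_Integration.integral_cong refl)
    fix x
    show "indicat_real {a..b} x *\<^sub>R (g x * v x) = (1 / k\<^sup>2) * (toy_W x * u x * v x) - lam / k\<^sup>2 * (u x * v x)"
    proof (cases "x \<in> {a..b}")
      case True
      then show ?thesis by (simp add: g_def diff_divide_distrib left_diff_distrib)
    next
      case False
      then have "v x = 0" using v_below[of x] v_above[of x] by auto
      then show ?thesis by simp
    qed
  qed
  also have "\<dots> = (1 / k\<^sup>2) * (\<integral>x. toy_W x * u x * v x \<partial>lborel) - lam / k\<^sup>2 * (\<integral>x. u x * v x \<partial>lborel)"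
    using i2 i3 by simp
  finally have e1: "(\<integral>x. Y x * w x \<partial>lborel) = (lam * (\<integral>x. u x * v x \<partial>lborel) - (\<integral>x. toy_W x * u x * v x \<partial>lborel)) / k\<^sup>2"
    by (simp add: diff_divide_distrib)
  have e2: "(\<integral>x. du x * w x \<partial>lborel) = (lam * (\<integral>x. u x * v x \<partial>lborel) - (\<integral>x. toy_W x * u x * v x \<partial>lborel)) / k\<^sup>2"
    using weak[OF vdom] k by (simp add: toy_form_def field_simps)
  \<comment> \<open>This identity integrates to 0: by the weak equation and integration by parts
    \<open>du\<close> and \<open>Y\<close> have the same pairing with \<open>w\<close>, and
    \<open>w\<close> has mean zero.\<close>
  have "(\<lambda>x. (w x)\<^sup>2) = (\<lambda>x. du x * w x - Y x * w x - c * w x)"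
  proof
    fix x
    show "(w x)\<^sup>2 = du x * w x - Y x * w x - c * w x"
    proof (cases "x \<in> {a..b}")
      case True
      have "(w x)\<^sup>2 = (du x - G x - c) * w x" using w_in[OF True] by (simp add: power2_eq_square)
      then show ?thesis using True by (simp add: Y_def algebra_simps)
    qed (simp add: w_out)
  qed
  then have "(\<integral>x. (w x)\<^sup>2 \<partial>lborel) = 0" using i1 iYw iw e1 e2 w0 by simp
  then have "AE x in lborel. (w x)\<^sup>2 = 0"
    using integral_nonneg_eq_0_iff_AE[OF iw2] by simp
  then have ae: "AE x in lborel. x \<in> {a..b} \<longrightarrow> du x = G x + c"
    by eventually_elim (use w_in in auto)
  have uint: "u x = u a + integral {a..x} (\<lambda>x. G x + c)" if x: "x \<in> {a..b}" for x
  proof -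
    have cGx: "continuous_on {a..x} (\<lambda>x. G x + c)"
      using x by (intro continuous_intros continuous_on_subset[OF cG]) auto
    have "u x - u a = (LINT x:{a..x}|lborel. du x)" using uac(2)[of a x] x by simp
    also have "\<dots> = (LINT x:{a..x}|lborel. G x + c)"
      unfolding set_lebesgue_integral_def
    proof (rule integral_cong_AE)
      have eq: "(\<lambda>t. indicator {a..x} t *\<^sub>R (G t + c)) = (\<lambda>t. indicator {a..x} t *\<^sub>R (Y t + c))"
        using x by (auto simp: Y_def indicator_def fun_eq_iff)
      show "(\<lambda>t. indicator {a..x} t *\<^sub>R (G t + c)) \<in> borel_measurable lborel"
        unfolding eq by measurable
      show "AE t in lborel. indicator {a..x} t *\<^sub>R du t = indicator {a..x} t *\<^sub>R (G t + c)"
        using ae by eventually_elim (use x in \<open>auto simp: indicator_def\<close>)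
    qed measurable
    also have "\<dots> = integral {a..x} (\<lambda>x. G x + c)"
      by (intro set_borel_integral_eq_integral borel_integrable_atLeastAtMost' cGx)
    finally show ?thesis by simp
  qed
  have cD: "continuous_on {a..b} (\<lambda>x. G x + c)" by (intro continuous_intros cG)
  have Du: "(u has_real_derivative G x + c) (at x)" if x: "x \<in> {a<..<b}" for x
  proof -
    have "((\<lambda>x. u a + integral {a..x} (\<lambda>x. G x + c)) has_real_derivative G x + c) (at x within {a..b})"
      using integral_has_real_derivative[OF cD, of x] x by (auto intro!: derivative_eq_intros)
    then have "(u has_real_derivative G x + c) (at x within {a..b})"
    proof (rule has_field_derivative_transform_within[where d = 1])
      show "u a + integral {a..y} (\<lambda>x. G x + c) = u y" if "y \<in> {a..b}" for y
        by (rule uint[OF that, symmetric])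
    qed (use x in auto)
    then show ?thesis using x by (simp add: at_within_Icc_at)
  qed
  have DG: "((\<lambda>x. G x + c) has_real_derivative (toy_W x - lam) / k\<^sup>2 * u x) (at x)"
    if x: "x \<in> {a<..<b}" "x \<noteq> 0" for x
  proof -
    have "isCont u x" using cu by (simp add: continuous_on_eq_continuous_at)
    then have "isCont g x" unfolding g_def using isCont_toy_W[OF x(2)] k by (intro continuous_intros) auto
    then have "continuous (at x within {a..b} - {}) g" by (simp add: continuous_at_imp_continuous_at_within)
    then have "((\<lambda>u. integral {a..u} g) has_vector_derivative g x) (at x within ({a..b} - {}))"
      using x by (intro integral_has_vector_derivative_continuous_at set_borel_integral_eq_integral(1)[OF ig]) auto
    then have "(G has_real_derivative g x) (at x)"
      using x by (simp add: has_real_derivative_iff_has_vector_derivative at_within_Icc_at G_def[abs_def])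
    then show ?thesis unfolding g_def by (auto intro!: derivative_eq_intros)
  qed
  show thesis
    by (rule that[of "\<lambda>x. G x + c"]) (use Du cD DG ae in \<open>auto simp: a_def b_def\<close>)
qed

text \<open>The local representatives on [-R, R] all agree with \<open>deriv u\<close>, which
  therefore serves as global derivative. Exhausting the line by countably many intervals shows that
  it equals \<open>du\<close> almost everywhere, so it inherits square integrability.\<close>

lemma toy_weak_regularity:
  assumes k: "k > 0"
    and dom: "toy_form_dom u du"
    and weak: "\<And>v dv. toy_form_dom v dv \<Longrightarrow> toy_form k u du v dv = lam * (\<integral>x. u x * v x \<partial>lborel)"
  obtains D where "\<And>x. (u has_real_derivative D x) (at x)"
    and "continuous_on UNIV D"
    and "\<And>x. x \<noteq> 0 \<Longrightarrow> (D has_real_derivative (toy_W x - lam) / k\<^sup>2 * u x) (at x)"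
    and "integrable lborel (\<lambda>x. (D x)\<^sup>2)"
proof -
  define D where "D = deriv u"
  have loc: "\<exists>E. (\<forall>x\<in>{-R<..<R}. (u has_real_derivative D x) (at x) \<and> D x = E x) \<and> continuous_on {-R..R} E \<and>
     (\<forall>x\<in>{-R<..<R}. x \<noteq> 0 \<longrightarrow> (E has_real_derivative (toy_W x - lam) / k\<^sup>2 * u x) (at x)) \<and>
     (AE x in lborel. x \<in> {-R..R} \<longrightarrow> du x = E x)" if R0: "R > 0" for R
  proof -
    obtain E where E: "\<And>x. x \<in> {-R<..<R} \<Longrightarrow> (u has_real_derivative E x) (at x)"
      "continuous_on {-R..R} E"
      "\<And>x. x \<in> {-R<..<R} \<Longrightarrow> x \<noteq> 0 \<Longrightarrow> (E has_real_derivative (toy_W x - lam) / k\<^sup>2 * u x) (at x)"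
      "AE x in lborel. x \<in> {-R..R} \<longrightarrow> du x = E x"
      by (rule toy_weak_regularity_local[OF k R0 dom weak]) (assumption | rule that)+
    have "D x = E x" if "x \<in> {-R<..<R}" for x
      unfolding D_def using E(1)[OF that] by (rule DERIV_imp_deriv)
    then show ?thesis using E by (intro exI[of _ E]) auto
  qed
  have at: "(u has_real_derivative D x) (at x) \<and> isCont D x \<and>
      (x \<noteq> 0 \<longrightarrow> (D has_real_derivative (toy_W x - lam) / k\<^sup>2 * u x) (at x))" for x
  proof -
    define R where "R = \<bar>x\<bar> + 1"
    have R: "R > 0" "x \<in> {-R<..<R}" by (auto simp: R_def)
    obtain E where E: "\<And>x. x \<in> {-R<..<R} \<Longrightarrow> (u has_real_derivative D x) (at x) \<and> D x = E x" "continuous_on {-R..R} E"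
      "\<And>x. x \<in> {-R<..<R} \<Longrightarrow> x \<noteq> 0 \<Longrightarrow> (E has_real_derivative (toy_W x - lam) / k\<^sup>2 * u x) (at x)"
      using loc[OF R(1)] by blast
    have ev: "\<forall>\<^sub>F y in nhds x. D y = E y"
      using eventually_nhds_in_open[of "{-R<..<R}" x] R E(1) by (auto elim!: eventually_mono)
    have "isCont E x" using E(2) R(2) by (intro continuous_on_interior[OF E(2)]) simp
    then have "isCont D x" using ev by (simp add: isCont_cong)
    moreover have "(D has_real_derivative (toy_W x - lam) / k\<^sup>2 * u x) (at x)" if "x \<noteq> 0"
      using E(3)[OF R(2) that] ev by (subst DERIV_cong_ev[OF refl ev refl])
    ultimately show ?thesis using E(1)[OF R(2)] by blast
  qed
  have cD: "continuous_on UNIV D" using at by (simp add: continuous_at_imp_continuous_on)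
  have "AE x in lborel. \<forall>n::nat. x \<in> {-real (Suc n)<..<real (Suc n)} \<longrightarrow> du x = D x"
  proof (subst AE_all_countable, rule allI)
    fix n :: nat
    obtain E where E: "\<And>x. x \<in> {-real (Suc n)<..<real (Suc n)} \<Longrightarrow> D x = E x" "AE x in lborel. x \<in> {-real (Suc n)..real (Suc n)} \<longrightarrow> du x = E x"
      using loc[of "real (Suc n)"] by auto
    show "AE x in lborel. x \<in> {-real (Suc n)<..<real (Suc n)} \<longrightarrow> du x = D x"
      using E(2) by eventually_elim (use E(1) in auto)
  qed
  then have ae: "AE x in lborel. (du x)\<^sup>2 = (D x)\<^sup>2"
  proof eventually_elim
    case (elim x)
    obtain n :: nat where "\<bar>x\<bar> < real n" using reals_Archimedean2 by blast
    then have "x \<in> {-real (Suc n)<..<real (Suc n)}" by auto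
    then show ?case using elim[rule_format, of n] by simp
  qed
  have [measurable]: "D \<in> borel_measurable borel" by (rule borel_measurable_continuous_onI[OF cD])
  have "integrable lborel (\<lambda>x. (du x)\<^sup>2)" "du \<in> borel_measurable lborel" using dom by (auto simp: toy_form_dom_def)
  then have "integrable lborel (\<lambda>x. (D x)\<^sup>2)"
    by (subst (asm) integrable_cong_AE[OF _ _ ae]) auto
  then show thesis using that[of D] at cD by auto
qed

section \<open>Eigenvalues below 1 as roots of the matching condition\<close>

text \<open>The Wronskian with the exponential yields u'(0) = -c u(0); inserted into the one with
  the Airy solution, this gives u(0) times the matching expression. Cancelling u(0) is legitimate:
  if it were 0, so would be u'(0), and u would vanish identically.\<close>

lemma matching_if_toy_eigenvalue:
  assumes h: "h > 0" and lt: "h\<^sup>2 * m < 1" and ev: "toy_eigenvalue (h ^ 3) (h\<^sup>2 * m)"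
  shows "h * airyA' m + sqrt (1 - h\<^sup>2 * m) * airyA m = 0"
proof -
  define lam where "lam = h\<^sup>2 * m"
  define k where "k = h ^ 3"
  define c where "c = sqrt (1 - lam) / k"
  have k: "k > 0" using h by (simp add: k_def)
  have c: "c > 0" using lt k by (simp add: c_def lam_def)
  have c2: "c\<^sup>2 = (1 - lam) / k\<^sup>2" using lt by (simp add: c_def lam_def power_divide)
  obtain u du where dom: "toy_form_dom u du" and pos: "(\<integral>x. (u x)\<^sup>2 \<partial>lborel) > 0"
    and weak: "\<And>v dv. toy_form_dom v dv \<Longrightarrow> toy_form k u du v dv = lam * (\<integral>x. u x * v x \<partial>lborel)"
    using ev unfolding toy_eigenvalue_def k_def lam_def by blast
  obtain D where Du: "\<And>x. (u has_real_derivative D x) (at x)"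
    and cD: "continuous_on UNIV D"
    and DD: "\<And>x. x \<noteq> 0 \<Longrightarrow> (D has_real_derivative (toy_W x - lam) / k\<^sup>2 * u x) (at x)"
    and D2: "integrable lborel (\<lambda>x. (D x)\<^sup>2)"
    by (rule toy_weak_regularity[OF k dom weak]) (assumption | rule that)+
  have cu: "continuous_on UNIV u" by (rule toy_form_dom_continuous[OF dom])
  have u2: "integrable lborel (\<lambda>x. (u x)\<^sup>2)" using dom by (simp add: toy_form_dom_def)
  have [measurable]: "u \<in> borel_measurable borel" "D \<in> borel_measurable borel"
    by (intro borel_measurable_continuous_onI cu cD)+

  define p where "p x = exp (- c * x)" for x
  define w1 where "w1 x = u x * (- c * p x) - D x * p x" for x
  have p2: "integrable lborel (\<lambda>x. (indicator {0<..} x * p x)\<^sup>2)"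
  proof -
    have "(\<lambda>x. (indicator {0<..} x * p x)\<^sup>2) = (\<lambda>x. indicator {0<..} x * exp (- (2 * c) * x))"
      by (auto simp: p_def fun_eq_iff indicator_def exp_double[symmetric] mult_ac)
    then show ?thesis using integrable_exp_open_half_line[of "2 * c"] c by simp
  qed
  have [measurable]: "p \<in> borel_measurable borel" unfolding p_def by measurable
  have w1const: "w1 x = w1 0" if "x \<ge> 0" for x
  proof (cases "x = 0")
    case False
    show ?thesis
    proof (rule DERIV_isconst2[of 0 x])
      show "continuous_on {0..x} w1" unfolding w1_def p_def
        by (intro continuous_intros continuous_on_subset[OF cu] continuous_on_subset[OF cD]) auto
      show "(w1 has_real_derivative 0) (at t)" if "0 < t" "t < x" for t
      proof -
        have q: "(toy_W t - lam) / k\<^sup>2 = c\<^sup>2" using that by (simp add: toy_W_def c2)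
        have dp: "(p has_real_derivative - c * p t) (at t)"
          unfolding p_def by (auto intro!: derivative_eq_intros)
        have d: "(D has_real_derivative c\<^sup>2 * u t) (at t)"
          using DD[of t] that unfolding q by simp
        show ?thesis
          unfolding w1_def
          by (auto intro!: derivative_eq_intros dp Du d simp: power2_eq_square algebra_simps)
      qed
    qed (use that False in auto)
  qed simp
  have w10: "w1 0 = 0"
  proof -
    have "integrable lborel (\<lambda>x. u x * (indicator {0<..} x * p x))" "integrable lborel (\<lambda>x. D x * (indicator {0<..} x * p x))"
      using u2 D2 p2 by (simp_all add: integrable_mult_of_squares)
    then have "integrable lborel (\<lambda>x. (- c) * (u x * (indicator {0<..} x * p x)) - D x * (indicator {0<..} x * p x))"
      by (intro Bochner_Integration.integrable_diff integrable_mult_right)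
    \<comment> \<open>The bound is tested from 1 on because the indicator of the open half-line
      vanishes at 0.\<close>
    then have "\<bar>w1 0\<bar> \<le> 0"
    proof (rule integrable_lower_bound_at_top[where R = 1])
      fix x :: real assume "x \<ge> 1"
      then show "\<bar>w1 0\<bar> \<le> \<bar>(- c) * (u x * (indicator {0<..} x * p x)) - D x * (indicator {0<..} x * p x)\<bar>"
        using w1const[of x] by (simp add: w1_def algebra_simps)
    qed
    then show ?thesis by simp
  qed
  then have D0: "D 0 = - c * u 0" by (simp add: w1_def p_def mult.commute)

  define w2 where "w2 x = u x * toy_left' h m x - D x * toy_left h m x" for x
  have cont_left: "continuous_on S (toy_left h m)" "continuous_on S (toy_left' h m)" for S
    using continuous_on_toy_left[OF continuous_on_id, of S h m] continuous_on_toy_left'[OF h continuous_on_id, of S m] by simp_all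
  have [measurable]: "toy_left h m \<in> borel_measurable borel" "toy_left' h m \<in> borel_measurable borel"
    by (intro borel_measurable_continuous_onI cont_left)+
  have l2: "integrable lborel (\<lambda>x. (indicator {..0} x * toy_left h m x)\<^sup>2)" "integrable lborel (\<lambda>x. (indicator {..0} x * toy_left' h m x)\<^sup>2)"
  proof -
    have "(indicator {..0} x * y)\<^sup>2 = indicator {..0} x * y\<^sup>2" for x y :: real by (simp add: indicator_def)
    then show "integrable lborel (\<lambda>x. (indicator {..0} x * toy_left h m x)\<^sup>2)" "integrable lborel (\<lambda>x. (indicator {..0} x * toy_left' h m x)\<^sup>2)"
      using integrable_toy_left(1,2)[OF h, of m] by simp_all
  qed
  have w2const: "w2 x = w2 0" if "x \<le> 0" for x
  proof (cases "x = 0")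
    case False
    show ?thesis
    proof (rule DERIV_isconst_end[of x 0, symmetric])
      show "continuous_on {x..0} w2" unfolding w2_def
        by (intro continuous_intros continuous_on_subset[OF cu] continuous_on_subset[OF cD] cont_left) auto
      show "(w2 has_real_derivative 0) (at t)" if "x < t" "t < 0" for t
      proof -
        have q: "(toy_W t - lam) / k\<^sup>2 = (- t - h\<^sup>2 * m) / (h ^ 3)\<^sup>2" using that by (simp add: toy_W_def lam_def k_def)
        have d: "(D has_real_derivative (- t - h\<^sup>2 * m) / (h ^ 3)\<^sup>2 * u t) (at t)"
          using DD[of t] that unfolding q by simp
        have "(w2 has_real_derivative (D t * toy_left' h m t + (- t - h\<^sup>2 * m) / (h ^ 3)\<^sup>2 * toy_left h m t * u t)
           - ((- t - h\<^sup>2 * m) / (h ^ 3)\<^sup>2 * u t * toy_left h m t + toy_left' h m t * D t)) (at t)"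
          unfolding w2_def
          by (intro DERIV_diff DERIV_mult Du d toy_left_has_derivative toy_left'_has_derivative[OF h])
        then show ?thesis by (simp add: mult_ac)
      qed
    qed (use that False in auto)
  qed simp
  have w20: "w2 0 = 0"
  proof -
    have "integrable lborel (\<lambda>x. u x * (indicator {..0} x * toy_left' h m x))" "integrable lborel (\<lambda>x. D x * (indicator {..0} x * toy_left h m x))"
      using u2 D2 l2 by (simp_all add: integrable_mult_of_squares)
    then have "integrable lborel (\<lambda>x. u x * (indicator {..0} x * toy_left' h m x) - D x * (indicator {..0} x * toy_left h m x))"
      by (rule Bochner_Integration.integrable_diff)
    then have "\<bar>w2 0\<bar> \<le> 0"
    proof (rule integrable_lower_bound_at_bot[where R = 0])
      fix x :: real assume "x \<le> 0"
      then show "\<bar>w2 0\<bar> \<le> \<bar>u x * (indicator {..0} x * toy_left' h m x) - D x * (indicator {..0} x * toy_left h m x)\<bar>"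
        using w2const[of x] by (simp add: w2_def)
    qed
    then show ?thesis by simp
  qed
  have u0: "u 0 \<noteq> 0"
  proof
    assume z: "u 0 = 0"
    have z': "D 0 = 0" using D0 z by simp
    \<comment> \<open>The potential is unbounded on the left, so uniqueness is applied on each
      interval between 0 and x with its own constant.\<close>
    have q: "\<bar>(toy_W t - lam) / k\<^sup>2\<bar> \<le> (r + 1 + \<bar>lam\<bar>) / k\<^sup>2" if "\<bar>t\<bar> \<le> r" for t r
      using toy_W_le[of t] toy_W_nonneg[of t] that by (auto simp: abs_divide intro!: divide_right_mono)
    have "u x = 0" for x
    proof (cases "x \<ge> 0")
      case True
      show ?thesis
      proof (rule linear_ode_zero(1)[where u = u and D = D and a = 0 and q = "\<lambda>t. (toy_W t - lam) / k\<^sup>2" and K = "(x + 1 + \<bar>lam\<bar>) / k\<^sup>2"])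
        show "continuous_on {0..x} u" "continuous_on {0..x} D" using cu cD continuous_on_subset by blast+
      qed (use True z z' Du DD q in auto)
    next
      case False
      have "(\<lambda>t. u (- t)) (- x) = 0"
      proof (rule linear_ode_zero(1)[where u = "\<lambda>t. u (- t)" and D = "\<lambda>t. - D (- t)" and a = 0
            and q = "\<lambda>t. (toy_W (- t) - lam) / k\<^sup>2" and K = "(- x + 1 + \<bar>lam\<bar>) / k\<^sup>2"])
        show "continuous_on {0..- x} (\<lambda>t. u (- t))" "continuous_on {0..- x} (\<lambda>t. - D (- t))"
          by (intro continuous_intros continuous_on_compose2[OF cu] continuous_on_compose2[OF cD]; simp)+
        show "((\<lambda>t. u (- t)) has_real_derivative - D (- t)) (at t)" for t
          by (rule DERIV_cong[OF DERIV_chain2[OF Du, of uminus "- 1"]]) (auto intro!: derivative_eq_intros)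
        show "((\<lambda>t. - D (- t)) has_real_derivative (toy_W (- t) - lam) / k\<^sup>2 * u (- t)) (at t)" if "0 < t" for t
        proof -
          have "- t \<noteq> 0" using that by simp
          moreover have "(uminus has_real_derivative - 1) (at t)" by (auto intro!: derivative_eq_intros)
          ultimately have "((\<lambda>t. D (- t)) has_real_derivative ((toy_W (- t) - lam) / k\<^sup>2 * u (- t)) * - 1) (at t)"
            by (intro DERIV_chain2[where g = uminus] DD)
          from DERIV_minus[OF this] show ?thesis by simp
        qed
        show "\<bar>(toy_W (- t) - lam) / k\<^sup>2\<bar> \<le> (- x + 1 + \<bar>lam\<bar>) / k\<^sup>2" if "0 < t" "t < - x" for t
          by (rule q) (use that in auto)
      qed (use False z z' in auto)
      then show ?thesis by simp
    qed
    then show False using pos by simp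
  qed
  have "u 0 * (toy_left' h m 0 + c * toy_left h m 0) = 0"
    using w20 unfolding w2_def D0 by (simp add: algebra_simps)
  then have "airyA' m / h\<^sup>2 + sqrt (1 - lam) / k * airyA m = 0"
    using u0 by (simp add: toy_left_0 toy_left'_0 c_def)
  then have "k * (airyA' m / h\<^sup>2) + k * (sqrt (1 - lam) / k * airyA m) = 0"
    by (simp only: distrib_left[symmetric] mult_zero_right)
  moreover have "k * (airyA' m / h\<^sup>2) = h * airyA' m"
    using h by (simp add: k_def power2_eq_square power3_eq_cube)
  moreover have "k * (sqrt (1 - lam) / k * airyA m) = sqrt (1 - lam) * airyA m" using k by simp
  ultimately show ?thesis by (simp add: lam_def)
qed

text \<open>Passing to m is division by h^2. Signs exclude m \<le> 0: there A A' \<ge> 0, so after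
  multiplication by A(m) the two terms cannot cancel unless A(m), and with it A'(m), vanishes.
  Positivity leaves a bounded range (0, M] to the later compactness argument.\<close>

lemma toy_ev_below1_eq:
  assumes h: "h > 0"
  shows "toy_ev_below1 (h ^ 3) =
    (\<lambda>m. h\<^sup>2 * m) ` {m. 0 < m \<and> h\<^sup>2 * m < 1 \<and> h * airyA' m + sqrt (1 - h\<^sup>2 * m) * airyA m = 0}" (is "_ = _ ` ?M")
proof (intro equalityI subsetI)
  fix lam assume "lam \<in> (\<lambda>m. h\<^sup>2 * m) ` ?M"
  then show "lam \<in> toy_ev_below1 (h ^ 3)"
    using toy_eigenvalue_if_matching[OF h] by (auto simp: toy_ev_below1_def)
next
  fix lam assume lam: "lam \<in> toy_ev_below1 (h ^ 3)"
  define m where "m = lam / h\<^sup>2"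
  have lm: "lam = h\<^sup>2 * m" using h by (simp add: m_def)
  have lt: "h\<^sup>2 * m < 1" and ev: "toy_eigenvalue (h ^ 3) (h\<^sup>2 * m)"
    using lam by (auto simp: toy_ev_below1_def lm)
  have F: "h * airyA' m + sqrt (1 - h\<^sup>2 * m) * airyA m = 0"
    by (rule matching_if_toy_eigenvalue[OF h lt ev])
  have "m > 0"
  proof (rule ccontr)
    assume "\<not> m > 0"
    then have "airyA m * airyA' m \<ge> 0"
      using airy_Ai_mult_deriv_nonpos[of "- m"] by (simp add: airyA_def airyA'_def)
    then have "0 \<le> h * (airyA m * airyA' m)" using h by simp
    also have "h * (airyA m * airyA' m) = - (sqrt (1 - h\<^sup>2 * m) * (airyA m)\<^sup>2)"
    proof -
      have "h * airyA' m = - (sqrt (1 - h\<^sup>2 * m) * airyA m)" using F by simp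
      then have "airyA m * (h * airyA' m) = airyA m * (- (sqrt (1 - h\<^sup>2 * m) * airyA m))" by simp
      then show ?thesis by (simp add: power2_eq_square mult_ac)
    qed
    finally have "sqrt (1 - h\<^sup>2 * m) * (airyA m)\<^sup>2 \<le> 0" by simp
    moreover have "sqrt (1 - h\<^sup>2 * m) > 0" using lt by simp
    ultimately have "(airyA m)\<^sup>2 \<le> 0" by (simp add: mult_le_0_iff)
    then have "airyA m = 0" by simp
    then show False using F h airyA_zero_simple by simp
  qed
  then show "lam \<in> (\<lambda>m. h\<^sup>2 * m) ` ?M" using F lt lm by auto
qed

section \<open>Analytic branches of roots\<close>

definition toy_matching :: "real \<Rightarrow> real \<Rightarrow> bool" where
  "toy_matching h m \<longleftrightarrow> h\<^sup>2 * m < 1 \<and> h * airyA' m + sqrt (1 - h\<^sup>2 * m) * airyA m = 0"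

text \<open>The matching condition can be solved for \<open>h\<close>, so that only one-variable inversion is needed.\<close>

lemma toy_matching_iff:
  fixes h x :: real
  defines "r \<equiv> airyA x / airyA' x"
  assumes h: "h > 0" and A': "airyA' x \<noteq> 0" and p: "1 + x * r\<^sup>2 > 0"
  shows "toy_matching h x \<longleftrightarrow> - r / sqrt (1 + x * r\<^sup>2) = h"
proof
  assume m: "toy_matching h x"
  define t where "t = sqrt (1 - h\<^sup>2 * x)"
  have t: "t > 0" "t\<^sup>2 = 1 - h\<^sup>2 * x" using m by (simp_all add: toy_matching_def t_def)
  have "h * airyA' x = - (t * airyA x)" using m by (simp add: toy_matching_def t_def)
  \<comment> \<open>From r = -h / t follows 1 + x r^2 = 1 / t^2; as t > 0, taking the root loses no
    sign and h is recovered.\<close>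
  then have r: "r = - h / t" using A' t(1) by (simp add: r_def field_simps)
  have "1 + x * r\<^sup>2 = (t\<^sup>2 + h\<^sup>2 * x) / t\<^sup>2" using t(1) by (simp add: r field_simps)
  also have "\<dots> = (1 / t)\<^sup>2" by (simp add: t(2) power_divide)
  finally have "sqrt (1 + x * r\<^sup>2) = 1 / t" using t(1) by simp
  then show "- r / sqrt (1 + x * r\<^sup>2) = h" using t(1) by (simp add: r)
next
  assume e: "- r / sqrt (1 + x * r\<^sup>2) = h"
  define s where "s = sqrt (1 + x * r\<^sup>2)"
  have s: "s > 0" "s\<^sup>2 = 1 + x * r\<^sup>2" using p by (simp_all add: s_def)
  have r: "r = - h * s" using e s(1) by (simp add: s_def[symmetric] field_simps)
  have "s\<^sup>2 * (1 - h\<^sup>2 * x) = 1" using s(2) unfolding r by (simp add: power_mult_distrib algebra_simps)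
  then have q: "1 - h\<^sup>2 * x = (1 / s)\<^sup>2" using s(1) by (simp add: field_simps)
  have "airyA x = r * airyA' x" using A' by (simp add: r_def)
  then have "h * airyA' x + sqrt (1 - h\<^sup>2 * x) * airyA x = 0"
    using s(1) unfolding q by (simp add: r)
  moreover have "1 - h\<^sup>2 * x > 0" unfolding q using s(1) by simp
  ultimately show "toy_matching h x" by (simp add: toy_matching_def)
qed

section \<open>The matching function in the complex plane\<close>

definition cairyA :: "complex \<Rightarrow> complex" where
  "cairyA z = airy_sol airy_Ai0 airy_Ai0' (- z)"

definition cairyA' :: "complex \<Rightarrow> complex" where
  "cairyA' z = - airy_sol_deriv airy_Ai0 airy_Ai0' (- z)"

lemma cairyA_has_derivative: "(cairyA has_field_derivative cairyA' z) (at z)"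
  unfolding cairyA_def[abs_def] cairyA'_def
  by (rule DERIV_cong[OF DERIV_chain2[OF airy_sol_has_derivative, of uminus "- 1"]]) (auto intro!: derivative_eq_intros)

lemma cairyA'_has_derivative: "(cairyA' has_field_derivative - z * cairyA z) (at z)"
  unfolding cairyA_def cairyA'_def[abs_def]
  by (rule DERIV_cong[OF DERIV_minus[OF DERIV_chain2[OF airy_sol_deriv_has_derivative, of uminus "- 1"]]])
     (auto intro!: derivative_eq_intros)

lemma cairyA_of_real: "cairyA (of_real x) = of_real (airyA x)"
  and cairyA'_of_real: "cairyA' (of_real x) = of_real (airyA' x)"
  by (simp_all add: cairyA_def cairyA'_def airyA_def airyA'_def airy_Ai_eq airy_Ai'_def
        airy_sol_of_real airy_sol_deriv_of_real flip: of_real_minus)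

lemma cairyA_cnj: "cairyA (cnj z) = cnj (cairyA z)"
  and cairyA'_cnj: "cairyA' (cnj z) = cnj (cairyA' z)"
  using airy_sol_cnj[of _ _ "- z"] airy_sol_deriv_cnj[of _ _ "- z"]
  by (simp_all add: cairyA_def cairyA'_def)

text \<open>The complex extension \<open>H\<close> of h as a function of m is locally invertible at
  the zero, and the Taylor series of its inverse is the branch. Injectivity of \<open>H\<close> on
  the ball supplies the last clause: no other root lies near \<open>z0\<close>, which the count of
  eigenvalues relies on.\<close>

lemma toy_branch:
  assumes z0: "airyA z0 = 0"
  obtains a :: "nat \<Rightarrow> real" and R e where "R > 0" "e > 0" "a 0 = z0"
    "\<And>h. 0 < h \<Longrightarrow> h < R \<Longrightarrow> summable (\<lambda>j. a j * h ^ j)"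
    "\<And>h. 0 < h \<Longrightarrow> h < R \<Longrightarrow> toy_matching h (\<Sum>j. a j * h ^ j)"
    "\<And>h m. 0 < h \<Longrightarrow> h < R \<Longrightarrow> \<bar>m - z0\<bar> < e \<Longrightarrow> toy_matching h m \<Longrightarrow> m = (\<Sum>j. a j * h ^ j)"
proof -
  have A'0: "airyA' z0 \<noteq> 0" by (rule airyA_zero_simple[OF z0])
  define Z where "Z = complex_of_real z0"
  have cA0: "cairyA Z = 0" and cA'0: "cairyA' Z \<noteq> 0"
    using z0 A'0 by (simp_all add: Z_def cairyA_of_real cairyA'_of_real)
  define r where "r z = cairyA z / cairyA' z" for z
  \<comment> \<open>The radicand. Where its real part is positive the principal root is holomorphic,
    and at real points it is the real square root.\<close>
  define S where "S z = 1 + z * (r z)\<^sup>2" for z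
  have r0: "r Z = 0" by (simp add: r_def cA0)
  have cont: "isCont cairyA z" "isCont cairyA' z" for z
    using cairyA_has_derivative cairyA'_has_derivative DERIV_isCont by blast+
  have contr: "isCont r Z" unfolding r_def using cA'0 by (intro continuous_intros cont)
  have "isCont (\<lambda>z. Re (S z)) Z" unfolding S_def by (intro isCont_Re continuous_intros contr)
  then have "((\<lambda>z. Re (S z)) \<longlongrightarrow> Re (S Z)) (nhds Z)"
    using tendsto_at_iff_tendsto_nhds[of "\<lambda>z. Re (S z)" Z] by (simp only: isCont_def)
  then have ev1: "\<forall>\<^sub>F z in nhds Z. Re (S z) > 0" by (rule order_tendstoD) (simp add: S_def r0)
  have "(cairyA' \<longlongrightarrow> cairyA' Z) (nhds Z)"
    using cont(2)[of Z] tendsto_at_iff_tendsto_nhds[of cairyA' Z] by (simp only: isCont_def)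
  then have ev2: "\<forall>\<^sub>F z in nhds Z. cairyA' z \<noteq> 0" using cA'0 by (rule tendsto_imp_eventually_ne)
  from eventually_conj[OF ev1 ev2] obtain \<rho> where \<rho>: "\<rho> > 0"
      "\<And>z. z \<in> ball Z \<rho> \<Longrightarrow> Re (S z) > 0 \<and> cairyA' z \<noteq> 0"
    unfolding eventually_nhds_metric by (auto simp: dist_commute)
  have holA: "cairyA holomorphic_on T" "cairyA' holomorphic_on T" for T
    using cairyA_has_derivative cairyA'_has_derivative
    by (meson field_differentiable_at_within field_differentiable_def holomorphic_on_def)+
  have holr: "r holomorphic_on ball Z \<rho>"
    unfolding r_def using \<rho>(2) by (intro holomorphic_intros holA) auto
  have nonpos: "S z \<notin> \<real>\<^sub>\<le>\<^sub>0" if "z \<in> ball Z \<rho>" for z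
    using \<rho>(2)[OF that] by (auto simp: complex_nonpos_Reals_iff)
  have holS: "S holomorphic_on ball Z \<rho>" unfolding S_def by (intro holomorphic_intros holr)
  define q where "q z = 1 / csqrt (S z)" for z
  have holq: "q holomorphic_on ball Z \<rho>"
    unfolding q_def using nonpos by (intro holomorphic_intros holS) force+
  define H where "H z = - (r z * q z)" for z
  have holH: "H holomorphic_on ball Z \<rho>" unfolding H_def by (intro holomorphic_intros holr holq)
  have Zin: "Z \<in> ball Z \<rho>" using \<rho> by simp
  have "deriv H Z \<noteq> 0"
  proof -
    have dr: "(r has_field_derivative 1) (at Z)"
      unfolding r_def
      by (rule DERIV_cong[OF DERIV_divide[OF cairyA_has_derivative cairyA'_has_derivative cA'0]]) (use cA'0 cA0 in simp)
    have dq: "(q has_field_derivative deriv q Z) (at Z)"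
      by (rule holomorphic_derivI[OF holq _ Zin]) simp
    \<comment> \<open>At the zero r = 0, r' = 1 and q = 1, so the derivative of q drops out of the
      product rule.\<close>
    have "(H has_field_derivative - 1) (at Z)"
      unfolding H_def
      by (rule DERIV_cong[OF DERIV_minus[OF DERIV_mult[OF dr dq]]]) (simp add: r0 q_def S_def)
    then show ?thesis by (simp add: DERIV_imp_deriv)
  qed
  then obtain e where e: "e > 0" "ball Z e \<subseteq> ball Z \<rho>" "inj_on H (ball Z e)"
    using has_complex_derivative_locally_injective[OF holH Zin open_ball] by metis
  have holHe: "H holomorphic_on ball Z e" using holH e(2) by (rule holomorphic_on_subset)
  obtain g where g: "g holomorphic_on (H ` ball Z e)" "\<And>z. z \<in> ball Z e \<Longrightarrow> g (H z) = z"
    using holomorphic_has_inverse[OF holHe open_ball e(3)] by metis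
  have opn: "open (H ` ball Z e)" by (rule open_mapping_thm3[OF holHe open_ball e(3)])
  have H0: "H Z = 0" by (simp add: H_def r0)
  then have "0 \<in> H ` ball Z e" using e(1) by (intro image_eqI[of _ _ Z]) auto
  then obtain R where R: "R > 0" "ball 0 R \<subseteq> H ` ball Z e"
    using opn open_contains_ball by metis
  have holg: "g holomorphic_on ball 0 R" using g(1) R(2) by (rule holomorphic_on_subset)
  \<comment> \<open>Real parts suffice: for 0 < h < R the value g(h) is shown below to be
    real.\<close>
  define a where "a j = Re ((deriv ^^ j) g 0 / fact j)" for j
  have g0: "g 0 = Z" using g(2)[of Z] e(1) H0 by simp
  have a0: "a 0 = z0" by (simp add: a_def g0 Z_def)
  have sums: "(\<lambda>j. a j * h ^ j) sums Re (g (of_real h))" if "\<bar>h\<bar> < R" for h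
  proof -
    have "(\<lambda>n. (deriv ^^ n) g 0 / fact n * (of_real h - 0) ^ n) sums g (of_real h)"
      by (rule holomorphic_power_series[OF holg]) (use that in simp)
    then have "(\<lambda>n. Re ((deriv ^^ n) g 0 / fact n * of_real (h ^ n))) sums Re (g (of_real h))"
      by (intro sums_Re) simp
    moreover have "Re (w * of_real x) = Re w * x" for w x by simp
    ultimately show ?thesis unfolding a_def by (simp only:)
  qed
  have Hcnj: "H (cnj z) = cnj (H z)" if "z \<in> ball Z \<rho>" for z
    using cnj_csqrt[OF nonpos[OF that]]
    by (simp add: H_def q_def S_def r_def cairyA_cnj cairyA'_cnj)
  have real: "H (of_real x) = of_real h \<longleftrightarrow> toy_matching h x" if "\<bar>x - z0\<bar> < e" "h > 0" for x h
  proof -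
    have "of_real x \<in> ball Z e" using that(1) by (simp add: Z_def dist_real_def abs_minus_commute dist_of_real)
    then have x: "of_real x \<in> ball Z \<rho>" using e(2) by blast
    define rr where "rr = airyA x / airyA' x"
    have rr: "r (of_real x) = of_real rr" by (simp add: r_def rr_def cairyA_of_real cairyA'_of_real)
    have A': "airyA' x \<noteq> 0" using \<rho>(2)[OF x] by (simp add: cairyA'_of_real)
    have Sx: "S (of_real x) = of_real (1 + x * rr\<^sup>2)" by (simp add: S_def rr)
    have p: "1 + x * rr\<^sup>2 > 0" using \<rho>(2)[OF x] unfolding Sx by simp
    have "csqrt (S (of_real x)) = of_real (sqrt (1 + x * rr\<^sup>2))"
      unfolding Sx using p by (intro csqrt_of_real_nonneg[THEN trans]) auto
    then have "H (of_real x) = of_real (- rr / sqrt (1 + x * rr\<^sup>2))"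
      by (simp add: H_def q_def rr)
    then have "H (of_real x) = of_real h \<longleftrightarrow> - rr / sqrt (1 + x * rr\<^sup>2) = h"
      by (simp only: of_real_eq_iff)
    then show ?thesis using toy_matching_iff[OF that(2) A'] p by (simp add: rr_def)
  qed
  have inverse: "\<exists>x. Re (g (of_real h)) = x \<and> \<bar>x - z0\<bar> < e \<and> H (of_real x) = of_real h" if "0 < h" "h < R" for h
  proof -
    have "complex_of_real h \<in> ball 0 R" using that by simp
    then obtain z where z: "z \<in> ball Z e" "H z = of_real h" using R(2) by (metis imageE subsetD)
    have gz: "g (of_real h) = z" using g(2)[OF z(1)] z(2) by simp
    have cz: "cnj z \<in> ball Z e"
    proof -
      have "dist Z (cnj z) = norm (cnj (Z - z))" by (simp add: dist_norm Z_def)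
      then show ?thesis using z(1) by (simp add: dist_norm del: complex_cnj_diff)
    qed
    \<comment> \<open>A real value of \<open>H\<close> is taken at z and at its conjugate alike;
      injectivity on the ball, which is symmetric about the real axis, makes z real.\<close>
    have "H (cnj z) = H z" using Hcnj[of z] z e(2) by auto
    then have "cnj z = z" using e(3) z(1) cz by (auto dest: inj_onD)
    then have zr: "z = of_real (Re z)" by (simp add: complex_eq_iff)
    have "dist Z (of_real (Re z)) < e" using z(1) zr by simp
    then have "\<bar>Re z - z0\<bar> < e" by (simp add: Z_def dist_of_real dist_real_def abs_minus_commute)
    then show ?thesis using gz zr z(2) by metis
  qed
  have S1: "(\<Sum>j. a j * h ^ j) = Re (g (of_real h))" if "0 < h" "h < R" for h
    using sums[of h] that by (simp add: sums_iff)
  show thesis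
  proof (rule that[of R e a, OF R(1) e(1) a0])
    fix h assume h: "0 < h" "h < R"
    show "summable (\<lambda>j. a j * h ^ j)" using sums[of h] h by (simp add: sums_iff)
    show "toy_matching h (\<Sum>j. a j * h ^ j)"
      using inverse[OF h] real h S1[OF h] by metis
    fix m assume m: "\<bar>m - z0\<bar> < e" "toy_matching h m"
    have "H (of_real m) = of_real h" using real[OF m(1) h(1)] m(2) by simp
    moreover have "of_real m \<in> ball Z e" using m(1) by (simp add: Z_def dist_of_real dist_real_def abs_minus_commute)
    ultimately have "g (of_real h) = of_real m" using g(2) by metis
    then show "m = (\<Sum>j. a j * h ^ j)" by (simp add: S1[OF h])
  qed
qed

section \<open>Counting the roots\<close>

lemma card_less_strict_mono:
  fixes S :: "real set"
  assumes "x \<in> S" "x < y" "finite {s \<in> S. s < y}"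
  shows "card {s \<in> S. s < x} < card {s \<in> S. s < y}"
  by (rule psubset_card_mono) (use assms in auto)

text \<open>The number of smaller elements grows strictly along S, so a rank is taken at most once
  and the definite description has a unique witness.\<close>

lemma nth_smallest_eqI:
  assumes "x \<in> S" "finite {y \<in> S. y < x}" "card {y \<in> S. y < x} = n - 1"
  shows "nth_smallest S n = x"
  unfolding nth_smallest_def
proof (rule the_equality)
  fix y assume y: "y \<in> S \<and> finite {z \<in> S. z < y} \<and> card {z \<in> S. z < y} = n - 1"
  then show "y = x"
    using card_less_strict_mono[of x S y] card_less_strict_mono[of y S x] assms
    by (metis less_irrefl linorder_less_linear)
qed (use assms in auto)

text \<open>Makes the description behind \<open>zA\<close> denote for every rank. The successor of x
  is the minimum of the elements in (x, s] for some larger s in S; truncation at s makes that set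
  finite.\<close>

lemma ex_nth_smallest:
  fixes S :: "real set"
  assumes unb: "\<And>M. \<exists>x\<in>S. x > M" and fin: "\<And>M. finite {x \<in> S. x \<le> M}"
  shows "\<exists>x\<in>S. card {y \<in> S. y < x} = n"
proof (induction n)
  case 0
  obtain s where s: "s \<in> S" using unb by blast
  define x where "x = Min {y \<in> S. y \<le> s}"
  have x: "x \<in> {y \<in> S. y \<le> s}" unfolding x_def using s fin by (intro Min_in) auto
  have "{y \<in> S. y < x} = {}"
  proof safe
    fix y assume "y \<in> S" "y < x"
    then have "x \<le> y" unfolding x_def using x fin by (intro Min_le) (auto simp: x_def)
    then show "y \<in> {}" using \<open>y < x\<close> by simp
  qed
  then show ?case using x by (metis (no_types, lifting) card.empty mem_Collect_eq)
next
  case (Suc n)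
  then obtain x where x: "x \<in> S" "card {y \<in> S. y < x} = n" by blast
  obtain s where s: "s \<in> S" "s > x" using unb by blast
  have f: "finite {y \<in> S. x < y \<and> y \<le> s}" by (rule finite_subset[OF _ fin[of s]]) auto
  define x' where "x' = Min {y \<in> S. x < y \<and> y \<le> s}"
  have x': "x' \<in> {y \<in> S. x < y \<and> y \<le> s}" unfolding x'_def using s f by (intro Min_in) auto
  have min: "x' \<le> y" if "y \<in> S" "x < y" for y
  proof (cases "y \<le> s")
    case True
    then show ?thesis unfolding x'_def using that f by (intro Min_le) auto
  qed (use x' in auto)
  have "{y \<in> S. y < x'} = insert x {y \<in> S. y < x}"
    using x x' min by (auto simp: not_less) (metis linorder_not_less linorder_less_linear)
  moreover have "finite {y \<in> S. y < x}" by (rule finite_subset[OF _ fin[of x]]) auto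
  ultimately have "card {y \<in> S. y < x'} = Suc n" using x(2) by simp
  then show ?case using x' by auto
qed

section \<open>Enumeration of the positive zeros\<close>

abbreviation airyA_zeros :: "real set" where
  "airyA_zeros \<equiv> {x. 0 < x \<and> airyA x = 0}"

lemma finite_airyA_zeros_less: "finite {y \<in> airyA_zeros. y < x}"
  by (rule finite_subset[OF _ finite_airyA_zeros[of x]]) auto

lemma zA_props:
  assumes "n \<ge> 1"
  shows "zA n > 0" "airyA (zA n) = 0" "card {y \<in> airyA_zeros. y < zA n} = n - 1"
proof -
  have "\<exists>x\<in>airyA_zeros. card {y \<in> airyA_zeros. y < x} = n - 1"
  proof (rule ex_nth_smallest)
    show "\<exists>x\<in>airyA_zeros. M < x" for M using airyA_zeros_unbounded[of "max M 0"] by auto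
    show "finite {x \<in> airyA_zeros. x \<le> M}" for M
      by (rule finite_subset[OF _ finite_airyA_zeros[of M]]) auto
  qed
  then obtain x where x: "x \<in> airyA_zeros" "card {y \<in> airyA_zeros. y < x} = n - 1" by blast
  have "zA n = x" unfolding zA_def by (rule nth_smallest_eqI[OF x(1) finite_airyA_zeros_less x(2)])
  then show "zA n > 0" "airyA (zA n) = 0" "card {y \<in> airyA_zeros. y < zA n} = n - 1" using x by auto
qed

text \<open>\<open>1 \<le> i\<close> matters: truncated subtraction gives index 0 the same rank as
  index 1.\<close>

lemma zA_less:
  assumes "1 \<le> i" "i < j"
  shows "zA i < zA j"
proof (rule ccontr)
  assume "\<not> zA i < zA j"
  then have "card {y \<in> airyA_zeros. y < zA j} \<le> card {y \<in> airyA_zeros. y < zA i}"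
    by (intro card_mono finite_airyA_zeros_less) auto
  then show False using zA_props(3)[of i] zA_props(3)[of j] assms by simp
qed

lemma airyA_zero_is_zA:
  assumes "0 < x" "airyA x = 0"
  obtains k where "k \<ge> 1" "x = zA k"
proof
  show "card {y \<in> airyA_zeros. y < x} + 1 \<ge> 1" by simp
  show "x = zA (card {y \<in> airyA_zeros. y < x} + 1)"
    unfolding zA_def by (rule nth_smallest_eqI[symmetric]) (use assms finite_airyA_zeros_less in auto)
qed

text \<open>Away from the zeros |A| has a positive minimum on a compact set, whereas a root
  satisfies |A(m)| \<le> 2 h C, which fails for small h. This excludes stray roots that the local
  branches cannot see.\<close>

lemma toy_matching_near_zeros:
  assumes N: "N \<ge> 1" and e: "\<And>k. 1 \<le> k \<Longrightarrow> k \<le> N \<Longrightarrow> e k > 0"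
  shows "\<forall>\<^sub>F h in at_right 0. \<forall>m. 0 < m \<and> m \<le> zA N \<and> toy_matching h m \<longrightarrow> (\<exists>k\<in>{1..N}. \<bar>m - zA k\<bar> < e k)"
proof -
  define M where "M = zA N"
  have M: "M > 0" using zA_props(1)[OF N] by (simp add: M_def)
  define K where "K = {0..M} - (\<Union>k\<in>{1..N}. ball (zA k) (e k))"
  have K: "compact K" unfolding K_def by (intro compact_diff compact_Icc open_UN) auto
  have nz: "airyA x \<noteq> 0" if "x \<in> K" for x
  proof
    assume 0: "airyA x = 0"
    have x: "0 \<le> x" "x \<le> M" using that by (auto simp: K_def)
    then have "0 < x" using 0 airyA_0_pos by (cases "x = 0") auto
    then obtain k where k: "k \<ge> 1" "x = zA k" using airyA_zero_is_zA 0 by blast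
    \<comment> \<open>A zero not beyond \<open>zA N\<close> has index at most N, so its
      neighbourhood has been removed from \<open>K\<close>.\<close>
    have "k \<le> N" using zA_less[OF N, of k] x k by (force simp: M_def)
    then have "x \<in> ball (zA k) (e k)" "k \<in> {1..N}" using k e[of k] by auto
    then show False using that unfolding K_def by blast
  qed
  obtain \<delta> where \<delta>: "\<delta> > 0" "\<And>x. x \<in> K \<Longrightarrow> \<delta> \<le> \<bar>airyA x\<bar>"
  proof (cases "K = {}")
    case True
    then show ?thesis using that[of 1] by simp
  next
    case False
    have "continuous_on K (\<lambda>x. \<bar>airyA x\<bar>)" by (intro continuous_intros)
    from continuous_attains_inf[OF K False this] obtain x where
      "x \<in> K" "\<And>y. y \<in> K \<Longrightarrow> \<bar>airyA x\<bar> \<le> \<bar>airyA y\<bar>" by auto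
    then show ?thesis using that[of "\<bar>airyA x\<bar>"] nz by simp
  qed
  obtain C where C: "\<And>x. x \<in> {0..M} \<Longrightarrow> \<bar>airyA' x\<bar> \<le> C"
  proof -
    have "continuous_on {0..M} (\<lambda>x. \<bar>airyA' x\<bar>)" by (intro continuous_intros)
    from continuous_attains_sup[OF compact_Icc _ this] show ?thesis using that M by force
  qed
  have C0: "C \<ge> 0" using C[of 0] M by force
  have "((\<lambda>h::real. h\<^sup>2 * M) \<longlongrightarrow> 0\<^sup>2 * M) (at_right 0)" by (intro tendsto_intros)
  \<comment> \<open>The 3/4 leaves 1 - h^2 m \<ge> 1/4, hence a square root of at least 1/2, which
    is the source of the factor 2 in the next limit.\<close>
  then have ev1: "\<forall>\<^sub>F h in at_right 0. h\<^sup>2 * M < 3 / 4" by (rule order_tendstoD) simp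
  have "((\<lambda>h::real. 2 * h * C) \<longlongrightarrow> 2 * 0 * C) (at_right 0)" by (intro tendsto_intros)
  then have ev2: "\<forall>\<^sub>F h in at_right 0. 2 * h * C < \<delta>" by (rule order_tendstoD) (use \<delta> in simp)
  have ev3: "\<forall>\<^sub>F h::real in at_right 0. h > 0" by (rule eventually_at_right_less)
  show ?thesis
    using ev1 ev2 ev3
  proof eventually_elim
    case (elim h)
    show ?case
    proof (intro allI impI)
      fix m assume m: "0 < m \<and> m \<le> zA N \<and> toy_matching h m"
      define t where "t = sqrt (1 - h\<^sup>2 * m)"
      have "h\<^sup>2 * m \<le> h\<^sup>2 * M" using m by (intro mult_left_mono) (auto simp: M_def)
      then have "1 - h\<^sup>2 * m \<ge> (1 / 2)\<^sup>2" using elim(1) by (simp add: power2_eq_square)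
      then have t: "t \<ge> 1 / 2" unfolding t_def by (rule real_le_rsqrt)
      have "t * airyA m = - (h * airyA' m)" using m by (simp add: toy_matching_def t_def)
      then have "t * \<bar>airyA m\<bar> = h * \<bar>airyA' m\<bar>"
        using t elim(3) by (metis abs_minus_cancel abs_mult abs_of_nonneg abs_of_pos order.trans zero_le_divide_1_iff zero_le_numeral)
      moreover have "(1 / 2) * \<bar>airyA m\<bar> \<le> t * \<bar>airyA m\<bar>" using t by (intro mult_right_mono) auto
      moreover have "h * \<bar>airyA' m\<bar> \<le> h * C" using elim(3) C[of m] m by (intro mult_left_mono) (auto simp: M_def)
      ultimately have "\<bar>airyA m\<bar> \<le> 2 * h * C" by linarith
      then have "\<bar>airyA m\<bar> < \<delta>" using elim(2) by simp
      then have "m \<notin> K" using \<delta>(2) by force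
      then show "\<exists>k\<in>{1..N}. \<bar>m - zA k\<bar> < e k"
        using m by (auto simp: K_def M_def dist_real_def abs_minus_commute)
    qed
  qed
qed

theorem theorem2p3:
  shows "\<exists>\<alpha> :: nat \<Rightarrow> nat \<Rightarrow> real. (\<forall>n\<ge>1. \<alpha> 0 n = zA n) \<and>
    (\<forall>N0::nat. \<exists>\<kappa>0>0.
       (\<forall>\<kappa>. 0 < \<kappa> \<and> \<kappa> < \<kappa>0 \<longrightarrow>
          (\<forall>n. 1 \<le> n \<and> n \<le> N0 \<longrightarrow>
             (\<exists>lam\<in>toy_ev_below1 \<kappa>. finite {\<mu> \<in> toy_ev_below1 \<kappa>. \<mu> < lam} \<and>
                card {\<mu> \<in> toy_ev_below1 \<kappa>. \<mu> < lam} = n - 1))) \<and>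
       (\<forall>n. 1 \<le> n \<and> n \<le> N0 \<longrightarrow>
          (\<exists>\<kappa>1>0. \<kappa>1 \<le> \<kappa>0 \<and>
             (\<forall>\<kappa>. 0 < \<kappa> \<and> \<kappa> < \<kappa>1 \<longrightarrow>
                (\<exists>s. (\<lambda>j. \<alpha> j n * \<kappa> powr (real j / 3)) sums s \<and>
                     toy_ev \<kappa> n = \<kappa> powr (2/3) * s)))))"
proof -
  \<comment> \<open>All branches are chosen here, before N0 and \<kappa> are fixed: one family of
    coefficients has to serve every N0.\<close>
  have "\<forall>n. \<exists>a R e. n \<ge> 1 \<longrightarrow> R > 0 \<and> e > 0 \<and> a 0 = zA n \<and>
    (\<forall>h. 0 < h \<and> h < R \<longrightarrow> summable (\<lambda>j. a j * h ^ j) \<and> toy_matching h (\<Sum>j. a j * h ^ j)) \<and>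
    (\<forall>h m. 0 < h \<and> h < R \<and> \<bar>m - zA n\<bar> < e \<and> toy_matching h m \<longrightarrow> m = (\<Sum>j. a j * h ^ j))"
  proof
    fix n :: nat
    show "\<exists>a R e. n \<ge> 1 \<longrightarrow> R > 0 \<and> e > 0 \<and> a 0 = zA n \<and>
      (\<forall>h. 0 < h \<and> h < R \<longrightarrow> summable (\<lambda>j. a j * h ^ j) \<and> toy_matching h (\<Sum>j. a j * h ^ j)) \<and>
      (\<forall>h m. 0 < h \<and> h < R \<and> \<bar>m - zA n\<bar> < e \<and> toy_matching h m \<longrightarrow> m = (\<Sum>j. a j * h ^ j))"
    proof (cases "n \<ge> 1")
      case True
      show ?thesis
      proof (rule toy_branch[OF zA_props(2)[OF True]])
        fix a :: "nat \<Rightarrow> real" and R e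
        assume "R > 0" "e > 0" "a 0 = zA n"
          "\<And>h. 0 < h \<Longrightarrow> h < R \<Longrightarrow> summable (\<lambda>j. a j * h ^ j)"
          "\<And>h. 0 < h \<Longrightarrow> h < R \<Longrightarrow> toy_matching h (\<Sum>j. a j * h ^ j)"
          "\<And>h m. 0 < h \<Longrightarrow> h < R \<Longrightarrow> \<bar>m - zA n\<bar> < e \<Longrightarrow> toy_matching h m \<Longrightarrow> m = (\<Sum>j. a j * h ^ j)"
        then show ?thesis by (intro exI[of _ a] exI[of _ R] exI[of _ e]) auto
      qed
    qed auto
  qed
  then obtain a :: "nat \<Rightarrow> nat \<Rightarrow> real" and R e where
    *: "\<forall>n\<ge>1. R n > 0 \<and> e n > 0 \<and> a n 0 = zA n \<and>
    (\<forall>h. 0 < h \<and> h < R n \<longrightarrow> summable (\<lambda>j. a n j * h ^ j) \<and> toy_matching h (\<Sum>j. a n j * h ^ j)) \<and>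
    (\<forall>h m. 0 < h \<and> h < R n \<and> \<bar>m - zA n\<bar> < e n \<and> toy_matching h m \<longrightarrow> m = (\<Sum>j. a n j * h ^ j))"
    unfolding choice_iff by blast
  define b where "b n h = (\<Sum>j. a n j * h ^ j)" for n h
  have Rpos: "R n > 0" and epos: "e n > 0" and a0: "a n 0 = zA n" if "n \<ge> 1" for n using * that by blast+
  have summ: "summable (\<lambda>j. a n j * h ^ j)" and match: "toy_matching h (b n h)"
    if "n \<ge> 1" "0 < h" "h < R n" for n h using * that unfolding b_def by blast+
  have uniq: "m = b n h" if "n \<ge> 1" "0 < h" "h < R n" "\<bar>m - zA n\<bar> < e n" "toy_matching h m" for n h m
    using * that unfolding b_def by blast
  \<comment> \<open>A power series is continuous at 0 once it converges at a nonzero point, here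
    \<open>R n / 2\<close>.\<close>
  have lim: "((\<lambda>h. b n h) \<longlongrightarrow> zA n) (at_right 0)" if n: "n \<ge> 1" for n
  proof -
    have "isCont (b n) 0"
      unfolding b_def
      by (rule isCont_powser[where K = "R n / 2"]) (use Rpos[OF n] summ[OF n, of "R n / 2"] in auto)
    moreover have "b n 0 = zA n" using a0[OF n] by (simp add: b_def)
    ultimately have "(b n \<longlongrightarrow> zA n) (at 0)" by (simp add: isCont_def)
    then show ?thesis by (rule tendsto_within_subset) simp
  qed
  have small: "\<exists>h0>0. \<forall>h>0. h < h0 \<longrightarrow> (\<forall>n\<in>{1..N}.
      summable (\<lambda>j. a n j * h ^ j) \<and> h\<^sup>2 * b n h \<in> toy_ev_below1 (h ^ 3) \<and>
      finite {\<mu> \<in> toy_ev_below1 (h ^ 3). \<mu> < h\<^sup>2 * b n h} \<and>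
      card {\<mu> \<in> toy_ev_below1 (h ^ 3). \<mu> < h\<^sup>2 * b n h} = n - 1)" for N :: nat
  proof -
    \<comment> \<open>One zero more than there are eigenvalues to count: for small h it lies above
      the branches 1 to N, so every root below one of these falls into the range in which roots are
      known to be near zeros.\<close>
    let ?N = "Suc N"
    have ev0: "\<forall>\<^sub>F h::real in at_right 0. h > 0" by (rule eventually_at_right_less)
    have ev1: "\<forall>\<^sub>F h in at_right 0. \<forall>n\<in>{1..?N}. h < R n"
    proof (rule eventually_ball_finite)
      show "\<forall>n\<in>{1..?N}. \<forall>\<^sub>F h in at_right 0. h < R n"
      proof
        fix n assume "n \<in> {1..?N}"
        then show "\<forall>\<^sub>F h in at_right 0. h < R n"
          using eventually_at_right_real[OF Rpos[of n]] by (auto elim: eventually_mono)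
      qed
    qed simp
    have ev2: "\<forall>\<^sub>F h in at_right 0. \<forall>i\<in>{1..?N}. \<forall>j\<in>{1..?N}. i < j \<longrightarrow> b i h < b j h"
    proof (intro eventually_ball_finite ballI)
      fix i j assume ij: "i \<in> {1..?N}" "j \<in> {1..?N}"
      show "\<forall>\<^sub>F h in at_right 0. i < j \<longrightarrow> b i h < b j h"
      proof (cases "i < j")
        case True
        \<comment> \<open>A level strictly between the two limits separates the branches for small
          h.\<close>
        obtain c where "zA i < c" "c < zA j" using dense[OF zA_less[of i j]] ij True by auto
        with order_tendstoD(2)[OF lim[of i], of c] order_tendstoD(1)[OF lim[of j], of c] ij
        have "\<forall>\<^sub>F h in at_right 0. b i h < c" "\<forall>\<^sub>F h in at_right 0. c < b j h" by auto
        then show ?thesis by eventually_elim auto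
      qed auto
    qed auto
    have ev3: "\<forall>\<^sub>F h in at_right 0. \<forall>n\<in>{1..?N}. 0 < b n h"
      using order_tendstoD(1)[OF lim] zA_props(1) by (intro eventually_ball_finite ballI) auto
    have ev4: "\<forall>\<^sub>F h in at_right 0. \<forall>n\<in>{1..N}. b n h < zA ?N"
    proof (intro eventually_ball_finite ballI)
      fix n assume n: "n \<in> {1..N}"
      then have "zA n < zA ?N" by (intro zA_less) auto
      then show "\<forall>\<^sub>F h in at_right 0. b n h < zA ?N" using order_tendstoD(2)[OF lim[of n]] n by auto
    qed simp
    have ev5: "\<forall>\<^sub>F h in at_right 0. \<forall>m. 0 < m \<and> m \<le> zA ?N \<and> toy_matching h m \<longrightarrow> (\<exists>k\<in>{1..?N}. \<bar>m - zA k\<bar> < e k)"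
      by (rule toy_matching_near_zeros) (use epos in auto)
    have "\<forall>\<^sub>F h in at_right 0. \<forall>n\<in>{1..N}.
      summable (\<lambda>j. a n j * h ^ j) \<and> h\<^sup>2 * b n h \<in> toy_ev_below1 (h ^ 3) \<and>
      finite {\<mu> \<in> toy_ev_below1 (h ^ 3). \<mu> < h\<^sup>2 * b n h} \<and>
      card {\<mu> \<in> toy_ev_below1 (h ^ 3). \<mu> < h\<^sup>2 * b n h} = n - 1"
      using ev0 ev1 ev2 ev3 ev4 ev5
    proof eventually_elim
      case (elim h)
      note h = elim(1)
      have evs: "toy_ev_below1 (h ^ 3) = (\<lambda>m. h\<^sup>2 * m) ` {m. 0 < m \<and> toy_matching h m}"
        using toy_ev_below1_eq[OF h] by (simp add: toy_matching_def)
      have inj: "inj_on b' S" if "\<And>i j. i \<in> S \<Longrightarrow> j \<in> S \<Longrightarrow> i < j \<Longrightarrow> b' i < (b' j :: real)" for b' and S :: "nat set"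
        by (rule linorder_inj_onI') (use that in force)
      show ?case
      proof
        fix n assume n: "n \<in> {1..N}"
        then have n1: "n \<ge> 1" "n \<in> {1..?N}" by auto
        have mem: "h\<^sup>2 * b k h \<in> toy_ev_below1 (h ^ 3)" if "k \<in> {1..?N}" for k
          unfolding evs using elim(2,4) match[of k h] h that by auto
        \<comment> \<open>A root below branch n is near some zero, hence is the branch of that zero
          by local uniqueness, and the order of the branches puts its index below n.\<close>
        have "{\<mu> \<in> toy_ev_below1 (h ^ 3). \<mu> < h\<^sup>2 * b n h} = (\<lambda>k. h\<^sup>2 * b k h) ` {1..<n}"
        proof (intro equalityI subsetI)
          fix \<mu> assume "\<mu> \<in> {\<mu> \<in> toy_ev_below1 (h ^ 3). \<mu> < h\<^sup>2 * b n h}"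
          then obtain m where m: "\<mu> = h\<^sup>2 * m" "0 < m" "toy_matching h m" "h\<^sup>2 * m < h\<^sup>2 * b n h"
            unfolding evs by auto
          have mb: "m < b n h" using m(4) h by (simp add: mult_less_cancel_left)
          then have "m \<le> zA ?N" using elim(5) n by force
          then obtain k where k: "k \<in> {1..?N}" "\<bar>m - zA k\<bar> < e k" using elim(6) m by blast
          have mk: "m = b k h" using k elim(2) m(3) h by (intro uniq) auto
          have "k < n"
          proof (rule ccontr)
            assume "\<not> k < n"
            then have "k = n \<or> b n h < b k h"
              using elim(3)[rule_format, OF n1(2) k(1)] by linarith
            then show False using mb mk by auto
          qed
          then show "\<mu> \<in> (\<lambda>k. h\<^sup>2 * b k h) ` {1..<n}" using k m(1) mk by auto
        next
          fix \<mu> assume "\<mu> \<in> (\<lambda>k. h\<^sup>2 * b k h) ` {1..<n}"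
          then obtain k where k: "k \<in> {1..<n}" "\<mu> = h\<^sup>2 * b k h" by auto
          have "k \<in> {1..?N}" using k n by auto
          moreover have "b k h < b n h" using elim(3) k n1 \<open>k \<in> {1..?N}\<close> by auto
          ultimately show "\<mu> \<in> {\<mu> \<in> toy_ev_below1 (h ^ 3). \<mu> < h\<^sup>2 * b n h}"
            using mem k h by auto
        qed
        moreover have "inj_on (\<lambda>k. h\<^sup>2 * b k h) {1..<n}"
          by (rule inj) (use elim(3) n h in auto)
        ultimately have "finite {\<mu> \<in> toy_ev_below1 (h ^ 3). \<mu> < h\<^sup>2 * b n h} \<and>
           card {\<mu> \<in> toy_ev_below1 (h ^ 3). \<mu> < h\<^sup>2 * b n h} = n - 1"
          by (simp add: card_image)
        then show "summable (\<lambda>j. a n j * h ^ j) \<and> h\<^sup>2 * b n h \<in> toy_ev_below1 (h ^ 3) \<and>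
          finite {\<mu> \<in> toy_ev_below1 (h ^ 3). \<mu> < h\<^sup>2 * b n h} \<and>
          card {\<mu> \<in> toy_ev_below1 (h ^ 3). \<mu> < h\<^sup>2 * b n h} = n - 1"
          using mem[OF n1(2)] summ[of n h] elim(2) n1 h by auto
      qed
    qed
    then show ?thesis unfolding eventually_at_right_field .
  qed
  show ?thesis
  proof (rule exI[of _ "\<lambda>j n. a n j"], intro conjI allI impI)
    show "a n 0 = zA n" if "n \<ge> 1" for n by (rule a0[OF that])
    fix N0 :: nat
    obtain h0 where h0: "h0 > 0" and Hs: "\<forall>h>0. h < h0 \<longrightarrow> (\<forall>n\<in>{1..N0}.
      summable (\<lambda>j. a n j * h ^ j) \<and> h\<^sup>2 * b n h \<in> toy_ev_below1 (h ^ 3) \<and>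
      finite {\<mu> \<in> toy_ev_below1 (h ^ 3). \<mu> < h\<^sup>2 * b n h} \<and>
      card {\<mu> \<in> toy_ev_below1 (h ^ 3). \<mu> < h\<^sup>2 * b n h} = n - 1)"
      using small[of N0] by blast
    have H: "summable (\<lambda>j. a n j * h ^ j)" "h\<^sup>2 * b n h \<in> toy_ev_below1 (h ^ 3)"
      "finite {\<mu> \<in> toy_ev_below1 (h ^ 3). \<mu> < h\<^sup>2 * b n h}"
      "card {\<mu> \<in> toy_ev_below1 (h ^ 3). \<mu> < h\<^sup>2 * b n h} = n - 1"
      if "0 < h" "h < h0" "1 \<le> n \<and> n \<le> N0" for h n
    proof -
      have "n \<in> {1..N0}" using that by simp
      from Hs[rule_format, OF that(1,2) this] show "summable (\<lambda>j. a n j * h ^ j)" "h\<^sup>2 * b n h \<in> toy_ev_below1 (h ^ 3)"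
        "finite {\<mu> \<in> toy_ev_below1 (h ^ 3). \<mu> < h\<^sup>2 * b n h}"
        "card {\<mu> \<in> toy_ev_below1 (h ^ 3). \<mu> < h\<^sup>2 * b n h} = n - 1" by blast+
    qed
    \<comment> \<open>Return from h to \<kappa>: j = 3 gives \<kappa> = h^3, and j = 2 gives the
      prefactor \<open>\<kappa> powr (2/3)\<close>.\<close>
    have cube: "\<exists>h. 0 < h \<and> h < h0 \<and> \<kappa> = h ^ 3 \<and> (\<forall>j. \<kappa> powr (real j / 3) = h ^ j)"
      if \<kappa>: "0 < \<kappa>" "\<kappa> < h0 ^ 3" for \<kappa>
    proof -
      define h where "h = \<kappa> powr (1 / 3)"
      have h: "h > 0" using \<kappa> by (simp add: h_def)
      have p: "\<kappa> powr (real j / 3) = h ^ j" for j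
      proof -
        have "h ^ j = h powr real j" using h by (simp add: powr_realpow)
        also have "\<dots> = \<kappa> powr (1 / 3 * real j)" unfolding h_def by (rule powr_powr)
        finally show ?thesis by simp
      qed
      have k3: "\<kappa> = h ^ 3" using p[of 3] \<kappa> by simp
      then have "h < h0" using \<kappa> h0 by (meson less_imp_le power_less_imp_less_base)
      then show ?thesis using h p k3 by blast
    qed
    show "\<exists>\<kappa>0>0.
       (\<forall>\<kappa>. 0 < \<kappa> \<and> \<kappa> < \<kappa>0 \<longrightarrow>
          (\<forall>n. 1 \<le> n \<and> n \<le> N0 \<longrightarrow>
             (\<exists>lam\<in>toy_ev_below1 \<kappa>. finite {\<mu> \<in> toy_ev_below1 \<kappa>. \<mu> < lam} \<and>
                card {\<mu> \<in> toy_ev_below1 \<kappa>. \<mu> < lam} = n - 1))) \<and>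
       (\<forall>n. 1 \<le> n \<and> n \<le> N0 \<longrightarrow>
          (\<exists>\<kappa>1>0. \<kappa>1 \<le> \<kappa>0 \<and>
             (\<forall>\<kappa>. 0 < \<kappa> \<and> \<kappa> < \<kappa>1 \<longrightarrow>
                (\<exists>s. (\<lambda>j. a n j * \<kappa> powr (real j / 3)) sums s \<and>
                     toy_ev \<kappa> n = \<kappa> powr (2/3) * s))))"
    proof (rule exI[of _ "h0 ^ 3"], intro conjI allI impI)
      show "h0 ^ 3 > 0" using h0 by simp
    next
      fix \<kappa> n assume \<kappa>: "0 < \<kappa> \<and> \<kappa> < h0 ^ 3" and n: "1 \<le> n \<and> n \<le> N0"
      obtain h where h: "0 < h" "h < h0" "\<kappa> = h ^ 3" using cube \<kappa> by blast
      show "\<exists>lam\<in>toy_ev_below1 \<kappa>. finite {\<mu> \<in> toy_ev_below1 \<kappa>. \<mu> < lam} \<and>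
                card {\<mu> \<in> toy_ev_below1 \<kappa>. \<mu> < lam} = n - 1"
        using H[OF h(1,2) n] unfolding h(3) by blast
    next
      fix n assume n: "1 \<le> n \<and> n \<le> N0"
      have "\<exists>s. (\<lambda>j. a n j * \<kappa> powr (real j / 3)) sums s \<and> toy_ev \<kappa> n = \<kappa> powr (2/3) * s"
        if \<kappa>: "0 < \<kappa>" "\<kappa> < h0 ^ 3" for \<kappa>
      proof -
        obtain h where h: "0 < h" "h < h0" "\<kappa> = h ^ 3" "\<And>j. \<kappa> powr (real j / 3) = h ^ j"
          using cube[OF \<kappa>] by blast
        note Hn = H[OF h(1,2) n]
        have "(\<lambda>j. a n j * \<kappa> powr (real j / 3)) sums b n h"
          unfolding h(4) b_def by (rule summable_sums[OF Hn(1)])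
        moreover have "toy_ev \<kappa> n = h\<^sup>2 * b n h"
          unfolding toy_ev_def h(3) by (rule nth_smallest_eqI[OF Hn(2-4)])
        moreover have "\<kappa> powr (2/3) = h\<^sup>2" using h(4)[of 2] by simp
        ultimately show ?thesis by auto
      qed
      \<comment> \<open>Here \<kappa>1 can be \<kappa>0 itself, since the expansions hold for all n
        up to N0 on one common interval.\<close>
      then show "\<exists>\<kappa>1>0. \<kappa>1 \<le> h0 ^ 3 \<and>
             (\<forall>\<kappa>. 0 < \<kappa> \<and> \<kappa> < \<kappa>1 \<longrightarrow>
                (\<exists>s. (\<lambda>j. a n j * \<kappa> powr (real j / 3)) sums s \<and>
                     toy_ev \<kappa> n = \<kappa> powr (2/3) * s))"
        using h0 by (intro exI[of _ "h0 ^ 3"]) auto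
    qed
  qed
qed

end
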